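(* Let $G$ be of type $F_4$. For $\gamma=a_1\alpha_1^\vee+a_2\alpha_2^\vee+a_3\alpha_3^\vee+a_4\alpha_4^\vee\in Q^\vee$, \begin{align*} \mathbf m_{w_{\epsilon_1+\epsilon_2}}^{w_\gamma}&=\tfrac12\|\gamma\|+\tfrac14\big(\mathbf 1_{a_1\not\equiv0\bmod2}+\mathbf 1_{a_1\not\equiv a_2\bmod2}+\mathbf 1_{a_2\not\equiv0\bmod2}\big)\\ \mathbf m_{w_{\epsilon_1+\epsilon_3}}^{w_\gamma}&=\|\gamma\|-\lfloor\tfrac{a_1}2\rfloor\\ \mathbf m_{w_{\epsilon_1+\epsilon_4}}^{w_\gamma}&=\tfrac32\|\gamma\|-\tfrac12a_2+\tfrac14\big(\mathbf 1_{a_1\not\equiv0\bmod2}+\mathbf 1_{a_1\not\equiv a_2\bmod2}-\mathbf 1_{a_2\not\equiv0\bmod2}\big)\\ \mathbf m_{w_{\epsilon_1-\epsilon_4}}^{w_\gamma}&=2\|\gamma\|-a_3\\ \mathbf m_{w_{\epsilon_2+\epsilon_3}}^{w_\gamma}&=\|\gamma\|-a_4\\ \mathbf m_{w_{\epsilon_1-\epsilon_3}}^{w_\gamma}&=\tfrac32\|\gamma\|-\tfrac12a_2-\tfrac14\big(\mathbf 1_{a_1\not\equiv0\bmod2}+\mathbf 1_{a_1\not\equiv a_2\bmod2}-\mathbf 1_{a_2\not\equiv0\bmod2}\big)\\ \mathbf m_{w_{\epsilon_1-\epsilon_2}}^{w_\gamma}&=\|\gamma\|-\lceil\tfrac{a_1}2\rceil\\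 \mathbf m_{w_{2\epsilon_1}}^{w_\gamma}&=\tfrac12\|\gamma\|-\tfrac14\big(\mathbf 1_{a_1\not\equiv0\bmod2}+\mathbf 1_{a_1\not\equiv a_2\bmod2}+\mathbf 1_{a_2\not\equiv0\bmod2}\big). \end{align*}
   Context: $Q^\vee$ is the coroot lattice of $G$, with simple coroots $\alpha_1^\vee=\epsilon_2-\epsilon_3$, $\alpha_2^\vee=\epsilon_3-\epsilon_4$, $\alpha_3^\vee=2\epsilon_4$, $\alpha_4^\vee=\epsilon_1-\epsilon_2-\epsilon_3-\epsilon_4$ in $\mathbb R^4$ (standard inner product; $\alpha_1^\vee,\alpha_2^\vee$ short, $\alpha_3^\vee,\alpha_4^\vee$ long); the highest short coroot is $\theta^\vee=\epsilon_1+\epsilon_2$. $\|\gamma\|=a_1^2+a_2^2+2a_3^2+2a_4^2-a_1a_2-2a_2a_3-2a_3a_4$ is the square length normalized so that short coroots have length $1$. $W$ is the Weyl group, $\widehat W=Q^\vee\rtimes W$ the affine Weyl group with simple reflections $s_i=s_{\alpha_i^\vee}$ and $s_0=t_{\theta^\vee}s_{\theta^\vee}$; $\epsilon(\cdot)$ is its sign character; $w_\gamma$ is the shortest element of $t_\gamma W$. The integers $\mathbf m_v^w$ are values at $q=1$ of inverse Kazhdan–Lusztig polynomials of $\widehat W$: with $C_v=\sum_{w\preccurlyeq v}P_{w,v}(1)w\in\mathbb Z[\widehat W]$ ($P_{w,v}$ the Kazhdan–Lusztig polynomials), $w=\sum_{v\preccurlyeq w}\epsilon(wv^{-1})\mathbf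 m_v^wC_v$. $\mathbf 1_P$ is $1$ if $P$ holds and $0$ otherwise. *)

theory Defs
  imports
    "HOL-Analysis.Analysis"
    "HOL-Algebra.Coset"
    "HOL-Computational_Algebra.Polynomial"
    "HOL-Library.Poly_Mapping"
    "HOL-Number_Theory.Cong"
begin

section \<open>Kazhdan-Lusztig theory of a Coxeter system\<close>

text \<open>
  Throughout this section \<open>G\<close> is a group and \<open>S \<subseteq> carrier G\<close> is a set of involutive generators
  such that \<open>(G, S)\<close> is a Coxeter system.
\<close>

definition cox_length :: "('g, 'm) monoid_scheme \<Rightarrow> 'g set \<Rightarrow> 'g \<Rightarrow> nat" where
  "cox_length G S w =
     (LEAST n. \<exists>ss. set ss \<subseteq> S \<and> length ss = n \<and> foldr (mult G) ss \<one>\<^bsub>G\<^esub> = w)"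

text \<open>The sign character: the homomorphism to \<open>{1, -1}\<close> sending every element of \<open>S\<close> to \<open>-1\<close>.\<close>

definition cox_sign :: "('g, 'm) monoid_scheme \<Rightarrow> 'g set \<Rightarrow> 'g \<Rightarrow> int" where
  "cox_sign G S w = (-1) ^ cox_length G S w"

definition cox_reflections :: "('g, 'm) monoid_scheme \<Rightarrow> 'g set \<Rightarrow> 'g set" where
  "cox_reflections G S = {x \<otimes>\<^bsub>G\<^esub> s \<otimes>\<^bsub>G\<^esub> inv\<^bsub>G\<^esub> x | x s. x \<in> carrier G \<and> s \<in> S}"

definition bruhat_le :: "('g, 'm) monoid_scheme \<Rightarrow> 'g set \<Rightarrow> 'g \<Rightarrow> 'g \<Rightarrow> bool" where
  "bruhat_le G S x y \<longleftrightarrow> x \<in> carrier G \<and> y \<in> carrier G \<and>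
     (x, y) \<in> {(u, t \<otimes>\<^bsub>G\<^esub> u) | u t. u \<in> carrier G \<and> t \<in> cox_reflections G S \<and>
                 cox_length G S u < cox_length G S (t \<otimes>\<^bsub>G\<^esub> u)}\<^sup>*"

text \<open>
  The \<open>R\<close>-polynomials \<open>R\<^bsub>u,v\<^esub>\<close> and the Kazhdan-Lusztig polynomials \<open>P\<^bsub>u,v\<^esub>\<close>, in the variable
  \<open>q = monom 1 1\<close>, are defined as in Bjoerner-Brenti, Combinatorics of Coxeter Groups, Theorems
  5.1.1 and 5.1.4: each is the unique family of integer polynomials with the properties below.
  Equivalently, \<open>R\<close> collects (up to signs and powers of \<open>q\<close>) the coefficients of the inverses of the standard basis elements
  of the Hecke algebra with \<open>T\<^sub>s\<^sup>2 = (q - 1) T\<^sub>s + q\<close>, and the condition on \<open>P\<close> is invariance of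
  \<open>q\<close> to the power \<open>-l(v)/2\<close> times \<open>\<Sum>u. P\<^bsub>u,v\<^esub> T\<^sub>u\<close> under the bar involution.
\<close>

definition is_R_family ::
  "('g, 'm) monoid_scheme \<Rightarrow> 'g set \<Rightarrow> ('g \<Rightarrow> 'g \<Rightarrow> int poly) \<Rightarrow> bool" where
  "is_R_family G S R \<longleftrightarrow>
     (\<forall>u v. \<not> bruhat_le G S u v \<longrightarrow> R u v = 0) \<and>
     (\<forall>u \<in> carrier G. R u u = 1) \<and>
     (\<forall>u \<in> carrier G. \<forall>v \<in> carrier G. \<forall>s \<in> S.
        cox_length G S (v \<otimes>\<^bsub>G\<^esub> s) < cox_length G S v \<longrightarrow>
        R u v =
          (if cox_length G S (u \<otimes>\<^bsub>G\<^esub> s) < cox_length G S u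
           then R (u \<otimes>\<^bsub>G\<^esub> s) (v \<otimes>\<^bsub>G\<^esub> s)
           else monom 1 1 * R (u \<otimes>\<^bsub>G\<^esub> s) (v \<otimes>\<^bsub>G\<^esub> s) + (monom 1 1 - 1) * R u (v \<otimes>\<^bsub>G\<^esub> s)))"

definition R_poly :: "('g, 'm) monoid_scheme \<Rightarrow> 'g set \<Rightarrow> 'g \<Rightarrow> 'g \<Rightarrow> int poly" where
  "R_poly G S = (THE R. is_R_family G S R)"

text \<open>
  Since \<open>reflect_poly p\<close> is \<open>q ^ degree p * p (1/q)\<close>, the left-hand side of the last condition is
  \<open>q\<close> to the power \<open>l(v) - l(u)\<close> times \<open>P\<^bsub>u,v\<^esub>(1/q)\<close>; the degree bound ensures that the
  subtractions do not truncate.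
\<close>

definition is_KL_family ::
  "('g, 'm) monoid_scheme \<Rightarrow> 'g set \<Rightarrow> ('g \<Rightarrow> 'g \<Rightarrow> int poly) \<Rightarrow> bool" where
  "is_KL_family G S P \<longleftrightarrow>
     (\<forall>u v. \<not> bruhat_le G S u v \<longrightarrow> P u v = 0) \<and>
     (\<forall>u \<in> carrier G. P u u = 1) \<and>
     (\<forall>u v. bruhat_le G S u v \<and> u \<noteq> v \<longrightarrow>
        2 * degree (P u v) + cox_length G S u + 1 \<le> cox_length G S v) \<and>
     (\<forall>u v. bruhat_le G S u v \<longrightarrow>
        monom 1 (cox_length G S v - cox_length G S u - degree (P u v)) * reflect_poly (P u v) =
        (\<Sum>a | bruhat_le G S u a \<and> bruhat_le G S a v. R_poly G S u a * P a v))"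

definition KL_poly :: "('g, 'm) monoid_scheme \<Rightarrow> 'g set \<Rightarrow> 'g \<Rightarrow> 'g \<Rightarrow> int poly" where
  "KL_poly G S = (THE P. is_KL_family G S P)"

text \<open>
  The additive group of the group ring \<open>\<int>[G]\<close> is rendered as the free abelian group
  \<^typ>\<open>'g \<Rightarrow>\<^sub>0 int\<close>; its multiplication is not needed.
\<close>

definition KL_basis :: "('g, 'm) monoid_scheme \<Rightarrow> 'g set \<Rightarrow> 'g \<Rightarrow> ('g \<Rightarrow>\<^sub>0 int)" where
  "KL_basis G S v =
     (\<Sum>w | bruhat_le G S w v. frag_cmul (poly (KL_poly G S w v) 1) (frag_of w))"

text \<open>
  \<open>inv_KL G S v w\<close> is the integer \<open>m\<close> with lower index \<open>v\<close> and upper index \<open>w\<close>; it is \<open>0\<close>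
  unless \<open>v \<le> w\<close> in the Bruhat order.
\<close>

definition inv_KL :: "('g, 'm) monoid_scheme \<Rightarrow> 'g set \<Rightarrow> 'g \<Rightarrow> 'g \<Rightarrow> int" where
  "inv_KL G S v w =
     (THE m :: 'g \<Rightarrow> int.
        (\<forall>x. \<not> bruhat_le G S x w \<longrightarrow> m x = 0) \<and>
        frag_of w =
          (\<Sum>x | bruhat_le G S x w.
             frag_cmul (cox_sign G S (w \<otimes>\<^bsub>G\<^esub> inv\<^bsub>G\<^esub> x) * m x) (KL_basis G S x))) v"


section \<open>The affine Weyl group of type \<open>F\<^sub>4\<close>\<close>

type_synonym aff_elt = "(real ^ 4) \<times> (real ^ 4 \<Rightarrow> real ^ 4)"

abbreviation eps :: "4 \<Rightarrow> real ^ 4" where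
  "eps i \<equiv> axis i 1"

definition alpha1 :: "real ^ 4" where "alpha1 = eps 2 - eps 3"
definition alpha2 :: "real ^ 4" where "alpha2 = eps 3 - eps 4"
definition alpha3 :: "real ^ 4" where "alpha3 = 2 *\<^sub>R eps 4"
definition alpha4 :: "real ^ 4" where "alpha4 = eps 1 - eps 2 - eps 3 - eps 4"

definition theta :: "real ^ 4" where "theta = eps 1 + eps 2"

definition coroot_comb :: "int \<Rightarrow> int \<Rightarrow> int \<Rightarrow> int \<Rightarrow> real ^ 4" where
  "coroot_comb a1 a2 a3 a4 =
     of_int a1 *\<^sub>R alpha1 + of_int a2 *\<^sub>R alpha2 + of_int a3 *\<^sub>R alpha3 + of_int a4 *\<^sub>R alpha4"

definition coroot_lattice :: "(real ^ 4) set" where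
  "coroot_lattice = {coroot_comb a1 a2 a3 a4 | a1 a2 a3 a4. True}"

definition sq_length :: "real ^ 4 \<Rightarrow> real" where
  "sq_length x = (x \<bullet> x) / (theta \<bullet> theta)"

lemma sq_length_coroot_comb:
  "sq_length (coroot_comb a1 a2 a3 a4) =
     of_int (a1^2 + a2^2 + 2 * a3^2 + 2 * a4^2 - a1 * a2 - 2 * a2 * a3 - 2 * a3 * a4)"
  apply (simp add: sq_length_def coroot_comb_def theta_def alpha1_def alpha2_def alpha3_def
      alpha4_def inner_vec_def sum_4 axis_def power2_eq_square algebra_simps)
  apply (simp add: field_simps)
  done

definition reflection :: "real ^ 4 \<Rightarrow> real ^ 4 \<Rightarrow> real ^ 4" where
  "reflection a x = x - (2 * (x \<bullet> a) / (a \<bullet> a)) *\<^sub>R a"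

inductive_set weyl_group :: "(real ^ 4 \<Rightarrow> real ^ 4) set" where
  id: "id \<in> weyl_group"
| refl: "u \<in> weyl_group \<Longrightarrow> a \<in> {alpha1, alpha2, alpha3, alpha4} \<Longrightarrow> reflection a \<circ> u \<in> weyl_group"

text \<open>
  The semidirect product of the coroot lattice and the Weyl group: the pair \<open>(\<gamma>, u)\<close> stands for
  \<open>t\<^sub>\<gamma> u\<close>.
\<close>

definition affine_weyl :: "aff_elt monoid" where
  "affine_weyl =
     \<lparr> carrier = coroot_lattice \<times> weyl_group,
       mult = (\<lambda>(x, u) (y, v). (x + u y, u \<circ> v)),
       one = (0, id) \<rparr>"

definition translation :: "real ^ 4 \<Rightarrow> aff_elt" where
  "translation x = (x, id)"

definition embed_weyl :: "(real ^ 4 \<Rightarrow> real ^ 4) \<Rightarrow> aff_elt" where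
  "embed_weyl u = (0, u)"

definition simple_reflections :: "aff_elt set" where
  "simple_reflections =
     (\<lambda>a. embed_weyl (reflection a)) ` {alpha1, alpha2, alpha3, alpha4} \<union>
     {translation theta \<otimes>\<^bsub>affine_weyl\<^esub> embed_weyl (reflection theta)}"

definition w_min :: "real ^ 4 \<Rightarrow> aff_elt" where
  "w_min x = arg_min (cox_length affine_weyl simple_reflections)
     (\<lambda>w. w \<in> translation x <#\<^bsub>affine_weyl\<^esub> (embed_weyl ` weyl_group))"

abbreviation m_aff ::
  "aff_elt \<Rightarrow> aff_elt \<Rightarrow> real" where
  "m_aff v w \<equiv> real_of_int (inv_KL affine_weyl simple_reflections v w)"

end

theory Submission
  imports Defs
begin

text \<open>
  An element of the affine Weyl group has a unique reduced expression ending in \<open>s\<^sub>0\<close> exactly if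
  it is one of the eight \<open>w\<^bsub>\<gamma>'\<^esub>\<close> in the lower indices. Modulo the basis elements \<open>C\<^sub>v\<close>
  with \<open>v\<close> neither one of these eight nor the identity, the group ring becomes a module of rank
  nine on which the simple reflections act through a tree. Up to sign, the
  coordinates of \<open>w\<close> in it are the integers \<open>\<^bold>m\<^sub>v (w)\<close> in question, so as functions of \<open>w\<close> these
  are determined by \<open>\<^bold>m\<^sub>v (1) = 0\<close> and by the rule
  that \<open>\<^bold>m\<^sub>v (s w)\<close> is \<open>\<^bold>m\<^sub>v (w)\<close> if \<open>s v > v\<close>, and otherwise the sum of the \<open>\<^bold>m\<^sub>u (w)\<close> over the
  neighbours \<open>u\<close> of \<open>v\<close> in the tree (with \<open>\<^bold>m\<^sub>1 = 1\<close>) minus \<open>\<^bold>m\<^sub>v (w)\<close>. The quadratic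
  quasi-polynomials of the theorem satisfy these rules.
\<close>

section \<open>Coxeter groups through separation by walls\<close>

text \<open>The quotient module is never formed. Its coordinates are treated as linear functionals
  on the group ring: up to sign, \<open>m i\<close> is shown to take the value 1 on C_v for v =
  \<open>V i\<close> and 0 on every other C_y, by induction on the length of y. The input is the
  product formula for C_s C_y together with the mu-coefficients along the tree. The obstacle is that
  the R-polynomials, the Kazhdan-Lusztig polynomials and the inverse coefficients are all definite
  descriptions, so existence and uniqueness of each has to be proved, starting from the exchange
  condition. Without the identity the tree is the affine E7 diagram, and labelling its nodes by
  their left descents folds it onto affine F4. The coefficients 1/2, 1, 3/2, 2, 1, 3/2, 1, 1/2 of
  the square length are half the marks 1, 2, 3, 4, 2, 3, 2, 1 of affine E7, the vector in which
  twice each entry is the sum over its neighbours. The identity, with its constant coordinate 1, is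
  attached to the end node s_0 and is the only inhomogeneous term of the recursion.\<close>

text \<open>
  The predicate \<open>sep t w\<close> is to be read as: the wall of the reflection \<open>t\<close> separates the
  fundamental chamber from its image under \<open>w\<close>. The cocycle rule \<open>sep_mult\<close> is all that is
  needed to obtain the strong exchange condition.
\<close>

locale coxeter_walls = group G for G (structure) +
  fixes S :: "'a set" and sep :: "'a \<Rightarrow> 'a \<Rightarrow> bool"
  assumes S_carrier: "S \<subseteq> carrier G"
    and finite_S: "finite S"
    and S_square: "s \<in> S \<Longrightarrow> s \<otimes> s = \<one>"
    and S_generates: "w \<in> carrier G \<Longrightarrow> \<exists>ss. set ss \<subseteq> S \<and> foldr (\<otimes>) ss \<one> = w"
    and sep_one: "t \<in> cox_reflections G S \<Longrightarrow> \<not> sep t \<one>"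
    and sep_mult: "\<lbrakk>t \<in> cox_reflections G S; s \<in> S; w \<in> carrier G\<rbrakk> \<Longrightarrow>
      sep t (s \<otimes> w) \<longleftrightarrow> (t = s) \<noteq> sep (s \<otimes> t \<otimes> s) w"
begin

abbreviation len :: "'a \<Rightarrow> nat" where "len \<equiv> cox_length G S"
abbreviation T :: "'a set" where "T \<equiv> cox_reflections G S"
abbreviation wprod :: "'a list \<Rightarrow> 'a" where "wprod ss \<equiv> foldr (\<otimes>) ss \<one>"
abbreviation below :: "'a \<Rightarrow> 'a \<Rightarrow> bool"  (infix \<open>\<unlhd>\<close> 50) where "u \<unlhd> v \<equiv> bruhat_le G S u v"

lemma S_closed [simp]: "s \<in> S \<Longrightarrow> s \<in> carrier G"
  using S_carrier by blast

lemma S_inv: "s \<in> S \<Longrightarrow> inv s = s"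
  by (simp add: S_square inv_equality)

lemma S_cancel [simp]:
  assumes "s \<in> S" "w \<in> carrier G"
  shows "s \<otimes> (s \<otimes> w) = w" "w \<otimes> s \<otimes> s = w"
  using assms by (simp_all add: S_square m_assoc flip: m_assoc[of s s w])

lemma S_mult_eq_iff: "\<lbrakk>s \<in> S; u \<in> carrier G; v \<in> carrier G\<rbrakk> \<Longrightarrow> s \<otimes> u = v \<longleftrightarrow> u = s \<otimes> v"
  by auto

lemma wprod_closed [simp]: "set ss \<subseteq> S \<Longrightarrow> wprod ss \<in> carrier G"
  by (induction ss) auto

lemma foldr_mult_wprod: "\<lbrakk>set xs \<subseteq> S; a \<in> carrier G\<rbrakk> \<Longrightarrow> foldr (\<otimes>) xs a = wprod xs \<otimes> a"
  by (induction xs) (auto simp: m_assoc)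

lemma wprod_append: "\<lbrakk>set xs \<subseteq> S; set ys \<subseteq> S\<rbrakk> \<Longrightarrow> wprod (xs @ ys) = wprod xs \<otimes> wprod ys"
  using foldr_mult_wprod[of xs "wprod ys"] by simp

lemma wprod_rev: "set xs \<subseteq> S \<Longrightarrow> wprod (rev xs) = inv (wprod xs)"
proof (induction xs)
  case (Cons s xs)
  have "wprod (rev (s # xs)) = wprod (rev xs) \<otimes> s"
    using Cons.prems wprod_append[of "rev xs" "[s]"] by simp
  thus ?case using Cons by (simp add: inv_mult_group S_inv)
qed simp

lemma len_le: "set ss \<subseteq> S \<Longrightarrow> len (wprod ss) \<le> length ss"
  unfolding cox_length_def by (rule Least_le) auto

lemma reduced_word:
  assumes "w \<in> carrier G"
  shows "\<exists>ss. set ss \<subseteq> S \<and> length ss = len w \<and> wprod ss = w"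
proof -
  have "\<exists>n ss. set ss \<subseteq> S \<and> length ss = n \<and> wprod ss = w"
    using S_generates[OF assms] by auto
  thus ?thesis
    unfolding cox_length_def by (rule LeastI_ex)
qed

lemma len_one [simp]: "len \<one> = 0"
  using len_le[of "[]"] by simp

lemma len_eq_0: "w \<in> carrier G \<Longrightarrow> len w = 0 \<longleftrightarrow> w = \<one>"
  using reduced_word[of w] by auto

lemma len_left_le:
  assumes "s \<in> S" "w \<in> carrier G" shows "len (s \<otimes> w) \<le> Suc (len w)"
proof -
  obtain ss where "set ss \<subseteq> S" "length ss = len w" "wprod ss = w"
    using reduced_word[OF assms(2)] by blast
  thus ?thesis using len_le[of "s # ss"] assms by simp
qed

lemma len_inv [simp]:
  assumes "w \<in> carrier G" shows "len (inv w) = len w"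
proof -
  have *: "len (inv w) \<le> len w" if w: "w \<in> carrier G" for w
  proof -
    obtain ss where ss: "set ss \<subseteq> S" "length ss = len w" "wprod ss = w"
      using reduced_word[OF w] by blast
    moreover have "set (rev ss) \<subseteq> S" using ss by simp
    ultimately show ?thesis using len_le[of "rev ss"] wprod_rev[of ss] by (simp only: length_rev)
  qed
  show ?thesis using *[OF assms] *[of "inv w"] assms by simp
qed

section \<open>Reflections and the strong exchange condition\<close>

lemma T_closed [simp]: "t \<in> T \<Longrightarrow> t \<in> carrier G"
  by (auto simp: cox_reflections_def)

lemma S_in_T: "s \<in> S \<Longrightarrow> s \<in> T"
  unfolding cox_reflections_def by (rule CollectI, rule exI[of _ \<one>], rule exI[of _ s]) simp

lemma T_conj:
  assumes "t \<in> T" "x \<in> carrier G"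
  shows "x \<otimes> t \<otimes> inv x \<in> T"
proof -
  obtain y s where ys: "y \<in> carrier G" "s \<in> S" "t = y \<otimes> s \<otimes> inv y"
    using assms unfolding cox_reflections_def by blast
  hence "x \<otimes> t \<otimes> inv x = (x \<otimes> y) \<otimes> s \<otimes> inv (x \<otimes> y)"
    using assms by (simp add: inv_mult_group m_assoc)
  thus ?thesis using ys assms unfolding cox_reflections_def by blast
qed

lemma T_conj_inv: "\<lbrakk>t \<in> T; x \<in> carrier G\<rbrakk> \<Longrightarrow> inv x \<otimes> t \<otimes> x \<in> T"
  using T_conj[of t "inv x"] by simp

lemma T_conj_S: "\<lbrakk>t \<in> T; s \<in> S\<rbrakk> \<Longrightarrow> s \<otimes> t \<otimes> s \<in> T"
  using T_conj[of t s] by (simp add: S_inv)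

lemma T_square: assumes "t \<in> T" shows "t \<otimes> t = \<one>"
proof -
  obtain x s where xs: "x \<in> carrier G" "s \<in> S" "t = x \<otimes> s \<otimes> inv x"
    using assms unfolding cox_reflections_def by blast
  have "t \<otimes> t = x \<otimes> (s \<otimes> (inv x \<otimes> x \<otimes> (s \<otimes> inv x)))"
    using xs by (simp only: m_assoc S_closed m_closed inv_closed)
  thus ?thesis using xs by simp
qed

lemma T_cancel: "\<lbrakk>t \<in> T; w \<in> carrier G\<rbrakk> \<Longrightarrow> t \<otimes> (t \<otimes> w) = w"
  by (simp add: T_square flip: m_assoc)

text \<open>Reading the word from the left, the wall of t is crossed at a letter that equals t
  conjugated by the letters before it. Deleting this letter multiplies the product by t on the
  left.\<close>

lemma exchange:
  assumes "set ss \<subseteq> S" "t \<in> T" "sep t (wprod ss)"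
  obtains rs where "set rs \<subseteq> S" "Suc (length rs) = length ss" "wprod rs = t \<otimes> wprod ss"
proof -
  have "\<exists>rs. set rs \<subseteq> S \<and> Suc (length rs) = length ss \<and> wprod rs = t \<otimes> wprod ss"
    using assms
  proof (induction ss arbitrary: t)
    case Nil
    thus ?case using sep_one by simp
  next
    case (Cons s ss)
    show ?case
    proof (cases "t = s")
      case True
      thus ?thesis using Cons.prems by (intro exI[of _ ss]) auto
    next
      case False
      hence "sep (s \<otimes> t \<otimes> s) (wprod ss)"
        using Cons.prems sep_mult[of t s "wprod ss"] by auto
      then obtain rs where rs: "set rs \<subseteq> S" "Suc (length rs) = length ss"
          "wprod rs = (s \<otimes> t \<otimes> s) \<otimes> wprod ss"
        using Cons.IH[of "s \<otimes> t \<otimes> s"] Cons.prems T_conj_S by auto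
      have "wprod (s # rs) = t \<otimes> wprod (s # ss)"
        using Cons.prems rs by (simp add: m_assoc)
      thus ?thesis using rs Cons.prems by (intro exI[of _ "s # rs"]) auto
    qed
  qed
  thus ?thesis using that by blast
qed

text \<open>Modulo 2, the walls crossed on the way to x w are those crossed by x together with the
  x-translates of those crossed by w. Induction on a word for x reduces this to
  \<open>sep_mult\<close>.\<close>

lemma sep_cocycle:
  assumes "t \<in> T" "x \<in> carrier G" "w \<in> carrier G"
  shows "sep t (x \<otimes> w) \<longleftrightarrow> sep t x \<noteq> sep (inv x \<otimes> t \<otimes> x) w"
proof -
  have "sep t (wprod ss \<otimes> w) \<longleftrightarrow> sep t (wprod ss) \<noteq> sep (inv (wprod ss) \<otimes> t \<otimes> wprod ss) w"
    if "set ss \<subseteq> S" "t \<in> T" for ss t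
    using that
  proof (induction ss arbitrary: t)
    case Nil
    thus ?case using assms sep_one by simp
  next
    case (Cons s ss)
    let ?p = "wprod ss"
    have c: "s \<in> S" "t \<in> carrier G" "?p \<in> carrier G" "w \<in> carrier G"
      using Cons.prems assms by auto
    have "inv (s \<otimes> ?p) \<otimes> t \<otimes> (s \<otimes> ?p) = inv ?p \<otimes> (s \<otimes> t \<otimes> s) \<otimes> ?p"
      using c by (simp add: inv_mult_group m_assoc S_inv)
    thus ?case
      using Cons.IH[of "s \<otimes> t \<otimes> s"] c T_conj_S[OF Cons.prems(2) c(1)]
        sep_mult[of t s "?p \<otimes> w"] sep_mult[of t s ?p] Cons.prems
      by (auto simp: m_assoc)
  qed
  moreover obtain ss where "set ss \<subseteq> S" "wprod ss = x" using S_generates assms by blast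
  ultimately show ?thesis using assms by blast
qed

lemma sep_S:
  assumes "t \<in> T" "s \<in> S" shows "sep t s \<longleftrightarrow> t = s"
  using sep_mult[of t s \<one>] sep_one[OF T_conj_S[OF assms]] assms by simp

text \<open>For t = x s x^-1, the cocycle expansions of t = x (s x^-1) and of 1 = x x^-1 differ
  exactly by the term \<open>sep s s\<close>, which is true.\<close>

lemma sep_self: assumes "t \<in> T" shows "sep t t"
proof -
  obtain x s where xs: "x \<in> carrier G" "s \<in> S" "t = x \<otimes> s \<otimes> inv x"
    using assms unfolding cox_reflections_def by blast
  have e1: "inv x \<otimes> t \<otimes> x = s"
    using xs by (simp add: m_assoc flip: m_assoc[of "inv x" x])
  have e2: "inv s \<otimes> s \<otimes> s = s" using xs by simp
  have "sep t t \<longleftrightarrow> sep t x \<noteq> sep s (s \<otimes> inv x)"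
    using sep_cocycle[OF assms, of x "s \<otimes> inv x"] xs e1 by (simp add: m_assoc)
  moreover have "sep s (s \<otimes> inv x) \<longleftrightarrow> sep s s \<noteq> sep s (inv x)"
    using sep_cocycle[of s s "inv x"] xs S_in_T e2 by simp
  moreover have "sep t (x \<otimes> inv x) \<longleftrightarrow> sep t x \<noteq> sep s (inv x)"
    using sep_cocycle[OF assms, of x "inv x"] xs e1 by simp
  ultimately show ?thesis using xs sep_one[OF assms] sep_S[of s s] S_in_T by auto
qed

lemma sep_T_mult: "\<lbrakk>t \<in> T; w \<in> carrier G\<rbrakk> \<Longrightarrow> sep t (t \<otimes> w) \<longleftrightarrow> \<not> sep t w"
  using sep_cocycle[of t t w] sep_self by (simp add: T_square flip: m_assoc)

text \<open>If the wall separates, \<open>exchange\<close> applied to a reduced word shortens it. If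
  not, it separates for t w by \<open>sep_T_mult\<close>, and the same argument runs from t w back
  to w.\<close>

theorem sep_iff_len:
  assumes "t \<in> T" "w \<in> carrier G"
  shows "sep t w \<longleftrightarrow> len (t \<otimes> w) < len w"
proof -
  have *: "len (t \<otimes> w) < len w" if st: "sep t w" and w: "w \<in> carrier G" for w
  proof -
    obtain ss where ss: "set ss \<subseteq> S" "length ss = len w" "wprod ss = w"
      using reduced_word[OF w] by blast
    obtain rs where "set rs \<subseteq> S" "Suc (length rs) = length ss" "wprod rs = t \<otimes> wprod ss"
      by (rule exchange[of ss t]) (use ss assms st in auto)
    thus ?thesis using len_le[of rs] ss by simp
  qed
  show ?thesis
    using *[of w] *[of "t \<otimes> w"] sep_T_mult[of t w] assms by (auto simp: T_cancel)
qed

lemma len_T_neq: "\<lbrakk>t \<in> T; w \<in> carrier G\<rbrakk> \<Longrightarrow> len (t \<otimes> w) \<noteq> len w"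
  using sep_iff_len[of t w] sep_iff_len[of t "t \<otimes> w"] sep_T_mult[of t w]
  by (auto simp: T_cancel)

lemma len_left:
  assumes "s \<in> S" "w \<in> carrier G"
  shows "if len (s \<otimes> w) < len w then len w = Suc (len (s \<otimes> w)) else len (s \<otimes> w) = Suc (len w)"
  using len_left_le[of s w] len_left_le[of s "s \<otimes> w"] len_T_neq[of s w] S_in_T assms by auto

lemma len_right:
  assumes "s \<in> S" "w \<in> carrier G"
  shows "if len (w \<otimes> s) < len w then len w = Suc (len (w \<otimes> s)) else len (w \<otimes> s) = Suc (len w)"
proof -
  have "inv (w \<otimes> s) = s \<otimes> inv w" using assms by (simp add: inv_mult_group S_inv)
  hence "len (s \<otimes> inv w) = len (w \<otimes> s)" using assms len_inv[of "w \<otimes> s"] by simp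
  moreover have "len (inv w) = len w" using assms by simp
  ultimately show ?thesis using len_left[of s "inv w"] assms(1) inv_closed[OF assms(2)] by metis
qed

lemma left_descent_exists:
  assumes "w \<in> carrier G" "w \<noteq> \<one>"
  obtains s where "s \<in> S" "len (s \<otimes> w) < len w"
proof -
  obtain ss where ss: "set ss \<subseteq> S" "length ss = len w" "wprod ss = w"
    using reduced_word[OF assms(1)] by blast
  then obtain s rs where "ss = s # rs" using assms by (cases ss) auto
  thus ?thesis using ss that[of s] len_le[of rs] by auto
qed

lemma right_descent_exists:
  assumes "w \<in> carrier G" "w \<noteq> \<one>"
  obtains s where "s \<in> S" "len (w \<otimes> s) < len w"
proof -
  obtain s where s: "s \<in> S" "len (s \<otimes> inv w) < len (inv w)"
    using left_descent_exists[of "inv w"] assms by (auto simp: inv_eq_1_iff)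
  have "inv (w \<otimes> s) = s \<otimes> inv w" using assms s by (simp add: inv_mult_group S_inv)
  hence "len (s \<otimes> inv w) = len (w \<otimes> s)" using assms s len_inv[of "w \<otimes> s"] by simp
  thus ?thesis using s assms that by simp
qed

lemma len_parity:
  assumes "x \<in> carrier G" "w \<in> carrier G"
  shows "even (len (x \<otimes> w)) \<longleftrightarrow> even (len x + len w)"
proof -
  have flip: "even (len (s \<otimes> u)) \<longleftrightarrow> odd (len u)" if "s \<in> S" "u \<in> carrier G" for s u
    using len_left[OF that] by (metis even_Suc)
  have "even (len (wprod ss \<otimes> u)) \<longleftrightarrow> even (length ss + len u)"
    if "set ss \<subseteq> S" "u \<in> carrier G" for ss u
    using that by (induction ss) (auto simp: m_assoc flip)
  moreover obtain ss where "set ss \<subseteq> S" "wprod ss = x" using S_generates assms by blast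
  ultimately show ?thesis using assms by (metis one_closed r_one len_one add_0_right even_add)
qed

lemma cox_sign_mult:
  "\<lbrakk>x \<in> carrier G; w \<in> carrier G\<rbrakk> \<Longrightarrow>
    cox_sign G S (x \<otimes> inv w) = (-1) ^ (len x + len w)"
  using len_parity[of x "inv w"] unfolding cox_sign_def
  by (metis inv_closed len_inv minus_one_power_iff)

text \<open>Passing from u to u s crosses a single wall, that of u s u^-1, so the side of the wall
  of t changes only if t = u s u^-1. This is the one configuration in which left and right descents
  interact.\<close>

lemma descents_meet:
  assumes "s \<in> S" "t \<in> S" "u \<in> carrier G"
    and "len (t \<otimes> u) < len u \<longleftrightarrow> \<not> len (t \<otimes> u \<otimes> s) < len (u \<otimes> s)"
  shows "t \<otimes> u = u \<otimes> s"
proof -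
  have r: "inv u \<otimes> t \<otimes> u \<in> T" using assms T_conj_inv S_in_T by simp
  have "sep t u \<longleftrightarrow> \<not> sep t (u \<otimes> s)"
    using assms sep_iff_len[of t u] sep_iff_len[of t "u \<otimes> s"] by (simp add: S_in_T m_assoc)
  hence "inv u \<otimes> t \<otimes> u = s"
    using sep_cocycle[of t u s] sep_S[OF r] assms S_in_T by auto
  thus ?thesis using assms by (metis S_closed m_assoc m_closed inv_closed r_inv l_one)
qed

subsection \<open>Bruhat order\<close>

definition edge :: "'a \<Rightarrow> 'a \<Rightarrow> bool" where
  "edge u v \<longleftrightarrow> u \<in> carrier G \<and> (\<exists>t\<in>T. v = t \<otimes> u \<and> len u < len v)"

lemma below_iff_edges: "u \<unlhd> v \<longleftrightarrow> u \<in> carrier G \<and> v \<in> carrier G \<and> edge\<^sup>*\<^sup>* u v"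
proof -
  have "{(u, t \<otimes> u) | u t. u \<in> carrier G \<and> t \<in> T \<and> len u < len (t \<otimes> u)} = {(u, v). edge u v}"
    by (auto simp: edge_def)
  thus ?thesis unfolding bruhat_le_def rtranclp_rtrancl_eq by simp
qed

lemma edge_below: "edge u v \<Longrightarrow> u \<unlhd> v"
  unfolding below_iff_edges by (auto simp: edge_def)

lemma below_refl [simp]: "u \<in> carrier G \<Longrightarrow> u \<unlhd> u"
  by (simp add: below_iff_edges)

lemma below_trans: "u \<unlhd> v \<Longrightarrow> v \<unlhd> w \<Longrightarrow> u \<unlhd> w"
  unfolding below_iff_edges by auto

lemma below_carrier: assumes "u \<unlhd> v" shows "u \<in> carrier G" "v \<in> carrier G"
  using assms by (auto simp: bruhat_le_def)

lemma below_len: assumes "u \<unlhd> v" shows "u = v \<or> len u < len v"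
proof -
  have "edge\<^sup>*\<^sup>* u v" using assms below_iff_edges by simp
  thus ?thesis
    by induction (auto simp: edge_def)
qed

lemma below_len_le: "u \<unlhd> v \<Longrightarrow> len u \<le> len v"
  using below_len by fastforce

lemma below_one: "u \<unlhd> \<one> \<Longrightarrow> u = \<one>"
  using below_len[of u \<one>] by simp

lemma S_below: "\<lbrakk>s \<in> S; u \<in> carrier G; len u < len (s \<otimes> u)\<rbrakk> \<Longrightarrow> u \<unlhd> s \<otimes> u"
  by (intro edge_below) (auto simp: edge_def S_in_T)

lemma S_below': "\<lbrakk>s \<in> S; u \<in> carrier G; len (s \<otimes> u) < len u\<rbrakk> \<Longrightarrow> s \<otimes> u \<unlhd> u"
  using S_below[of s "s \<otimes> u"] by simp

text \<open>Conjugation by s carries the wall of t to that of s t s and preserves separation, except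
  for the wall of s itself.\<close>

lemma edge_lift:
  assumes "s \<in> S" "t \<in> T" "u \<in> carrier G" "len u < len (t \<otimes> u)" "t \<noteq> s"
  shows "edge (s \<otimes> u) (s \<otimes> (t \<otimes> u))"
proof -
  let ?t = "s \<otimes> t \<otimes> s"
  have tT: "?t \<in> T" using assms T_conj_S by simp
  have c: "t \<in> carrier G" "s \<in> carrier G" using assms by auto
  have "?t \<noteq> s"
  proof
    assume "?t = s"
    hence "s \<otimes> (s \<otimes> t \<otimes> s) \<otimes> s = s \<otimes> s \<otimes> s" by simp
    thus False using assms c by (simp add: m_assoc S_square)
  qed
  moreover have "s \<otimes> ?t \<otimes> s = t" using assms c by (simp add: m_assoc S_square)
  moreover have "\<not> sep t u" using sep_iff_len[of t u] assms by simp
  ultimately have "\<not> sep ?t (s \<otimes> u)" using sep_mult[OF tT assms(1,3)] by simp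
  moreover have e: "?t \<otimes> (s \<otimes> u) = s \<otimes> (t \<otimes> u)" using assms c by (simp add: m_assoc)
  ultimately have "len (s \<otimes> u) < len (s \<otimes> (t \<otimes> u))"
    using sep_iff_len[OF tT, of "s \<otimes> u"] len_T_neq[OF tT, of "s \<otimes> u"] assms by auto
  thus ?thesis unfolding edge_def using e tT assms by force
qed

text \<open>The lifting property, along a chain of edges: multiplication by s carries each edge to
  an edge, except an edge that is itself multiplication by s, and that one merely exchanges the two
  alternatives.\<close>

lemma below_lift:
  assumes "u \<unlhd> v" "s \<in> S"
  shows "s \<otimes> u \<unlhd> v \<or> s \<otimes> u \<unlhd> s \<otimes> v"
proof -
  have "edge\<^sup>*\<^sup>* u v" "u \<in> carrier G" using assms below_iff_edges by auto
  thus ?thesis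
  proof induction
    case base
    thus ?case using assms by simp
  next
    case (step x y)
    then obtain t where t: "t \<in> T" "y = t \<otimes> x" "len x < len y" "x \<in> carrier G"
      by (auto simp: edge_def)
    show ?case
    proof (cases "t = s")
      case True
      thus ?thesis using step t assms edge_below[of x y] below_trans by auto
    next
      case False
      thus ?thesis
        using step t assms edge_below[of x y] edge_lift[of s t x] edge_below below_trans by blast
    qed
  qed
qed

lemma below_lift_up:
  assumes "u \<unlhd> v" "s \<in> S" "len v < len (s \<otimes> v)"
  shows "s \<otimes> u \<unlhd> s \<otimes> v"
  using below_lift[OF assms(1,2)] S_below[of s v] assms below_carrier below_trans by blast

lemma below_lift_down:
  assumes "u \<unlhd> v" "s \<in> S" "len (s \<otimes> v) < len v"
  shows "s \<otimes> u \<unlhd> v"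
  using below_lift[OF assms(1,2)] S_below'[of s v] assms below_carrier below_trans by blast

lemma finite_len_le: "finite {x \<in> carrier G. len x \<le> n}"
proof (rule finite_subset)
  show "{x \<in> carrier G. len x \<le> n} \<subseteq> wprod ` {ss. set ss \<subseteq> S \<and> length ss \<le> n}"
  proof
    fix x assume x: "x \<in> {x \<in> carrier G. len x \<le> n}"
    then obtain ss where "set ss \<subseteq> S" "length ss = len x" "wprod ss = x"
      using reduced_word by blast
    thus "x \<in> wprod ` {ss. set ss \<subseteq> S \<and> length ss \<le> n}" using x by auto
  qed
  show "finite (wprod ` {ss. set ss \<subseteq> S \<and> length ss \<le> n})"
    using finite_lists_length_le[OF finite_S] by simp
qed

lemma finite_below [simp]: "finite {x. x \<unlhd> w}"
  by (rule finite_subset[OF _ finite_len_le[of "len w"]])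
    (use below_carrier below_len_le in blast)

end

section \<open>R-polynomials\<close>

abbreviation X :: "int poly" where "X \<equiv> monom 1 (Suc 0)"

section \<open>Commuting left and right Hecke operators\<close>

context coxeter_walls
begin

definition agree :: "('a \<Rightarrow> int poly) \<Rightarrow> ('a \<Rightarrow> int poly) \<Rightarrow> bool"  (infix \<open>\<simeq>\<close> 50) where
  "F \<simeq> H \<longleftrightarrow> (\<forall>u\<in>carrier G. F u = H u)"

text \<open>
  \<open>lop\<close> and \<open>rop\<close> are the left-handed and right-handed versions of the recursion that defines the
  \<open>R\<close>-polynomials, acting on columns \<open>u \<mapsto> R u v\<close>. They commute, and \<open>lmop\<close>, which is \<open>q\<close> times the
  inverse of \<open>lop\<close>, satisfies the braid relations because it commutes with \<open>rmop\<close>.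
\<close>

definition lop :: "'a \<Rightarrow> ('a \<Rightarrow> int poly) \<Rightarrow> 'a \<Rightarrow> int poly" where
  "lop s F u = (if len (s \<otimes> u) < len u then F (s \<otimes> u) else X * F (s \<otimes> u) + (X - 1) * F u)"

definition rop :: "'a \<Rightarrow> ('a \<Rightarrow> int poly) \<Rightarrow> 'a \<Rightarrow> int poly" where
  "rop s F u = (if len (u \<otimes> s) < len u then F (u \<otimes> s) else X * F (u \<otimes> s) + (X - 1) * F u)"

definition lmop :: "'a \<Rightarrow> ('a \<Rightarrow> int poly) \<Rightarrow> 'a \<Rightarrow> int poly" where
  "lmop s F u = lop s F u - (X - 1) * F u"

definition rmop :: "'a \<Rightarrow> ('a \<Rightarrow> int poly) \<Rightarrow> 'a \<Rightarrow> int poly" where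
  "rmop s F u = rop s F u - (X - 1) * F u"

lemma agree_refl [simp]: "F \<simeq> F"
  by (simp add: agree_def)

lemma agree_sym: "F \<simeq> H \<Longrightarrow> H \<simeq> F"
  by (simp add: agree_def)

lemma agree_trans [trans]: "F \<simeq> H \<Longrightarrow> H \<simeq> K \<Longrightarrow> F \<simeq> K"
  by (simp add: agree_def)

lemma agreeD: "F \<simeq> H \<Longrightarrow> u \<in> carrier G \<Longrightarrow> F u = H u"
  by (simp add: agree_def)

lemma lop_cong: "s \<in> S \<Longrightarrow> F \<simeq> H \<Longrightarrow> lop s F \<simeq> lop s H"
  by (simp add: agree_def lop_def)

lemma rop_cong: "s \<in> S \<Longrightarrow> F \<simeq> H \<Longrightarrow> rop s F \<simeq> rop s H"
  by (simp add: agree_def rop_def)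

lemma lmop_cong: "s \<in> S \<Longrightarrow> F \<simeq> H \<Longrightarrow> lmop s F \<simeq> lmop s H"
  by (simp add: agree_def lop_def lmop_def)

lemma lmop_fun: "lmop s F = (\<lambda>u. lop s F u - (X - 1) * F u)"
  by (simp add: lmop_def fun_eq_iff)

lemma rmop_fun: "rmop s F = (\<lambda>u. rop s F u - (X - 1) * F u)"
  by (simp add: rmop_def fun_eq_iff)

lemma lop_scale: "lop s (\<lambda>u. c * F u) = (\<lambda>u. c * lop s F u)"
  by (auto simp: lop_def fun_eq_iff algebra_simps)

lemma lmop_scale: "lmop s (\<lambda>u. c * F u) = (\<lambda>u. c * lmop s F u)"
  by (auto simp: lmop_def lop_scale fun_eq_iff algebra_simps)

lemma lop_diff: "lop s (\<lambda>u. F u - H u) = (\<lambda>u. lop s F u - lop s H u)"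
  by (auto simp: lop_def fun_eq_iff algebra_simps)

lemma rop_diff: "rop s (\<lambda>u. F u - H u) = (\<lambda>u. rop s F u - rop s H u)"
  by (auto simp: rop_def fun_eq_iff algebra_simps)

lemma rop_scale: "rop s (\<lambda>u. c * F u) = (\<lambda>u. c * rop s F u)"
  by (auto simp: rop_def fun_eq_iff algebra_simps)

text \<open>If t u and u s differ, then by \<open>descents_meet\<close> neither multiplication
  affects whether the other is a descent, and the branches match. If they coincide, both operators
  read the same entries.\<close>

lemma lop_rop_commute:
  assumes "s \<in> S" "t \<in> S"
  shows "lop t (rop s F) \<simeq> rop s (lop t F)"
  unfolding agree_def
proof
  fix u assume u: "u \<in> carrier G"
  have a: "t \<otimes> u \<otimes> s = t \<otimes> (u \<otimes> s)" using u assms by (simp add: m_assoc)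
  show "lop t (rop s F) u = rop s (lop t F) u"
  proof (cases "t \<otimes> u = u \<otimes> s")
    case True
    have bk: "t \<otimes> (t \<otimes> u) = u" "u \<otimes> s \<otimes> s = u" using u assms by simp_all
    have "t \<otimes> (u \<otimes> s) = u" using bk True by simp
    thus ?thesis using bk by (simp add: lop_def rop_def True)
  next
    case False
    have l: "len (t \<otimes> u) < len u \<longleftrightarrow> len (t \<otimes> (u \<otimes> s)) < len (u \<otimes> s)"
      using descents_meet[of s t u] assms u False a by auto
    have r: "len (u \<otimes> s) < len u \<longleftrightarrow> len (t \<otimes> (u \<otimes> s)) < len (t \<otimes> u)"
      using l len_left[of t u] len_left[of t "u \<otimes> s"] len_right[of s u] len_right[of s "t \<otimes> u"]
        assms u a by (simp split: if_splits)
    show ?thesis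
      using l r by (simp add: lop_def rop_def a algebra_simps)
  qed
qed

lemma lmop_rmop_commute:
  assumes "s \<in> S" "t \<in> S"
  shows "lmop t (rmop s F) \<simeq> rmop s (lmop t F)"
proof -
  have "lmop t (rmop s F) u = rmop s (lmop t F) u" if "u \<in> carrier G" for u
    using agreeD[OF lop_rop_commute[OF assms] that, of F]
    by (simp only: lmop_fun rmop_fun lop_diff rop_diff lop_scale rop_scale) (simp add: algebra_simps)
  thus ?thesis by (simp add: agree_def)
qed

text \<open>The quadratic Hecke relation in the form L (L - (q - 1)) = q for L =
  \<open>lop s\<close>.\<close>

lemma lmop_lop:
  assumes "s \<in> S" shows "lmop s (lop s F) \<simeq> (\<lambda>u. X * F u)"
  unfolding agree_def
proof
  fix u assume "u \<in> carrier G"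
  thus "lmop s (lop s F) u = X * F u"
    using len_left[OF assms, of u] assms
    by (auto simp: lmop_def lop_def algebra_simps split: if_splits)
qed

lemma lop_lmop:
  assumes "s \<in> S" shows "lop s (lmop s F) \<simeq> (\<lambda>u. X * F u)"
  unfolding agree_def
proof
  fix u assume "u \<in> carrier G"
  thus "lop s (lmop s F) u = X * F u"
    using len_left[OF assms, of u] assms
    by (auto simp: lmop_def lop_def algebra_simps split: if_splits)
qed

lemma fold_lmop_cong: "set a \<subseteq> S \<Longrightarrow> F \<simeq> H \<Longrightarrow> fold lmop a F \<simeq> fold lmop a H"
  by (induction a arbitrary: F H) (auto simp: lmop_cong)

lemma fold_lmop_scale: "fold lmop a (\<lambda>u. c * F u) = (\<lambda>u. c * fold lmop a F u)"
  by (induction a arbitrary: F) (auto simp: lmop_scale)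

lemma foldr_lop_cong: "set a \<subseteq> S \<Longrightarrow> F \<simeq> H \<Longrightarrow> foldr lop a F \<simeq> foldr lop a H"
  by (induction a) (auto simp: lop_cong)

lemma foldr_lop_scale: "foldr lop a (\<lambda>u. c * F u) = (\<lambda>u. c * foldr lop a F u)"
  by (induction a) (auto simp: lop_scale)

lemma fold_lmop_rmop_commute:
  "set a \<subseteq> S \<Longrightarrow> s \<in> S \<Longrightarrow> fold lmop a (rmop s F) \<simeq> rmop s (fold lmop a F)"
proof (induction a arbitrary: F)
  case (Cons t a)
  have "fold lmop a (lmop t (rmop s F)) \<simeq> fold lmop a (rmop s (lmop t F))"
    using Cons.prems by (intro fold_lmop_cong lmop_rmop_commute) auto
  thus ?case using Cons by (auto intro: agree_trans)
qed simp

lemma foldr_lop_rop_commute: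
  "set a \<subseteq> S \<Longrightarrow> s \<in> S \<Longrightarrow> foldr lop a (rop s F) \<simeq> rop s (foldr lop a F)"
proof (induction a)
  case (Cons t a)
  have "lop t (foldr lop a (rop s F)) \<simeq> lop t (rop s (foldr lop a F))"
    using Cons by (intro lop_cong) auto
  also have "lop t (rop s (foldr lop a F)) \<simeq> rop s (lop t (foldr lop a F))"
    using Cons.prems by (intro lop_rop_commute) auto
  finally show ?case by simp
qed simp

lemma fold_lmop_foldr_lop:
  "set a \<subseteq> S \<Longrightarrow> fold lmop a (foldr lop a F) \<simeq> (\<lambda>u. X ^ length a * F u)"
proof (induction a)
  case (Cons s a)
  have "fold lmop a (lmop s (lop s (foldr lop a F))) \<simeq> fold lmop a (\<lambda>u. X * foldr lop a F u)"
    using Cons.prems by (intro fold_lmop_cong lmop_lop) auto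
  thus ?case using Cons by (auto simp: agree_def fold_lmop_scale mult_ac)
qed simp

lemma foldr_lop_fold_lmop:
  "set a \<subseteq> S \<Longrightarrow> foldr lop a (fold lmop a F) \<simeq> (\<lambda>u. X ^ length a * F u)"
proof (induction a arbitrary: F)
  case (Cons s a)
  have "lop s (foldr lop a (fold lmop a (lmop s F))) \<simeq> lop s (\<lambda>u. X ^ length a * lmop s F u)"
    using Cons by (intro lop_cong) auto
  thus ?case using Cons.prems lop_lmop[of s F] by (auto simp: agree_def lop_scale mult.left_commute)
qed simp

section \<open>Independence of the reduced word\<close>

definition reduced :: "'a list \<Rightarrow> 'a \<Rightarrow> bool" where
  "reduced a v \<longleftrightarrow> set a \<subseteq> S \<and> length a = len v \<and> wprod a = v"

text \<open>Since the lengths add, every letter is applied at an ascent. There the terms with q - 1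
  cancel in \<open>lmop\<close>, and each operator is a shift times q; \<open>lop\<close> would
  leave a remainder.\<close>

lemma fold_lmop_value:
  assumes "set a \<subseteq> S" "v \<in> carrier G" "len (wprod a \<otimes> v) = length a + len v"
  shows "fold lmop a F v = X ^ length a * F (wprod a \<otimes> v)"
  using assms
proof (induction a arbitrary: v rule: rev_induct)
  case (snoc s a)
  have s: "s \<in> S" "set a \<subseteq> S" using snoc.prems by auto
  have e: "wprod (a @ [s]) \<otimes> v = wprod a \<otimes> (s \<otimes> v)"
    using wprod_append[of a "[s]"] s snoc.prems by (simp add: m_assoc)
  have "len (wprod b \<otimes> x) \<le> length b + len x" if "set b \<subseteq> S" "x \<in> carrier G" for b x
    using that
  proof (induction b)
    case (Cons t b)
    thus ?case using len_left_le[of t "wprod b \<otimes> x"] by (auto simp: m_assoc)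
  qed simp
  from this[of a "s \<otimes> v"] have l: "len (s \<otimes> v) = Suc (len v)"
    using snoc.prems s e len_left_le[of s v] by simp
  have "fold lmop (a @ [s]) F v = X * fold lmop a F (s \<otimes> v)"
    using l by (simp add: lmop_def lop_def)
  also have "fold lmop a F (s \<otimes> v) = X ^ length a * F (wprod a \<otimes> (s \<otimes> v))"
    using snoc.prems s e l by (intro snoc.IH) auto
  finally show ?case using e by (simp add: algebra_simps)
qed simp

text \<open>This takes the place of a theorem on braid moves. At the identity both sides have the
  explicit value of \<open>fold_lmop_value\<close>; commutation with \<open>rmop\<close> then
  carries the agreement to all u by right multiplication.\<close>

lemma fold_lmop_unique:
  assumes "reduced a v" "reduced b v"
  shows "fold lmop a F \<simeq> fold lmop b F"
proof -
  have ab: "set a \<subseteq> S" "set b \<subseteq> S" using assms by (auto simp: reduced_def)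
  have "fold lmop a F u = fold lmop b F u" if "u \<in> carrier G" for u
    using that
  proof (induction "len u" arbitrary: u F)
    case 0
    hence "u = \<one>" using len_eq_0 by simp
    thus ?case
      using fold_lmop_value[of a \<one> F] fold_lmop_value[of b \<one> F] assms ab
      by (auto simp: reduced_def)
  next
    case (Suc n)
    have "u \<noteq> \<one>" using Suc.hyps by auto
    then obtain s where s: "s \<in> S" "len (u \<otimes> s) < len u"
      using right_descent_exists Suc.prems by blast
    let ?w = "u \<otimes> s"
    have w: "?w \<in> carrier G" "?w \<otimes> s = u" "len ?w = n"
      using s Suc len_right[of s u] by auto
    \<comment> \<open>The letter s ascends at \<open>?w\<close>, so \<open>rmop s H\<close> at
      \<open>?w\<close> is q times the value of H at u. The factor q is cancelled below.\<close>
    have eq: "X * fold lmop c F u = fold lmop c (rmop s F) ?w" if "set c \<subseteq> S" for c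
      using agreeD[OF fold_lmop_rmop_commute[OF that s(1)] w(1), of F] w s
      by (simp add: rmop_def rop_def)
    have "X * fold lmop a F u = X * fold lmop b F u"
      using Suc.hyps(1)[of ?w "rmop s F"] eq ab w by simp
    thus ?case by simp
  qed
  thus ?thesis by (simp add: agree_def)
qed

text \<open>\<open>fold lmop b\<close> inverts \<open>foldr lop b\<close> up to a power of q. By
  \<open>fold_lmop_unique\<close> it does the same for the word a, and the power can be
  cancelled.\<close>

lemma foldr_lop_unique:
  assumes "reduced a v" "reduced b v"
  shows "foldr lop a F \<simeq> foldr lop b F"
proof -
  have ab: "set a \<subseteq> S" "set b \<subseteq> S" "length a = length b" using assms by (auto simp: reduced_def)
  have "fold lmop b (foldr lop a F) \<simeq> (\<lambda>u. X ^ length a * F u)"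
    using fold_lmop_unique[OF assms(2,1)] fold_lmop_foldr_lop[OF ab(1)] agree_trans by blast
  hence "foldr lop b (fold lmop b (foldr lop a F)) \<simeq> foldr lop b (\<lambda>u. X ^ length a * F u)"
    by (intro foldr_lop_cong ab)
  moreover have "foldr lop b (fold lmop b (foldr lop a F)) \<simeq> (\<lambda>u. X ^ length b * foldr lop a F u)"
    by (rule foldr_lop_fold_lmop[OF ab(2)])
  ultimately show ?thesis by (simp add: agree_def foldr_lop_scale ab)
qed

definition delta_one :: "'a \<Rightarrow> int poly" where
  "delta_one u = (if u = \<one> then 1 else 0)"

text \<open>The column of R-polynomials with upper index v. On the carrier the choice of the word is
  immaterial by \<open>foldr_lop_unique\<close>.\<close>

definition R_col :: "'a \<Rightarrow> 'a \<Rightarrow> int poly" where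
  "R_col v = foldr lop (SOME a. reduced a v) delta_one"

lemma R_col_eq:
  assumes "reduced a v" shows "R_col v \<simeq> foldr lop a delta_one"
  unfolding R_col_def by (rule foldr_lop_unique[OF someI[of "\<lambda>a. reduced a v"]]) (use assms in auto)

lemma ex_reduced: "v \<in> carrier G \<Longrightarrow> \<exists>a. reduced a v"
  using reduced_word by (simp add: reduced_def)

lemma R_col_left:
  assumes "s \<in> S" "v \<in> carrier G" "len v < len (s \<otimes> v)"
  shows "R_col (s \<otimes> v) \<simeq> lop s (R_col v)"
proof -
  obtain a where a: "reduced a v" using ex_reduced assms by blast
  have "reduced (s # a) (s \<otimes> v)"
    using a assms len_left[of s v] by (auto simp: reduced_def)
  hence "R_col (s \<otimes> v) \<simeq> lop s (foldr lop a delta_one)" using R_col_eq by fastforce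
  also have "\<dots> \<simeq> lop s (R_col v)"
    by (intro lop_cong agree_sym[OF R_col_eq] a assms)
  finally show ?thesis .
qed

text \<open>The recursion of \<open>is_R_family\<close> is right-handed, the construction
  left-handed. On \<open>delta_one\<close> the two operators for s agree, because s u = 1 exactly if
  u s = 1; the right-handed one then commutes past the remaining letters.\<close>

lemma R_col_right:
  assumes "s \<in> S" "v \<in> carrier G" "len v < len (v \<otimes> s)"
  shows "R_col (v \<otimes> s) \<simeq> rop s (R_col v)"
proof -
  obtain a where a: "reduced a v" using ex_reduced assms by blast
  hence aS: "set a \<subseteq> S" by (simp add: reduced_def)
  have "reduced (a @ [s]) (v \<otimes> s)"
    using a assms len_right[of s v] wprod_append[of a "[s]"] by (auto simp: reduced_def)
  hence "R_col (v \<otimes> s) \<simeq> foldr lop a (lop s delta_one)" using R_col_eq by fastforce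
  also have "\<dots> \<simeq> foldr lop a (rop s delta_one)"
  proof (rule foldr_lop_cong[OF aS])
    have "s \<otimes> u = \<one> \<longleftrightarrow> u \<otimes> s = \<one>" if "u \<in> carrier G" for u
      using that assms by (metis S_closed S_inv inv_comm inv_equality r_inv l_inv)
    moreover have "s \<noteq> \<one>" using assms by auto
    moreover have "len (s \<otimes> u) < len u \<longleftrightarrow> len (u \<otimes> s) < len u" if "u \<in> carrier G" "u = \<one> \<or> s \<otimes> u = \<one>" for u
      using that assms S_inv[of s] by (metis S_closed inv_equality inv_comm l_one r_one S_mult_eq_iff one_closed S_square)
    ultimately show "lop s delta_one \<simeq> rop s delta_one"
      unfolding agree_def lop_def rop_def delta_one_def by (smt (verit) mult_zero_right add.right_neutral)
  qed
  also have "\<dots> \<simeq> rop s (foldr lop a delta_one)"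
    by (rule foldr_lop_rop_commute[OF aS assms(1)])
  also have "\<dots> \<simeq> rop s (R_col v)"
    by (intro rop_cong agree_sym[OF R_col_eq] a assms)
  finally show ?thesis .
qed

lemma R_col_one: "R_col \<one> \<simeq> delta_one"
  using R_col_eq[of "[]" \<one>] by (simp add: reduced_def)

lemma left_induct [consumes 1, case_names one step]:
  assumes "v \<in> carrier G" "P \<one>"
    and "\<And>s v. \<lbrakk>s \<in> S; v \<in> carrier G; len (s \<otimes> v) = Suc (len v); P v\<rbrakk> \<Longrightarrow> P (s \<otimes> v)"
  shows "P v"
  using assms(1)
proof (induction "len v" arbitrary: v)
  case 0
  thus ?case using assms(2) len_eq_0 by simp
next
  case (Suc n)
  have "v \<noteq> \<one>" using Suc.hyps by auto
  then obtain s where s: "s \<in> S" "len (s \<otimes> v) < len v"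
    using left_descent_exists Suc.prems by blast
  thus ?case
    using assms(3)[of s "s \<otimes> v"] Suc.hyps(1)[of "s \<otimes> v"] Suc.prems Suc.hyps(2) len_left[of s v] by auto
qed

lemma R_col_diag: "v \<in> carrier G \<Longrightarrow> R_col v v = 1"
proof (induction v rule: left_induct)
  case one
  thus ?case using R_col_one by (simp add: agree_def delta_one_def)
next
  case (step s v)
  thus ?case using agreeD[OF R_col_left[of s v], of "s \<otimes> v"] by (simp add: lop_def)
qed

lemma R_col_support: "v \<in> carrier G \<Longrightarrow> u \<in> carrier G \<Longrightarrow> R_col v u \<noteq> 0 \<Longrightarrow> u \<unlhd> v"
proof (induction v arbitrary: u rule: left_induct)
  case one
  thus ?case using agreeD[OF R_col_one, of u] by (auto simp: delta_one_def split: if_splits)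
next
  case (step s v)
  have "R_col v (s \<otimes> u) \<noteq> 0 \<or> R_col v u \<noteq> 0"
    using step agreeD[OF R_col_left[of s v], of u] by (auto simp: lop_def split: if_splits)
  hence "s \<otimes> u \<unlhd> v \<or> u \<unlhd> v" using step by auto
  thus ?case
    using step below_lift_up[of "s \<otimes> u" v s] S_below[of s v] below_trans[of u v] by auto
qed

section \<open>Existence and uniqueness of the R-polynomials\<close>

definition R_fam :: "'a \<Rightarrow> 'a \<Rightarrow> int poly" where
  "R_fam u v = (if u \<in> carrier G \<and> v \<in> carrier G then R_col v u else 0)"

lemma is_R_family_R_fam: "is_R_family G S R_fam"
  unfolding is_R_family_def
proof (intro conjI allI ballI impI)
  fix u v assume "\<not> u \<unlhd> v"
  thus "R_fam u v = 0" using R_col_support by (auto simp: R_fam_def)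
next
  fix u assume "u \<in> carrier G"
  thus "R_fam u u = 1" by (simp add: R_fam_def R_col_diag)
next
  fix u v s assume *: "u \<in> carrier G" "v \<in> carrier G" "s \<in> S" "len (v \<otimes> s) < len v"
  thus "R_fam u v = (if len (u \<otimes> s) < len u then R_fam (u \<otimes> s) (v \<otimes> s)
      else monom 1 1 * R_fam (u \<otimes> s) (v \<otimes> s) + (monom 1 1 - 1) * R_fam u (v \<otimes> s))"
    using agreeD[OF R_col_right[of s "v \<otimes> s"], of u] by (simp add: R_fam_def rop_def)
qed

lemma R_family_unique:
  assumes "is_R_family G S R" "is_R_family G S R'"
  shows "R = R'"
proof -
  have "R u v = R' u v" if "v \<in> carrier G" "u \<in> carrier G" for u v
    using that
  proof (induction "len v" arbitrary: u v)
    case 0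
    hence v: "v = \<one>" using len_eq_0 by simp
    show ?case
    proof (cases "u = \<one>")
      case True
      thus ?thesis using assms v unfolding is_R_family_def by simp
    next
      case False
      hence "\<not> u \<unlhd> \<one>" using below_one by blast
      thus ?thesis using assms v unfolding is_R_family_def by simp
    qed
  next
    case (Suc n)
    have "v \<noteq> \<one>" using Suc.hyps by auto
    then obtain s where s: "s \<in> S" "len (v \<otimes> s) < len v"
      using right_descent_exists Suc.prems by blast
    hence "len (v \<otimes> s) = n" using len_right[of s v] Suc by simp
    hence "R x (v \<otimes> s) = R' x (v \<otimes> s)" if "x \<in> carrier G" for x
      using Suc.hyps(1)[of "v \<otimes> s" x] Suc.prems s that by simp
    thus ?case using assms s Suc.prems unfolding is_R_family_def by auto
  qed
  moreover have "R u v = R' u v" if "\<not> (v \<in> carrier G \<and> u \<in> carrier G)" for u v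
  proof -
    have "\<not> u \<unlhd> v" using that below_carrier by blast
    thus ?thesis using assms unfolding is_R_family_def by simp
  qed
  ultimately show ?thesis by blast
qed

lemma R_poly_eq: "R_poly G S = R_fam"
  unfolding R_poly_def using is_R_family_R_fam R_family_unique by (intro the_equality) auto

abbreviation R :: "'a \<Rightarrow> 'a \<Rightarrow> int poly" where "R \<equiv> R_poly G S"

lemma R_zero: "\<not> u \<unlhd> v \<Longrightarrow> R u v = 0"
  using is_R_family_R_fam by (simp add: R_poly_eq is_R_family_def)

lemma R_diag: "u \<in> carrier G \<Longrightarrow> R u u = 1"
  using is_R_family_R_fam by (simp add: R_poly_eq is_R_family_def)

lemma R_left:
  assumes "s \<in> S" "u \<in> carrier G" "v \<in> carrier G" "len v < len (s \<otimes> v)"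
  shows "R u (s \<otimes> v) = (if len (s \<otimes> u) < len u then R (s \<otimes> u) v
    else X * R (s \<otimes> u) v + (X - 1) * R u v)"
  using agreeD[OF R_col_left[OF assms(1,3,4)] assms(2)] assms
  by (simp add: R_poly_eq R_fam_def lop_def)

end

section \<open>Kazhdan-Lusztig polynomials\<close>

text \<open>
  \<open>bar n l p\<close> is \<open>q ^ (n - l) * p (1/q)\<close>, truncated to a polynomial; it is \<open>0\<close> if \<open>n < l\<close>.
\<close>

definition bar :: "nat \<Rightarrow> nat \<Rightarrow> int poly \<Rightarrow> int poly" where
  "bar n l p = (if l \<le> n then \<Sum>j\<le>n - l. monom (coeff p (n - l - j)) j else 0)"

lemma coeff_bar: "coeff (bar n l p) j = (if j + l \<le> n then coeff p (n - l - j) else 0)"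
  by (auto simp: bar_def coeff_sum)

lemma bar_add: "bar n l (p + r) = bar n l p + bar n l r"
  by (auto simp: poly_eq_iff coeff_bar)

lemma bar_smult: "bar n l (smult c p) = smult c (bar n l p)"
  by (auto simp: poly_eq_iff coeff_bar)

lemma coeff_X_mult: "coeff (X * p) j = (case j of 0 \<Rightarrow> 0 | Suc i \<Rightarrow> coeff p i)"
  by (auto simp: coeff_monom_mult split: nat.split)

lemma bar_X_mult: "bar (Suc n) l (X * p) = bar n l p"
proof (rule poly_eqI)
  fix j
  consider "j + l \<le> n" | "j + l = Suc n" | "Suc n < j + l" by linarith
  thus "coeff (bar (Suc n) l (X * p)) j = coeff (bar n l p) j"
  proof cases
    case 1
    hence "Suc n - l - j = Suc (n - l - j)" by simp
    thus ?thesis using 1 by (simp add: coeff_bar coeff_X_mult)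
  qed (auto simp: coeff_bar coeff_X_mult)
qed

lemma bar_Suc_Suc: "bar (Suc n) (Suc l) p = bar n l p"
  by (auto simp: poly_eq_iff coeff_bar)

text \<open>The degree bound makes the constant term on the left vanish, which is the coefficient of
  p in degree n + 1 - l.\<close>

lemma bar_Suc_left:
  assumes "p = 0 \<or> degree p + l \<le> n"
  shows "bar (Suc n) l p = X * bar n l p"
proof -
  have "coeff p (Suc n - l) = 0" if "l \<le> Suc n"
    using assms that by (cases "p = 0") (auto intro!: coeff_eq_0)
  thus ?thesis
    by (auto simp: poly_eq_iff coeff_bar coeff_X_mult split: nat.split)
qed

lemma bar_Suc_right:
  assumes "p = 0 \<or> Suc (degree p + l) \<le> n"
  shows "bar n l p = X * bar n (Suc l) p"
  using bar_Suc_left[of p "Suc l" n] assms bar_Suc_Suc by simp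

lemma bar_eq_reflect_poly:
  assumes "degree p + l \<le> n"
  shows "monom 1 (n - l - degree p) * reflect_poly p = bar n l p"
proof (rule poly_eqI)
  fix j
  show "coeff (monom 1 (n - l - degree p) * reflect_poly p) j = coeff (bar n l p) j"
    using assms by (auto simp: coeff_monom_mult coeff_reflect_poly coeff_bar coeff_eq_0 add.commute)
qed

lemma smult_sum_distrib: "smult k (sum f A) = (\<Sum>a\<in>A. smult k (f a))"
  by (induction A rule: infinite_finite_induct) (auto simp: smult_add_right)

section \<open>Bar-invariant columns\<close>

context coxeter_walls
begin

text \<open>With c read as the Hecke algebra element with coefficients \<open>c u\<close>, this says
  that q to the power -n/2 times that element is fixed by the bar involution. The degree bound
  ensures that \<open>bar\<close> truncates nothing.\<close>

definition dual :: "nat \<Rightarrow> ('a \<Rightarrow> int poly) \<Rightarrow> bool" where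
  "dual n c \<longleftrightarrow> finite {a. c a \<noteq> 0} \<and>
     (\<forall>a. c a \<noteq> 0 \<longrightarrow> a \<in> carrier G \<and> degree (c a) + len a \<le> n) \<and>
     (\<forall>u\<in>carrier G. bar n (len u) (c u) = (\<Sum>a | c a \<noteq> 0. R u a * c a))"

lemma dualD:
  assumes "dual n c" "finite A" "{a. c a \<noteq> 0} \<subseteq> A" "u \<in> carrier G"
  shows "bar n (len u) (c u) = (\<Sum>a\<in>A. R u a * c a)"
proof -
  have "(\<Sum>a | c a \<noteq> 0. R u a * c a) = (\<Sum>a\<in>A. R u a * c a)"
    by (rule sum.mono_neutral_left) (use assms in auto)
  thus ?thesis using assms by (simp add: dual_def)
qed

lemma dualI:
  assumes "finite A" "{a. c a \<noteq> 0} \<subseteq> A"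
    and "\<And>a. c a \<noteq> 0 \<Longrightarrow> a \<in> carrier G \<and> degree (c a) + len a \<le> n"
    and "\<And>u. u \<in> carrier G \<Longrightarrow> bar n (len u) (c u) = (\<Sum>a\<in>A. R u a * c a)"
  shows "dual n c"
proof -
  have "(\<Sum>a | c a \<noteq> 0. R u a * c a) = (\<Sum>a\<in>A. R u a * c a)" for u
    by (rule sum.mono_neutral_left) (use assms in auto)
  thus ?thesis using assms finite_subset unfolding dual_def by metis
qed

lemma dual_support:
  assumes "dual n c"
  shows "finite {a. c a \<noteq> 0}" "c a \<noteq> 0 \<Longrightarrow> a \<in> carrier G"
    "c a \<noteq> 0 \<Longrightarrow> degree (c a) + len a \<le> n"
  using assms by (auto simp: dual_def)

lemma dual_zero: "dual n (\<lambda>u. 0)"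
  by (simp add: dual_def poly_eq_iff coeff_bar)

lemma dual_add:
  assumes "dual n c" "dual n d"
  shows "dual n (\<lambda>u. c u + d u)"
proof -
  let ?A = "{a. c a \<noteq> 0} \<union> {a. d a \<noteq> 0}"
  show ?thesis
  proof (rule dualI)
    show "finite ?A" using assms by (auto simp: dual_def)
    show "{a. c a + d a \<noteq> 0} \<subseteq> ?A" by auto
    fix a assume a: "c a + d a \<noteq> 0"
    have "degree (c a + d a) \<le> max (degree (c a)) (degree (d a))"
      by (rule degree_add_le_max)
    thus "a \<in> carrier G \<and> degree (c a + d a) + len a \<le> n"
      using a dual_support(2,3)[OF assms(1), of a] dual_support(2,3)[OF assms(2), of a]
      by (cases "c a = 0"; cases "d a = 0") auto
  next
    fix u assume u: "u \<in> carrier G"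
    have A: "finite ?A" using assms by (auto simp: dual_def)
    show "bar n (len u) (c u + d u) = (\<Sum>a\<in>?A. R u a * (c a + d a))"
      using dualD[OF assms(1) A _ u] dualD[OF assms(2) A _ u]
      by (simp add: bar_add distrib_left sum.distrib)
  qed
qed

lemma dual_smult:
  assumes "dual n c" shows "dual n (\<lambda>u. smult k (c u))"
proof (rule dualI)
  show "finite {a. c a \<noteq> 0}" using assms by (simp add: dual_def)
  show "{a. smult k (c a) \<noteq> 0} \<subseteq> {a. c a \<noteq> 0}" by auto
  fix a assume "smult k (c a) \<noteq> 0"
  thus "a \<in> carrier G \<and> degree (smult k (c a)) + len a \<le> n"
    using dual_support(2,3)[OF assms, of a] by auto
next
  fix u assume "u \<in> carrier G"
  thus "bar n (len u) (smult k (c u)) = (\<Sum>a | c a \<noteq> 0. R u a * smult k (c a))"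
    using assms by (simp add: dual_def bar_smult smult_sum_distrib)
qed

lemma dual_sum:
  "finite Z \<Longrightarrow> (\<And>z. z \<in> Z \<Longrightarrow> dual n (c z)) \<Longrightarrow> dual n (\<lambda>u. \<Sum>z\<in>Z. c z u)"
  by (induction Z rule: finite_induct) (auto simp: dual_zero dual_add)

text \<open>Multiplication by q raises n by 2, since the normalising power of q is -n/2.\<close>

lemma dual_shift1:
  assumes "dual n c" shows "dual (Suc (Suc n)) (\<lambda>u. X * c u)"
proof (rule dualI)
  show "finite {a. c a \<noteq> 0}" using assms by (simp add: dual_def)
  show "{a. X * c a \<noteq> 0} \<subseteq> {a. c a \<noteq> 0}" by auto
  fix a assume "X * c a \<noteq> 0"
  thus "a \<in> carrier G \<and> degree (X * c a) + len a \<le> Suc (Suc n)"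
    using dual_support(2,3)[OF assms, of a] by (auto simp: degree_mult_eq degree_monom_eq)
next
  fix u assume u: "u \<in> carrier G"
  have "bar (Suc (Suc n)) (len u) (X * c u) = bar (Suc n) (len u) (c u)"
    by (rule bar_X_mult)
  also have "\<dots> = X * bar n (len u) (c u)"
    by (rule bar_Suc_left) (use dual_support(3)[OF assms, of u] in auto)
  finally show "bar (Suc (Suc n)) (len u) (X * c u) = (\<Sum>a | c a \<noteq> 0. R u a * (X * c a))"
    using assms u by (simp add: dual_def sum_distrib_left mult.left_commute)
qed

lemma dual_shift: "dual n c \<Longrightarrow> dual (n + 2 * k) (\<lambda>u. X ^ k * c u)"
proof (induction k)
  case (Suc k)
  thus ?case using dual_shift1[of "n + 2 * k" "\<lambda>u. X ^ k * c u"] by (simp add: mult.assoc)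
qed simp

text \<open>Left multiplication of the column \<open>c\<close>, read as \<open>\<Sum>u. c u T\<^sub>u\<close>, by \<open>T\<^sub>s + 1\<close>.\<close>

definition mul :: "'a \<Rightarrow> ('a \<Rightarrow> int poly) \<Rightarrow> 'a \<Rightarrow> int poly" where
  "mul s c u = (if u \<notin> carrier G then 0
     else if len (s \<otimes> u) < len u then c (s \<otimes> u) + X * c u else X * c (s \<otimes> u) + c u)"

lemma sum_S_shift:
  assumes "s \<in> S" "A \<subseteq> carrier G" "\<And>a. a \<in> A \<Longrightarrow> s \<otimes> a \<in> A"
  shows "(\<Sum>a\<in>A. g (s \<otimes> a)) = (\<Sum>a\<in>A. g a)"
  by (rule sum.reindex_bij_witness[of _ "\<lambda>a. s \<otimes> a" "\<lambda>a. s \<otimes> a"]) (use assms in auto)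

text \<open>The matrix R intertwines the transpose of \<open>mul s\<close>, acting on the index a,
  with 1 + \<open>lop s\<close>, acting on the index u.\<close>

lemma R_pair:
  assumes "s \<in> S" "u \<in> carrier G" "a \<in> carrier G"
  shows "(if len (s \<otimes> a) < len a then X * (R u a + R u (s \<otimes> a)) else R u a + R u (s \<otimes> a)) =
    R u a + (if len (s \<otimes> u) < len u then R (s \<otimes> u) a else X * R (s \<otimes> u) a + (X - 1) * R u a)"
proof (cases "len (s \<otimes> a) < len a")
  case False
  hence "len a < len (s \<otimes> a)" using len_left[of s a] assms by (auto split: if_splits)
  thus ?thesis using R_left[of s u a] assms False by simp
next
  case True
  have su: "s \<otimes> (s \<otimes> u) = u" "s \<otimes> u \<in> carrier G" using assms by simp_all
  have "R u a = (if len (s \<otimes> u) < len u then R (s \<otimes> u) (s \<otimes> a)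
      else X * R (s \<otimes> u) (s \<otimes> a) + (X - 1) * R u (s \<otimes> a))"
    using R_left[of s u "s \<otimes> a"] assms True by simp
  moreover have "R (s \<otimes> u) a = (if len u < len (s \<otimes> u) then R u (s \<otimes> a)
      else X * R u (s \<otimes> a) + (X - 1) * R (s \<otimes> u) (s \<otimes> a))"
    using R_left[of s "s \<otimes> u" "s \<otimes> a"] assms True su by simp
  ultimately show ?thesis
    using True len_left[of s u] assms by (auto simp: algebra_simps split: if_splits)
qed

text \<open>The element q^(-1/2) (T_s + 1) is bar-invariant, so multiplication by T_s + 1 raises n
  by 1.\<close>

lemma dual_mul:
  assumes s: "s \<in> S" and c: "dual n c"
  shows "dual (Suc n) (mul s c)"
proof -
  let ?C = "{a. c a \<noteq> 0}"
  let ?A = "?C \<union> (\<lambda>a. s \<otimes> a) ` ?C"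
  have C: "finite ?C" "?C \<subseteq> carrier G" using c by (auto simp: dual_def)
  have A: "finite ?A" "?A \<subseteq> carrier G" "s \<otimes> a \<in> ?A" if "a \<in> ?A" for a
    using C s that by (auto simp: image_iff)
  have A': "finite ?A" "?A \<subseteq> carrier G" using C s by auto
  have deg: "c a = 0 \<or> degree (c a) + len a \<le> n" for a using dual_support(3)[OF c] by blast
  show ?thesis
  proof (rule dualI)
    show "finite ?A" by (rule A')
    show "{a. mul s c a \<noteq> 0} \<subseteq> ?A"
    proof
      fix a assume "a \<in> {a. mul s c a \<noteq> 0}"
      hence "a \<in> carrier G" "c a \<noteq> 0 \<or> c (s \<otimes> a) \<noteq> 0"
        by (auto simp: mul_def split: if_splits)
      thus "a \<in> ?A" using s by (force simp: image_iff intro: exI[of _ "s \<otimes> a"])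
    qed
    fix a assume a: "mul s c a \<noteq> 0"
    hence ac: "a \<in> carrier G" by (auto simp: mul_def split: if_splits)
    have dX: "degree (X * p) \<le> Suc (degree p)" for p :: "int poly"
      using degree_mult_le[of X p] by (simp add: degree_monom_eq)
    have "degree (mul s c a) + len a \<le> Suc n"
    proof (cases "len (s \<otimes> a) < len a")
      case True
      have "degree (c (s \<otimes> a)) + len a \<le> Suc n \<or> c (s \<otimes> a) = 0"
        using deg[of "s \<otimes> a"] True len_left[of s a] s ac by auto
      moreover have "degree (X * c a) + len a \<le> Suc n \<or> c a = 0"
        using deg[of a] dX[of "c a"] by auto
      ultimately show ?thesis
        using True ac a degree_add_le_max[of "c (s \<otimes> a)" "X * c a"]
        by (cases "c a = 0"; cases "c (s \<otimes> a) = 0") (auto simp: mul_def)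
    next
      case False
      have "degree (X * c (s \<otimes> a)) + len a \<le> Suc n \<or> c (s \<otimes> a) = 0"
        using deg[of "s \<otimes> a"] dX[of "c (s \<otimes> a)"] False len_left[of s a] s ac by auto
      moreover have "degree (c a) + len a \<le> Suc n \<or> c a = 0"
        using deg[of a] by auto
      ultimately show ?thesis
        using False ac a degree_add_le_max[of "X * c (s \<otimes> a)" "c a"]
        by (cases "c a = 0"; cases "c (s \<otimes> a) = 0") (auto simp: mul_def)
    qed
    thus "a \<in> carrier G \<and> degree (mul s c a) + len a \<le> Suc n" using ac by simp
  next
    fix u assume u: "u \<in> carrier G"
    define F where "F x = (\<Sum>a\<in>?A. R x a * c a)" for x
    have F: "bar n (len x) (c x) = F x" if "x \<in> carrier G" for x
      unfolding F_def by (rule dualD[OF c A'(1) _ that]) auto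
    let ?k = "\<lambda>a. if len (s \<otimes> a) < len a then X else 1"
    let ?k' = "\<lambda>a. if len (s \<otimes> a) < len a then 1 else X"
    have "(\<Sum>a\<in>?A. R u a * mul s c a) = (\<Sum>a\<in>?A. R u a * (?k a * c a) + R u a * (?k' a * c (s \<otimes> a)))"
      using A'(2) by (intro sum.cong) (auto simp: mul_def algebra_simps)
    also have "\<dots> = (\<Sum>a\<in>?A. R u a * (?k a * c a)) + (\<Sum>a\<in>?A. R u a * (?k' a * c (s \<otimes> a)))"
      by (rule sum.distrib)
    \<comment> \<open>The set \<open>?A\<close> is stable under s, so the half with
      \<open>c (s \<otimes> a)\<close> can be reindexed to carry \<open>c a\<close>. The weights
      \<open>?k'\<close> and \<open>?k\<close> are exchanged by this, and \<open>R_pair\<close>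
      becomes applicable.\<close>
    also have "(\<Sum>a\<in>?A. R u a * (?k' a * c (s \<otimes> a))) = (\<Sum>a\<in>?A. R u (s \<otimes> a) * (?k' (s \<otimes> a) * c (s \<otimes> (s \<otimes> a))))"
      by (rule sum_S_shift[symmetric]) (use s A' A in blast)+
    also have "\<dots> = (\<Sum>a\<in>?A. R u (s \<otimes> a) * (?k a * c a))"
    proof (rule sum.cong[OF HOL.refl])
      fix a assume "a \<in> ?A"
      hence "a \<in> carrier G" using A' by blast
      thus "R u (s \<otimes> a) * (?k' (s \<otimes> a) * c (s \<otimes> (s \<otimes> a))) = R u (s \<otimes> a) * (?k a * c a)"
        using s len_left[of s a] by (auto split: if_splits)
    qed
    also have "(\<Sum>a\<in>?A. R u a * (?k a * c a)) + (\<Sum>a\<in>?A. R u (s \<otimes> a) * (?k a * c a)) =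
        (\<Sum>a\<in>?A. (if len (s \<otimes> a) < len a then X * (R u a + R u (s \<otimes> a)) else R u a + R u (s \<otimes> a)) * c a)"
      unfolding sum.distrib[symmetric] by (intro sum.cong) (auto simp: algebra_simps)
    also have "\<dots> = (\<Sum>a\<in>?A. (R u a + (if len (s \<otimes> u) < len u then R (s \<otimes> u) a
        else X * R (s \<otimes> u) a + (X - 1) * R u a)) * c a)"
      using A' s u by (intro sum.cong HOL.refl arg_cong2[of _ _ _ _ "(*)"] R_pair) auto
    also have "\<dots> = F u + (if len (s \<otimes> u) < len u then F (s \<otimes> u) else X * F (s \<otimes> u) + (X - 1) * F u)"
      unfolding F_def by (auto simp: sum.distrib sum_distrib_left algebra_simps sum_subtractf)
    finally have rhs: "(\<Sum>a\<in>?A. R u a * mul s c a) = \<dots>" .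
    have Fu: "F u = bar n (len u) (c u)" "F (s \<otimes> u) = bar n (len (s \<otimes> u)) (c (s \<otimes> u))"
      using F[of u] F[of "s \<otimes> u"] s u by auto
    show "bar (Suc n) (len u) (mul s c u) = (\<Sum>a\<in>?A. R u a * mul s c a)"
    proof (cases "len (s \<otimes> u) < len u")
      case True
      hence "len u = Suc (len (s \<otimes> u))" using len_left[of s u] s u by simp
      hence "bar (Suc n) (len u) (c (s \<otimes> u)) = F (s \<otimes> u)" using Fu by (simp add: bar_Suc_Suc)
      thus ?thesis unfolding rhs using True u Fu bar_X_mult[of n "len u" "c u"]
        by (simp add: mul_def bar_add)
    next
      case False
      hence l: "len (s \<otimes> u) = Suc (len u)" using len_left[of s u] s u by simp
      have "bar (Suc n) (len u) (X * c (s \<otimes> u)) = X * bar n (Suc (len u)) (c (s \<otimes> u))"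
        unfolding bar_X_mult by (rule bar_Suc_right) (use deg[of "s \<otimes> u"] l in auto)
      moreover have "bar (Suc n) (len u) (c u) = X * bar n (len u) (c u)"
        by (rule bar_Suc_left) (rule deg)
      ultimately show ?thesis unfolding rhs using False u Fu l
        by (simp add: mul_def bar_add algebra_simps)
    qed
  qed
qed

section \<open>Existence and uniqueness of the Kazhdan-Lusztig columns\<close>

definition KL_col :: "'a \<Rightarrow> ('a \<Rightarrow> int poly) \<Rightarrow> bool" where
  "KL_col v c \<longleftrightarrow> dual (len v) c \<and> c v = 1 \<and> (\<forall>u. c u \<noteq> 0 \<longrightarrow> u \<unlhd> v) \<and>
     (\<forall>u. c u \<noteq> 0 \<and> u \<noteq> v \<longrightarrow> 2 * degree (c u) + len u + 1 \<le> len v)"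

text \<open>The difference e of two such columns is again bar-invariant. At an element u of maximal
  length in its support, invariance says that \<open>e u\<close> is its own mirror image in degree
  l(v) - l(u). Its degree is less than half of that, so it is 0.\<close>

lemma KL_col_unique:
  assumes "KL_col v c" "KL_col v d"
  shows "c = d"
proof (rule ccontr)
  assume "c \<noteq> d"
  define e where "e u = c u - d u" for u
  have dual: "dual (len v) e"
    using dual_add[of "len v" c "\<lambda>u. smult (-1) (d u)"] dual_smult[of "len v" d "-1"] assms
    by (simp add: KL_col_def e_def[abs_def])
  have "{a. e a \<noteq> 0} \<noteq> {}" using \<open>c \<noteq> d\<close> by (auto simp: e_def fun_eq_iff)
  then obtain u where u: "e u \<noteq> 0" "\<And>a. e a \<noteq> 0 \<Longrightarrow> len a \<le> len u"
    using dual_support(1)[OF dual] obtains_MAX[of "{a. e a \<noteq> 0}" len]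
      Max_ge[of "len ` {a. e a \<noteq> 0}"]
    by (metis (mono_tags, lifting) finite_imageI imageI mem_Collect_eq)
  have uc: "u \<in> carrier G" using dual_support(2)[OF dual] u by blast
  have "u \<noteq> v" using u assms by (auto simp: e_def KL_col_def)
  have deg: "2 * degree (e u) + len u + 1 \<le> len v"
  proof -
    have "2 * degree (c u) + len u + 1 \<le> len v \<or> c u = 0"
      "2 * degree (d u) + len u + 1 \<le> len v \<or> d u = 0"
      using assms \<open>u \<noteq> v\<close> by (auto simp: KL_col_def)
    thus ?thesis using degree_diff_le_max[of "c u" "d u"] u(1)
      by (cases "c u = 0"; cases "d u = 0") (auto simp: e_def)
  qed
  have "bar (len v) (len u) (e u) = (\<Sum>a | e a \<noteq> 0. R u a * e a)"
    using dual uc by (simp add: dual_def)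
  also have "\<dots> = (\<Sum>a\<in>{u}. R u a * e a)"
  proof (rule sum.mono_neutral_right)
    show "finite {a. e a \<noteq> 0}" by (rule dual_support(1)[OF dual])
    show "{u} \<subseteq> {a. e a \<noteq> 0}" using u by simp
    show "\<forall>a\<in>{a. e a \<noteq> 0} - {u}. R u a * e a = 0"
    proof
      fix a assume "a \<in> {a. e a \<noteq> 0} - {u}"
      hence "\<not> u \<unlhd> a" using u(2)[of a] below_len[of u a] by auto
      thus "R u a * e a = 0" by (simp add: R_zero)
    qed
  qed
  also have "\<dots> = e u" using uc by (simp add: R_diag)
  finally have "coeff (e u) (degree (e u)) = coeff (bar (len v) (len u) (e u)) (degree (e u))" by simp
  also have "\<dots> = 0" using deg by (auto simp: coeff_bar intro!: coeff_eq_0)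
  finally show False using u by simp
qed

definition KLc :: "'a \<Rightarrow> 'a \<Rightarrow> int poly" where
  "KLc v = (SOME c. KL_col v c)"

text \<open>The coefficient in the highest degree that the bound permits, when the length difference
  is odd, as \<open>lower_terms\<close> demands.\<close>

definition mu :: "'a \<Rightarrow> 'a \<Rightarrow> int" where
  "mu z y = coeff (KLc y z) ((len y - len z - 1) div 2)"

definition lower_terms :: "'a \<Rightarrow> 'a \<Rightarrow> 'a set" where
  "lower_terms s y = {z. z \<unlhd> y \<and> z \<noteq> y \<and> len (s \<otimes> z) < len z \<and> odd (len y - len z)}"

text \<open>The product formula C_s C_y = C_{sy} + sum of mu(z,y) C_z, solved for C_{sy}. The powers
  of q make up for working without the normalisation by q^(-l/2).\<close>

definition KL_step :: "'a \<Rightarrow> 'a \<Rightarrow> 'a \<Rightarrow> int poly" where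
  "KL_step s y u = mul s (KLc y) u -
     (\<Sum>z\<in>lower_terms s y. smult (mu z y) (X ^ ((Suc (len y) - len z) div 2) * KLc z u))"

lemma finite_lower_terms [simp]: "finite (lower_terms s y)"
  by (rule finite_subset[OF _ finite_below[of y]]) (auto simp: lower_terms_def)

lemma KL_col_coeff:
  assumes "KL_col v c" "coeff (c u) i \<noteq> 0"
  shows "u = v \<and> i = 0 \<or> 2 * i + len u + 1 \<le> len v"
proof (cases "u = v")
  case True
  thus ?thesis using assms by (auto simp: KL_col_def split: if_splits)
next
  case False
  moreover have "c u \<noteq> 0" "i \<le> degree (c u)" using assms le_degree by auto
  ultimately show ?thesis using assms by (fastforce simp: KL_col_def)
qed

lemma lower_terms_shift:
  assumes "z \<in> lower_terms s y"
  shows "len z < len y" "len z + 2 * ((Suc (len y) - len z) div 2) = Suc (len y)"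
proof -
  show *: "len z < len y" using assms below_len by (auto simp: lower_terms_def)
  have "even (Suc (len y) - len z)" using assms * by (auto simp: lower_terms_def Suc_diff_le)
  thus "len z + 2 * ((Suc (len y) - len z) div 2) = Suc (len y)" using * by simp
qed

lemma coeff_X_power_mult: "coeff (X ^ k * p) i = (if k \<le> i then coeff p (i - k) else 0)"
  by (simp add: monom_power coeff_monom_mult)

text \<open>The column \<open>mul s (KLc y)\<close> is bar-invariant and can violate the degree
  bound only at elements u with descent s, in a single degree, where its coefficient is
  \<open>mu u y\<close>. The subtracted terms remove precisely these coefficients.\<close>

lemma KL_step_KL_col:
  assumes s: "s \<in> S" and y: "y \<in> carrier G" and up: "len y < len (s \<otimes> y)"
    and IH: "\<And>z. z \<in> carrier G \<Longrightarrow> len z \<le> len y \<Longrightarrow> KL_col z (KLc z)"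
  shows "KL_col (s \<otimes> y) (KL_step s y)"
proof -
  let ?Z = "lower_terms s y"
  let ?k = "\<lambda>z. (Suc (len y) - len z) div 2"
  have ly: "len (s \<otimes> y) = Suc (len y)" using len_left[of s y] s y up by simp
  have Ky: "KL_col y (KLc y)" using IH y by simp
  have Z: "KL_col z (KLc z)" "z \<unlhd> y" "len z < len y" "len z + 2 * ?k z = Suc (len y)"
      "len (s \<otimes> z) < len z" "z \<in> carrier G" if "z \<in> ?Z" for z
    using that lower_terms_shift[OF that] IH[of z] below_carrier[of z y] by (auto simp: lower_terms_def)
  have supp_y: "u \<unlhd> y" if "KLc y u \<noteq> 0" for u using Ky that by (simp add: KL_col_def)
  have "dual (Suc (len y)) (\<lambda>u. mul s (KLc y) u + smult (-1)
      (\<Sum>z\<in>?Z. smult (mu z y) (X ^ ?k z * KLc z u)))"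
  proof (intro dual_add dual_smult[of _ _ "-1"] dual_sum)
    show "dual (Suc (len y)) (mul s (KLc y))" using Ky s by (simp add: KL_col_def dual_mul)
    fix z assume z: "z \<in> ?Z"
    have "dual (len z + 2 * ?k z) (\<lambda>u. X ^ ?k z * KLc z u)"
      using Z(1)[OF z] by (intro dual_shift) (simp add: KL_col_def)
    thus "dual (Suc (len y)) (\<lambda>u. smult (mu z y) (X ^ ?k z * KLc z u))"
      using Z(4)[OF z] by (intro dual_smult) simp
  qed simp
  hence d: "dual (len (s \<otimes> y)) (KL_step s y)" by (simp add: KL_step_def[abs_def] ly)
  have z0: "KLc z (s \<otimes> y) = 0" if "z \<in> ?Z" for z
    using Z(1,3)[OF that] ly below_len_le by (fastforce simp: KL_col_def)
  have y0: "KLc y (s \<otimes> y) = 0"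
    using supp_y[of "s \<otimes> y"] ly below_len_le[of "s \<otimes> y" y] by auto
  have diag: "KL_step s y (s \<otimes> y) = 1"
    using s y up Ky y0 z0 by (simp add: KL_step_def mul_def KL_col_def)
  have supp: "u \<unlhd> s \<otimes> y" if "KL_step s y u \<noteq> 0" for u
  proof -
    have uc: "u \<in> carrier G" using d that dual_support(2) by blast
    have ysy: "y \<unlhd> s \<otimes> y" using S_below s y up by simp
    have "mul s (KLc y) u \<noteq> 0 \<or> (\<exists>z\<in>?Z. KLc z u \<noteq> 0)"
    proof (rule ccontr)
      assume "\<not> ?thesis"
      hence "KL_step s y u = 0" by (simp add: KL_step_def)
      thus False using that by simp
    qed
    hence "KLc y u \<noteq> 0 \<or> KLc y (s \<otimes> u) \<noteq> 0 \<or> (\<exists>z\<in>?Z. KLc z u \<noteq> 0)"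
      by (auto simp: mul_def split: if_splits)
    moreover have "u \<unlhd> z" if "z \<in> ?Z" "KLc z u \<noteq> 0" for z
      using Z(1)[OF that(1)] that(2) by (simp add: KL_col_def)
    ultimately have "u \<unlhd> y \<or> s \<otimes> u \<unlhd> y"
      using supp_y Z(2) below_trans by blast
    thus ?thesis using below_lift_up[of "s \<otimes> u" y s] s up uc ysy below_trans by auto
  qed
  have vanish: "coeff (KL_step s y u) i = 0"
    if uc: "u \<in> carrier G" and ne: "u \<noteq> s \<otimes> y" and i: "len y < 2 * i + len u" for u i
  proof -
    have ne': "s \<otimes> u \<noteq> y" using ne s uc by auto
    \<comment> \<open>The summand of z reaches the forbidden range only through its diagonal entry
      1, that is for u = z and in degree exactly \<open>?k z\<close>.\<close>
    have zc: "coeff (X ^ ?k z * KLc z u) i = of_bool (z = u \<and> 2 * i + len u = Suc (len y))"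
      if "z \<in> ?Z" for z
    proof (cases "?k z \<le> i \<and> coeff (KLc z u) (i - ?k z) \<noteq> 0")
      case True
      hence "u = z \<and> i - ?k z = 0 \<or> 2 * (i - ?k z) + len u + 1 \<le> len z"
        using KL_col_coeff[OF Z(1)[OF that]] by blast
      moreover have "coeff (X ^ ?k z * KLc z u) i = coeff (KLc z u) (i - ?k z)"
        using True by (simp add: coeff_X_power_mult)
      moreover have "coeff (KLc z z) 0 = 1" using Z(1)[OF that] by (simp add: KL_col_def)
      ultimately show ?thesis using Z(4)[OF that] i True by auto
    next
      case False
      hence "coeff (X ^ ?k z * KLc z u) i = 0" by (auto simp: coeff_X_power_mult)
      moreover have "coeff (KLc z z) 0 = 1" using Z(1)[OF that] by (simp add: KL_col_def)
      ultimately show ?thesis using Z(4)[OF that] False by auto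
    qed
    have sumc: "coeff (\<Sum>z\<in>?Z. smult (mu z y) (X ^ ?k z * KLc z u)) i =
        (if u \<in> ?Z \<and> 2 * i + len u = Suc (len y) then mu u y else 0)"
    proof -
      have "coeff (\<Sum>z\<in>?Z. smult (mu z y) (X ^ ?k z * KLc z u)) i =
          (\<Sum>z\<in>?Z. if u = z then (if 2 * i + len u = Suc (len y) then mu u y else 0) else 0)"
        unfolding coeff_sum by (rule sum.cong) (auto simp: zc)
      thus ?thesis by (simp add: sum.delta)
    qed
    show ?thesis
    proof (cases "len (s \<otimes> u) < len u")
      case False
      have lsu: "len (s \<otimes> u) = Suc (len u)" using len_left[of s u] s uc False by simp
      have "coeff (X * KLc y (s \<otimes> u)) i = 0"
      proof (cases i)
        case (Suc j)
        have "coeff (KLc y (s \<otimes> u)) j = 0"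
          using KL_col_coeff[OF Ky, of "s \<otimes> u" j] ne' i Suc lsu by fastforce
        thus ?thesis using Suc by (simp add: coeff_X_mult)
      qed (simp add: coeff_X_mult)
      moreover have "coeff (KLc y u) i = 0"
        using KL_col_coeff[OF Ky, of u i] i by fastforce
      moreover have "u \<notin> ?Z" using False by (simp add: lower_terms_def)
      ultimately show ?thesis using sumc False uc by (simp add: KL_step_def mul_def)
    next
      case True
      have lsu: "len u = Suc (len (s \<otimes> u))" using len_left[of s u] s uc True by simp
      have "coeff (KLc y (s \<otimes> u)) i = 0"
        using KL_col_coeff[OF Ky, of "s \<otimes> u" i] ne' i lsu by fastforce
      moreover have "coeff (X * KLc y u) i =
          (if u \<in> ?Z \<and> 2 * i + len u = Suc (len y) then mu u y else 0)"
      proof (cases "coeff (X * KLc y u) i = 0")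
        case True
        have "mu u y = 0" if "2 * i + len u = Suc (len y)" "u \<in> ?Z"
        proof -
          have "i = Suc ((len y - len u - 1) div 2)" using that lower_terms_shift[OF that(2)] by simp
          thus ?thesis using True by (simp add: coeff_X_mult mu_def)
        qed
        thus ?thesis using True by auto
      next
        case nz: False
        then obtain j where j: "i = Suc j" "coeff (KLc y u) j \<noteq> 0"
          by (cases i) (auto simp: coeff_X_mult)
        have "u \<noteq> y" using True up by auto
        hence e: "2 * i + len u = Suc (len y)"
          using KL_col_coeff[OF Ky j(2)] j(1) i by simp
        moreover have "u \<unlhd> y" using j(2) by (intro supp_y) auto
        moreover have "odd (len y - len u)"
        proof -
          have "len y - len u = 2 * j + 1" using e j by simp
          thus ?thesis by simp
        qed
        ultimately have "u \<in> ?Z" using True \<open>u \<noteq> y\<close> by (simp add: lower_terms_def)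
        moreover have "j = (len y - len u - 1) div 2" using e j by simp
        ultimately show ?thesis using e j by (simp add: coeff_X_mult mu_def)
      qed
      ultimately show ?thesis using sumc True uc by (simp add: KL_step_def mul_def)
    qed
  qed
  have "2 * degree (KL_step s y u) + len u + 1 \<le> len (s \<otimes> y)"
    if "KL_step s y u \<noteq> 0" "u \<noteq> s \<otimes> y" for u
  proof -
    have "\<not> len y < 2 * degree (KL_step s y u) + len u"
      using vanish[of u "degree (KL_step s y u)"] that dual_support(2)[OF d, of u] by auto
    thus ?thesis using ly by simp
  qed
  thus ?thesis using d diag supp by (simp add: KL_col_def)
qed

lemma KL_col_one: "KL_col \<one> delta_one"
proof -
  have "dual 0 delta_one"
  proof (rule dualI)
    show "finite {\<one>}" by simp
    show "{a. delta_one a \<noteq> 0} \<subseteq> {\<one>}" by (auto simp: delta_one_def)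
    fix a assume "delta_one a \<noteq> 0"
    thus "a \<in> carrier G \<and> degree (delta_one a) + len a \<le> 0"
      by (auto simp: delta_one_def split: if_splits)
  next
    fix u assume u: "u \<in> carrier G"
    show "bar 0 (len u) (delta_one u) = (\<Sum>a\<in>{\<one>}. R u a * delta_one a)"
    proof (cases "u = \<one>")
      case True
      thus ?thesis by (simp add: bar_def delta_one_def R_diag one_pCons monom_0)
    next
      case False
      hence "R u \<one> = 0" using below_one R_zero by blast
      thus ?thesis using False by (simp add: delta_one_def bar_def)
    qed
  qed
  thus ?thesis by (auto simp: KL_col_def delta_one_def split: if_splits)
qed

theorem KL_col_KLc: "v \<in> carrier G \<Longrightarrow> KL_col v (KLc v)"
proof (induction "len v" arbitrary: v rule: less_induct)
  case less
  have "\<exists>c. KL_col v c"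
  proof (cases "v = \<one>")
    case True
    thus ?thesis using KL_col_one by blast
  next
    case False
    then obtain s where s: "s \<in> S" "len (s \<otimes> v) < len v"
      using left_descent_exists less.prems by blast
    have "KL_col (s \<otimes> (s \<otimes> v)) (KL_step s (s \<otimes> v))"
      using s less by (intro KL_step_KL_col) auto
    thus ?thesis using s less.prems by auto
  qed
  thus ?case unfolding KLc_def by (rule someI_ex)
qed

lemma KLc_mult:
  assumes "s \<in> S" "y \<in> carrier G" "len y < len (s \<otimes> y)"
  shows "KLc (s \<otimes> y) = KL_step s y"
  using assms by (intro KL_col_unique[of "s \<otimes> y"] KL_step_KL_col KL_col_KLc) auto

section \<open>Descents and mu-coefficients\<close>

lemma KLc_support: "v \<in> carrier G \<Longrightarrow> KLc v u \<noteq> 0 \<Longrightarrow> u \<unlhd> v"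
  using KL_col_KLc by (auto simp: KL_col_def)

lemma KLc_diag: "v \<in> carrier G \<Longrightarrow> KLc v v = 1"
  using KL_col_KLc by (auto simp: KL_col_def)

text \<open>Columns in the image of \<open>mul s\<close> are invariant under u to s u. All terms
  subtracted in \<open>KL_step\<close> belong to shorter z with descent s, so induction on the
  length applies.\<close>

lemma KLc_descent_invariant:
  assumes "s \<in> S" "y \<in> carrier G" "len (s \<otimes> y) < len y" "u \<in> carrier G"
  shows "KLc y (s \<otimes> u) = KLc y u"
  using assms(2,3)
proof (induction "len y" arbitrary: y rule: less_induct)
  case less
  let ?y = "s \<otimes> y"
  have K: "KLc y = KL_step s ?y"
    using KLc_mult[of s ?y] less.prems assms by simp
  have "KLc z (s \<otimes> u) = KLc z u" if "z \<in> lower_terms s ?y" for z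
    using less.hyps[of z] lower_terms_shift[OF that] that less.prems below_carrier[of z ?y]
    by (auto simp: lower_terms_def)
  moreover have "mul s (KLc ?y) (s \<otimes> u) = mul s (KLc ?y) u"
    using assms len_left[of s u] by (auto simp: mul_def split: if_splits)
  ultimately show ?case unfolding K KL_step_def by simp
qed

text \<open>By descent invariance the coefficient also occurs at t z. As t z is longer than z by
  one, the degree bound there is violated unless t z = y.\<close>

lemma mu_nonzero:
  assumes "z \<in> carrier G" "y \<in> carrier G" "mu z y \<noteq> 0" "len z < len y" "odd (len y - len z)"
    and "t \<in> S" "len (t \<otimes> y) < len y" "len z < len (t \<otimes> z)"
  shows "y = t \<otimes> z"
proof -
  have "coeff (KLc y (t \<otimes> z)) ((len y - len z - 1) div 2) \<noteq> 0"
    using assms KLc_descent_invariant[of t y z] by (simp add: mu_def)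
  moreover have "2 * ((len y - len z - 1) div 2) + Suc (len z) = len y"
    using assms by (auto elim!: oddE)
  ultimately show ?thesis
    using KL_col_coeff[OF KL_col_KLc[of y], of "t \<otimes> z"] assms len_left[of t z] by fastforce
qed

lemma mu_succ:
  assumes "z \<in> carrier G" "t \<in> S" "len z < len (t \<otimes> z)"
  shows "mu z (t \<otimes> z) = 1"
proof -
  have "KLc (t \<otimes> z) (t \<otimes> z) = KLc (t \<otimes> z) z"
    using assms by (intro KLc_descent_invariant) auto
  thus ?thesis using assms len_left[of t z] KLc_diag[of "t \<otimes> z"] by (simp add: mu_def)
qed

text \<open>The definition sums over the interval from u to v, \<open>dual\<close> over the support
  of the column. The two differ by vanishing terms, and \<open>reflect_poly\<close> turns into
  \<open>bar\<close> within the degree bound.\<close>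

lemma is_KL_family_iff:
  "is_KL_family G S P \<longleftrightarrow>
     (\<forall>v\<in>carrier G. KL_col v (\<lambda>u. P u v)) \<and> (\<forall>v. v \<notin> carrier G \<longrightarrow> (\<forall>u. P u v = 0))"
proof
  assume P: "is_KL_family G S P"
  have z: "P u v = 0" if "\<not> u \<unlhd> v" for u v using P that by (simp add: is_KL_family_def)
  have deg: "2 * degree (P u v) + len u + 1 \<le> len v" if "u \<unlhd> v" "u \<noteq> v" for u v
    using P that by (simp add: is_KL_family_def)
  have diag: "P v v = 1" if "v \<in> carrier G" for v using P that by (simp add: is_KL_family_def)
  have "dual (len v) (\<lambda>u. P u v)" if v: "v \<in> carrier G" for v
  proof (rule dualI)
    show "finite {a. a \<unlhd> v}" by simp
    show "{a. P a v \<noteq> 0} \<subseteq> {a. a \<unlhd> v}" using z by auto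
    have dg: "degree (P a v) + len a \<le> len v" if "a \<unlhd> v" for a
      using deg[of a v] diag[OF v] that by (cases "a = v") auto
    fix a assume "P a v \<noteq> 0"
    thus "a \<in> carrier G \<and> degree (P a v) + len a \<le> len v"
      using z dg below_carrier by blast
  next
    fix u assume u: "u \<in> carrier G"
    show "bar (len v) (len u) (P u v) = (\<Sum>a | a \<unlhd> v. R u a * P a v)"
    proof (cases "u \<unlhd> v")
      case True
      have dg: "degree (P u v) + len u \<le> len v"
        using deg[of u v] diag[OF v] True by (cases "u = v") auto
      have "monom 1 (len v - len u - degree (P u v)) * reflect_poly (P u v) =
          (\<Sum>a | u \<unlhd> a \<and> a \<unlhd> v. R u a * P a v)"
        using P True unfolding is_KL_family_def by blast
      hence "bar (len v) (len u) (P u v) = (\<Sum>a | u \<unlhd> a \<and> a \<unlhd> v. R u a * P a v)"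
        unfolding bar_eq_reflect_poly[OF dg] .
      also have "\<dots> = (\<Sum>a | a \<unlhd> v. R u a * P a v)"
        using R_zero by (intro sum.mono_neutral_left) auto
      finally show ?thesis .
    next
      case False
      hence "R u a = 0" if "a \<unlhd> v" for a using that R_zero below_trans by blast
      thus ?thesis using z[OF False] by (simp add: bar_def)
    qed
  qed
  note dl = this
  show "(\<forall>v\<in>carrier G. KL_col v (\<lambda>u. P u v)) \<and> (\<forall>v. v \<notin> carrier G \<longrightarrow> (\<forall>u. P u v = 0))"
  proof (intro conjI ballI allI impI)
    fix v assume "v \<in> carrier G"
    moreover have "u \<unlhd> v" if "P u v \<noteq> 0" for u using z that by blast
    ultimately show "KL_col v (\<lambda>u. P u v)"
      using dl deg diag
      unfolding KL_col_def by simp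
  next
    fix u v assume "v \<notin> carrier G"
    hence "\<not> u \<unlhd> v" using below_carrier(2) by blast
    thus "P u v = 0" by (rule z)
  qed
next
  assume P: "(\<forall>v\<in>carrier G. KL_col v (\<lambda>u. P u v)) \<and> (\<forall>v. v \<notin> carrier G \<longrightarrow> (\<forall>u. P u v = 0))"
  have K: "KL_col v (\<lambda>u. P u v)" if "v \<in> carrier G" for v using P that by blast
  have z: "P u v = 0" if "\<not> u \<unlhd> v" for u v
    using P that by (cases "v \<in> carrier G") (auto simp: KL_col_def)
  show "is_KL_family G S P"
    unfolding is_KL_family_def
  proof (intro conjI allI impI ballI)
    fix u v assume "\<not> u \<unlhd> v"
    thus "P u v = 0" by (rule z)
  next
    fix u assume "u \<in> carrier G"
    thus "P u u = 1" using K by (simp add: KL_col_def)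
  next
    fix u v assume uv: "u \<unlhd> v \<and> u \<noteq> v"
    show "2 * degree (P u v) + len u + 1 \<le> len v"
      using K[of v] uv below_carrier[of u v] below_len[of u v]
      by (cases "P u v = 0") (auto simp: KL_col_def)
  next
    fix u v assume uv: "u \<unlhd> v"
    hence c: "u \<in> carrier G" "v \<in> carrier G" using below_carrier by auto
    have dl: "dual (len v) (\<lambda>u. P u v)" using K c by (simp add: KL_col_def)
    have "degree (P u v) + len u \<le> len v"
      using dual_support(3)[OF dl, of u] below_len_le[OF uv] by (cases "P u v = 0") auto
    hence "monom 1 (len v - len u - degree (P u v)) * reflect_poly (P u v) = bar (len v) (len u) (P u v)"
      by (rule bar_eq_reflect_poly)
    also have "\<dots> = (\<Sum>a | a \<unlhd> v. R u a * P a v)"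
      using z by (intro dualD[OF dl _ _ c(1)]) auto
    also have "\<dots> = (\<Sum>a | u \<unlhd> a \<and> a \<unlhd> v. R u a * P a v)"
      using R_zero by (intro sum.mono_neutral_right) auto
    finally show "monom 1 (len v - len u - degree (P u v)) * reflect_poly (P u v) =
        (\<Sum>a | u \<unlhd> a \<and> a \<unlhd> v. R u a * P a v)" .
  qed
qed

lemma KL_poly_eq: "v \<in> carrier G \<Longrightarrow> KL_poly G S u v = KLc v u"
proof -
  define P where "P = (\<lambda>u v. if v \<in> carrier G then KLc v u else 0)"
  have "(\<lambda>u. P u v) = KLc v" if "v \<in> carrier G" for v using that by (auto simp: P_def)
  hence P: "is_KL_family G S P"
    unfolding is_KL_family_iff using KL_col_KLc by (simp add: P_def)
  have "Q = P" if Q: "is_KL_family G S Q" for Q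
  proof -
    have "(\<lambda>u. Q u v) = (\<lambda>u. P u v)" for v
      using P Q KL_col_unique unfolding is_KL_family_iff by (cases "v \<in> carrier G") auto
    thus ?thesis by (auto simp: fun_eq_iff)
  qed
  hence "KL_poly G S = P" unfolding KL_poly_def using P by blast
  thus "v \<in> carrier G \<Longrightarrow> KL_poly G S u v = KLc v u" by (simp add: P_def)
qed


section \<open>Inverse Kazhdan-Lusztig polynomials at one\<close>

definition KL1 :: "'a \<Rightarrow> 'a \<Rightarrow> int" where
  "KL1 u y = poly (KLc y u) 1"

text \<open>The value on C_y of the linear functional on the group ring that takes the value
  \<open>f u\<close> on each group element u.\<close>

definition KL_pairing :: "('a \<Rightarrow> int) \<Rightarrow> 'a \<Rightarrow> int" where
  "KL_pairing f y = (\<Sum>u | u \<unlhd> y. KL1 u y * f u)"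

lemma KL1_diag: "v \<in> carrier G \<Longrightarrow> KL1 v v = 1"
  by (simp add: KL1_def KLc_diag)

lemma KL1_zero: "v \<in> carrier G \<Longrightarrow> \<not> u \<unlhd> v \<Longrightarrow> KL1 u v = 0"
  using KLc_support[of v u] by (cases "KLc v u = 0") (auto simp: KL1_def)

lemma KL_pairing_superset:
  assumes "y \<in> carrier G" "finite A" "{u. u \<unlhd> y} \<subseteq> A"
  shows "KL_pairing f y = (\<Sum>u\<in>A. KL1 u y * f u)"
  unfolding KL_pairing_def using assms KL1_zero by (intro sum.mono_neutral_left) auto

lemma KL1_mult:
  assumes "s \<in> S" "y \<in> carrier G" "len y < len (s \<otimes> y)" "u \<in> carrier G"
  shows "KL1 u (s \<otimes> y) = KL1 (s \<otimes> u) y + KL1 u y - (\<Sum>z\<in>lower_terms s y. mu z y * KL1 u z)"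
  using assms by (auto simp: KL1_def KLc_mult KL_step_def mul_def poly_sum poly_monom)

text \<open>The formula for C_s C_y at q = 1, where C_s is 1 + s. The left multiplication is moved
  onto f, which requires summing over a range stable under s: the elements below s y.\<close>

lemma KL_pairing_mult:
  assumes "s \<in> S" "y \<in> carrier G" "len y < len (s \<otimes> y)"
  shows "KL_pairing f (s \<otimes> y) =
    (\<Sum>u | u \<unlhd> y. KL1 u y * (f u + f (s \<otimes> u))) - (\<Sum>z\<in>lower_terms s y. mu z y * KL_pairing f z)"
proof -
  let ?A = "{u. u \<unlhd> s \<otimes> y}"
  have A: "finite ?A" "?A \<subseteq> carrier G" using below_carrier by auto
  have stable: "s \<otimes> u \<in> ?A" if "u \<in> ?A" for u
    using below_lift_down[of u "s \<otimes> y" s] that assms by simp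
  have y: "{u. u \<unlhd> y} \<subseteq> ?A" using S_below[of s y] assms below_trans by blast
  have z: "{u. u \<unlhd> z} \<subseteq> ?A" "z \<in> carrier G" if "z \<in> lower_terms s y" for z
    using that y below_trans[of _ z y] below_carrier[of z y] by (auto simp: lower_terms_def)
  have "KL_pairing f (s \<otimes> y) = (\<Sum>u\<in>?A. KL1 (s \<otimes> u) y * f u + KL1 u y * f u -
      (\<Sum>z\<in>lower_terms s y. mu z y * (KL1 u z * f u)))"
    unfolding KL_pairing_def
    using A assms by (intro sum.cong) (auto simp: KL1_mult algebra_simps sum_distrib_left)
  also have "\<dots> = (\<Sum>u\<in>?A. KL1 (s \<otimes> u) y * f u) + (\<Sum>u\<in>?A. KL1 u y * f u) -
      (\<Sum>u\<in>?A. \<Sum>z\<in>lower_terms s y. mu z y * (KL1 u z * f u))"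
    by (simp add: sum_subtractf sum.distrib)
  also have "(\<Sum>u\<in>?A. KL1 (s \<otimes> u) y * f u) = (\<Sum>u\<in>?A. KL1 (s \<otimes> (s \<otimes> u)) y * f (s \<otimes> u))"
    by (rule sum_S_shift[symmetric]) (use assms A stable in blast)+
  also have "\<dots> = (\<Sum>u\<in>?A. KL1 u y * f (s \<otimes> u))"
    using A assms by (intro sum.cong) auto
  also have "(\<Sum>u\<in>?A. KL1 u y * f (s \<otimes> u)) + (\<Sum>u\<in>?A. KL1 u y * f u) =
      (\<Sum>u\<in>?A. KL1 u y * (f u + f (s \<otimes> u)))"
    by (simp add: sum.distrib distrib_left)
  also have "\<dots> = (\<Sum>u | u \<unlhd> y. KL1 u y * (f u + f (s \<otimes> u)))"
    using KL_pairing_superset[OF assms(2) A(1) y, of "\<lambda>u. f u + f (s \<otimes> u)"]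
    by (simp add: KL_pairing_def)
  also have "(\<Sum>u\<in>?A. \<Sum>z\<in>lower_terms s y. mu z y * (KL1 u z * f u)) =
      (\<Sum>z\<in>lower_terms s y. mu z y * (\<Sum>u\<in>?A. KL1 u z * f u))"
    by (subst sum.swap) (simp add: sum_distrib_left)
  also have "\<dots> = (\<Sum>z\<in>lower_terms s y. mu z y * KL_pairing f z)"
    using KL_pairing_superset[OF z(2) A(1) z(1), of _ f] by (intro sum.cong) simp_all
  finally show ?thesis .
qed

text \<open>
  A family of functions that transforms under left multiplication like the coordinates of a
  cell module of the graph on \<open>V\<close> is dual to the Kazhdan-Lusztig basis. The hypothesis on \<open>N\<close>
  says that whenever \<open>t \<otimes> V i\<close> leaves the set \<open>V ` I\<close>, it has the descents of \<open>V i\<close> as well.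
\<close>

theorem KL_pairing_cell:
  fixes V :: "'i \<Rightarrow> 'a" and f :: "'i \<Rightarrow> 'a \<Rightarrow> int" and N :: "'i \<Rightarrow> 'i set"
  assumes V: "inj_on V I" "V ` I \<subseteq> carrier G"
    and N: "\<And>i. i \<in> I \<Longrightarrow> N i \<subseteq> I" "\<And>i. i \<in> I \<Longrightarrow> finite (N i)"
    and f_one: "\<And>i. i \<in> I \<Longrightarrow> f i \<one> = of_bool (V i = \<one>)"
    and f_step: "\<And>i s w. \<lbrakk>i \<in> I; s \<in> S; w \<in> carrier G\<rbrakk> \<Longrightarrow> f i w + f i (s \<otimes> w) =
      (if len (s \<otimes> V i) < len (V i) then 2 * f i w + (\<Sum>j\<in>N i. f j w) else 0)"
    and desc: "\<And>i s t. \<lbrakk>i \<in> I; s \<in> S; t \<in> S; len (s \<otimes> V i) < len (V i); len (t \<otimes> V i) < len (V i)\<rbrakk>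
      \<Longrightarrow> s = t"
    and nbrs: "\<And>i s. \<lbrakk>i \<in> I; s \<in> S; len (s \<otimes> V i) < len (V i)\<rbrakk> \<Longrightarrow> V ` N i =
      insert (s \<otimes> V i) {t \<otimes> V i | t. t \<in> S \<and> t \<noteq> s \<and> \<not> len (s \<otimes> (t \<otimes> V i)) < len (t \<otimes> V i)}"
    and y: "y \<in> carrier G" and i: "i \<in> I"
  shows "KL_pairing (f i) y = of_bool (y = V i)"
  using y i
proof (induction "len y" arbitrary: y i rule: less_induct)
  case less
  have Vi: "V i \<in> carrier G" using V less.prems by blast
  show ?case
  proof (cases "y = \<one>")
    case True
    have "{u. u \<unlhd> \<one>} = {\<one>}" using below_one by auto
    thus ?thesis using True f_one[OF less.prems(2)] by (simp add: KL_pairing_def KL1_diag)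
  next
    case False
    then obtain s where s: "s \<in> S" "len (s \<otimes> y) < len y"
      using left_descent_exists less.prems by blast
    define y' where "y' = s \<otimes> y"
    have y': "y' \<in> carrier G" "y = s \<otimes> y'" "len y' < len y"
      using s less.prems by (simp_all add: y'_def)
    have IHy: "KL_pairing (f j) y' = of_bool (y' = V j)" if "j \<in> I" for j
      using less.hyps[of y' j] y' that by simp
    have IHz: "KL_pairing (f i) z = of_bool (z = V i)" if "z \<in> lower_terms s y'" for z
      using less.hyps[of z i] lower_terms_shift(1)[OF that] that y' less.prems below_carrier[of z y']
      by (auto simp: lower_terms_def)
    define low where "low = (if V i \<in> lower_terms s y' then mu (V i) y' else 0)"
    have "(\<Sum>z\<in>lower_terms s y'. mu z y' * KL_pairing (f i) z) =
        (\<Sum>z\<in>lower_terms s y'. if z = V i then mu (V i) y' else 0)"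
      by (intro sum.cong) (auto simp: IHz)
    hence "(\<Sum>z\<in>lower_terms s y'. mu z y' * KL_pairing (f i) z) = low"
      by (simp add: low_def)
    hence eq: "KL_pairing (f i) y = (\<Sum>u | u \<unlhd> y'. KL1 u y' * (f i u + f i (s \<otimes> u))) - low"
      using KL_pairing_mult[of s y' "f i"] s y' by simp
    show ?thesis
    proof (cases "len (s \<otimes> V i) < len (V i)")
      case False
      \<comment> \<open>When s is not a descent of \<open>V i\<close>, the function
        \<open>f i\<close> is antisymmetric under s. All subtracted z have descent s, as does y, so
        \<open>V i\<close> is none of them.\<close>
      have "f i u + f i (s \<otimes> u) = 0" if "u \<unlhd> y'" for u
        using f_step[of i s u] that below_carrier[of u y'] False s less.prems by simp
      moreover have "V i \<notin> lower_terms s y'" using False by (simp add: lower_terms_def)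
      moreover have "y \<noteq> V i" using False s by auto
      ultimately show ?thesis unfolding eq low_def by simp
    next
      case True
      have ne: "y' \<noteq> V i" using True y' by auto
      have "(\<Sum>u | u \<unlhd> y'. KL1 u y' * (f i u + f i (s \<otimes> u))) =
          (\<Sum>u | u \<unlhd> y'. 2 * (KL1 u y' * f i u) + (\<Sum>j\<in>N i. KL1 u y' * f j u))"
        using f_step[of i s] True below_carrier s less.prems
        by (intro sum.cong) (auto simp: algebra_simps sum_distrib_left)
      also have "\<dots> = 2 * KL_pairing (f i) y' + (\<Sum>j\<in>N i. KL_pairing (f j) y')"
        unfolding KL_pairing_def sum.distrib sum_distrib_left by (subst sum.swap) simp
      also have "\<dots> = (\<Sum>j\<in>N i. of_bool (y' = V j))"
        using IHy N(1)[OF less.prems(2)] less.prems ne by (auto intro!: sum.cong)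
      also have "\<dots> = of_bool (y' \<in> V ` N i)"
      proof (cases "y' \<in> V ` N i")
        case True
        then obtain j where j: "j \<in> N i" "y' = V j" by blast
        have "(\<Sum>j\<in>N i. of_bool (y' = V j)) = (\<Sum>k\<in>N i. if k = j then 1 else 0 :: int)"
          using j V(1) N(1)[OF less.prems(2)] by (intro sum.cong) (auto dest: inj_onD)
        thus ?thesis using j N(2)[OF less.prems(2)] True by simp
      qed (auto intro!: sum.neutral)
      finally have eq': "KL_pairing (f i) y = of_bool (y' \<in> V ` N i) - low" unfolding eq by simp
      have yV: "y = V i \<longleftrightarrow> y' = s \<otimes> V i" using S_mult_eq_iff[of s y' "V i"] s y' Vi by auto
      \<comment> \<open>In (a), y is \<open>V i\<close> itself and nothing is subtracted. In (b), y'
        lies one step above \<open>V i\<close>, and the contribution 1 of the neighbour is cancelled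
        by a mu equal to 1. In (c), no neighbour contributes, and a nonzero mu would lead back to
        (b) by \<open>mu_nonzero\<close>.\<close>
      consider (a) "y' = s \<otimes> V i"
        | (b) t where "t \<in> S" "t \<noteq> s" "y' = t \<otimes> V i" "\<not> len (s \<otimes> (t \<otimes> V i)) < len (t \<otimes> V i)"
        | (c) "y' \<notin> V ` N i"
        using nbrs[OF less.prems(2) s(1) True] by blast
      thus ?thesis
      proof cases
        case a
        have "y' \<in> V ` N i" using nbrs[OF less.prems(2) s(1) True] a by blast
        moreover have "V i \<notin> lower_terms s y'"
          using lower_terms_shift(1)[of "V i" s y'] a True by auto
        ultimately show ?thesis using a yV eq' by (simp add: low_def)
      next
        case (b t)
        have "y' \<in> V ` N i" using nbrs[OF less.prems(2) s(1) True] b by blast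
        have up: "len (t \<otimes> V i) = Suc (len (V i))"
          using len_left[of t "V i"] b Vi desc[OF less.prems(2) s(1), of t] True by (auto split: if_splits)
        have "V i \<in> lower_terms s y'"
          using b up True Vi S_below[of t "V i"] ne by (simp add: lower_terms_def)
        moreover have "mu (V i) y' = 1" using mu_succ[of "V i" t] b Vi up by simp
        moreover have "y' \<noteq> s \<otimes> V i" using b s Vi by simp
        ultimately show ?thesis using \<open>y' \<in> V ` N i\<close> yV eq' by (simp add: low_def)
      next
        case c
        have "low = 0"
        proof (rule ccontr)
          assume "low \<noteq> 0"
          hence z: "V i \<in> lower_terms s y'" "mu (V i) y' \<noteq> 0" by (auto simp: low_def split: if_splits)
          have "y' \<noteq> \<one>" using lower_terms_shift(1)[OF z(1)] by auto
          then obtain t where t: "t \<in> S" "len (t \<otimes> y') < len y'"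
            using left_descent_exists y' by blast
          have "t \<noteq> s" using t y' by auto
          hence "len (V i) < len (t \<otimes> V i)"
            using len_left[of t "V i"] t Vi desc[OF less.prems(2) s(1), of t] True by (auto split: if_splits)
          hence "y' = t \<otimes> V i"
            using mu_nonzero[of "V i" y' t] z t Vi y' lower_terms_shift(1)[OF z(1)]
            by (simp add: lower_terms_def)
          hence "y' \<in> V ` N i"
            using nbrs[OF less.prems(2) s(1) True] t \<open>t \<noteq> s\<close> y' by auto
          thus False using c by blast
        qed
        moreover have "y' \<noteq> s \<otimes> V i" using c nbrs[OF less.prems(2) s(1) True] by blast
        ultimately show ?thesis using c yV eq' by simp
      qed
    qed
  qed
qed

section \<open>Expansion of group elements in the Kazhdan-Lusztig basis\<close>

lemma lookup_KL_basis:
  assumes "y \<in> carrier G"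
  shows "Poly_Mapping.lookup (KL_basis G S y) u = KL1 u y"
proof -
  have "Poly_Mapping.lookup (KL_basis G S y) u = (\<Sum>w | w \<unlhd> y. KL1 w y * of_bool (u = w))"
    unfolding KL_basis_def lookup_sum using KL_poly_eq assms
    by (intro sum.cong) (auto simp: lookup_frag_cmul KL1_def lookup_single when_def)
  also have "\<dots> = (\<Sum>w | w \<unlhd> y. if w = u then KL1 u y else 0)"
    by (intro sum.cong) auto
  also have "\<dots> = KL1 u y" using KL1_zero assms by simp
  finally show ?thesis .
qed

lemma KL_basis_expansion_iff:
  assumes "w \<in> carrier G"
  shows "frag_of w = (\<Sum>x | x \<unlhd> w. frag_cmul (k x) (KL_basis G S x)) \<longleftrightarrow>
    (\<forall>u. (\<Sum>x | x \<unlhd> w. k x * KL1 u x) = of_bool (u = w))"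
proof -
  have "Poly_Mapping.lookup (\<Sum>x | x \<unlhd> w. frag_cmul (k x) (KL_basis G S x)) u =
      (\<Sum>x | x \<unlhd> w. k x * KL1 u x)" for u
    unfolding lookup_sum using below_carrier
    by (intro sum.cong) (auto simp: lookup_frag_cmul lookup_KL_basis)
  thus ?thesis
    by (auto simp: poly_mapping_eq_iff fun_eq_iff lookup_single when_def)
qed

text \<open>Unitriangularity: w is C_w minus a combination of elements b strictly below w, whose
  expansions are substituted. The factor \<open>of_bool (x \<unlhd> b)\<close> extends them by zero
  to the range below w.\<close>

lemma ex_KL_expansion:
  "w \<in> carrier G \<Longrightarrow> \<exists>k. \<forall>u. (\<Sum>x | x \<unlhd> w. k x * KL1 u x) = of_bool (u = w)"
proof (induction "len w" arbitrary: w rule: less_induct)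
  case less
  let ?B = "{x. x \<unlhd> w \<and> x \<noteq> w}"
  have B: "finite ?B" by (rule finite_subset[OF _ finite_below[of w]]) auto
  have "\<exists>k. \<forall>u. (\<Sum>x | x \<unlhd> b. k x * KL1 u x) = of_bool (u = b)" if "b \<in> ?B" for b
    using less.hyps[of b] that below_len[of b w] below_carrier[of b w] by auto
  then obtain k where k: "\<And>b u. b \<in> ?B \<Longrightarrow> (\<Sum>x | x \<unlhd> b. k b x * KL1 u x) = of_bool (u = b)"
    by metis
  define k' where "k' x = of_bool (x = w) - (\<Sum>b\<in>?B. KL1 b w * (of_bool (x \<unlhd> b) * k b x))" for x
  have "(\<Sum>x | x \<unlhd> w. k' x * KL1 u x) = of_bool (u = w)" for u
  proof -
    have "(\<Sum>x | x \<unlhd> w. k' x * KL1 u x) = (\<Sum>x | x \<unlhd> w. of_bool (x = w) * KL1 u x) -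
        (\<Sum>x | x \<unlhd> w. \<Sum>b\<in>?B. KL1 b w * (of_bool (x \<unlhd> b) * k b x * KL1 u x))"
      by (simp add: k'_def algebra_simps sum_subtractf sum_distrib_left)
    also have "(\<Sum>x | x \<unlhd> w. of_bool (x = w) * KL1 u x) = (\<Sum>x | x \<unlhd> w. if x = w then KL1 u w else 0)"
      by (intro sum.cong) auto
    also have "\<dots> = KL1 u w" using less.prems by simp
    also have "(\<Sum>x | x \<unlhd> w. \<Sum>b\<in>?B. KL1 b w * (of_bool (x \<unlhd> b) * k b x * KL1 u x)) =
        (\<Sum>b\<in>?B. KL1 b w * (\<Sum>x | x \<unlhd> w. of_bool (x \<unlhd> b) * k b x * KL1 u x))"
      by (subst sum.swap) (simp add: sum_distrib_left)
    also have "\<dots> = (\<Sum>b\<in>?B. KL1 b w * of_bool (u = b))"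
    proof (intro sum.cong HOL.refl arg_cong2[of _ _ _ _ "(*)"])
      fix b assume b: "b \<in> ?B"
      have "(\<Sum>x | x \<unlhd> w. of_bool (x \<unlhd> b) * k b x * KL1 u x) = (\<Sum>x | x \<unlhd> b. k b x * KL1 u x)"
        using b below_trans[of _ b w] by (intro sum.mono_neutral_cong_right) auto
      thus "(\<Sum>x | x \<unlhd> w. of_bool (x \<unlhd> b) * k b x * KL1 u x) = of_bool (u = b)"
        using k[OF b] by simp
    qed
    also have "\<dots> = (\<Sum>b\<in>?B. if b = u then KL1 u w else 0)"
      by (intro sum.cong) auto
    also have "\<dots> = (if u \<in> ?B then KL1 u w else 0)" using B by simp
    finally show ?thesis using KL1_zero[OF less.prems, of u] KL1_diag[OF less.prems] by auto
  qed
  thus ?case by blast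
qed

text \<open>Among the indices where the coefficients differ, take u of maximal length. Only the
  basis element of u itself then contributes a difference at u.\<close>

lemma KL_expansion_unique:
  assumes "w \<in> carrier G" "\<forall>u. (\<Sum>x | x \<unlhd> w. k x * KL1 u x) = (\<Sum>x | x \<unlhd> w. k' x * KL1 u x)"
    and "x \<unlhd> w"
  shows "k x = k' x"
proof (rule ccontr)
  assume "k x \<noteq> k' x"
  let ?D = "{x. x \<unlhd> w \<and> k x \<noteq> k' x}"
  have D: "finite ?D" by (rule finite_subset[OF _ finite_below[of w]]) auto
  have "Max (len ` ?D) \<in> len ` ?D" using D \<open>k x \<noteq> k' x\<close> assms(3) by (intro Max_in) auto
  then obtain u where u: "u \<in> ?D" "len u = Max (len ` ?D)" by auto
  have max: "len a \<le> len u" if "a \<in> ?D" for a using D that u by simp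
  have uc: "u \<in> carrier G" using u below_carrier by blast
  have "0 = (\<Sum>x | x \<unlhd> w. (k x - k' x) * KL1 u x)"
    using assms(2) by (simp add: left_diff_distrib sum_subtractf)
  also have "\<dots> = (\<Sum>x\<in>{u}. (k x - k' x) * KL1 u x)"
  proof (rule sum.mono_neutral_right)
    show "\<forall>a\<in>{x. x \<unlhd> w} - {u}. (k a - k' a) * KL1 u a = 0"
    proof
      fix a assume a: "a \<in> {x. x \<unlhd> w} - {u}"
      show "(k a - k' a) * KL1 u a = 0"
      proof (cases "k a = k' a")
        case False
        hence "len a \<le> len u" using a max by simp
        hence "\<not> u \<unlhd> a" using a below_len[of u a] by auto
        thus ?thesis using KL1_zero[of a u] a below_carrier[of a w] by simp
      qed simp
    qed
  qed (use u in auto)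
  also have "\<dots> = k u - k' u" using uc by (simp add: KL1_diag)
  finally show False using u by simp
qed

text \<open>Such an f is the coordinate functional of C_v, so applying it to the expansion of w
  picks out the coefficient of C_v.\<close>

theorem inv_KL_eq:
  assumes v: "v \<in> carrier G" and w: "w \<in> carrier G"
    and f: "\<And>y. y \<in> carrier G \<Longrightarrow> KL_pairing f y = of_bool (y = v)"
  shows "inv_KL G S v w = (-1) ^ (len v + len w) * f w"
proof -
  let ?sg = "\<lambda>x. (-1) ^ (len w + len x) :: int"
  have sg: "cox_sign G S (w \<otimes> inv x) = ?sg x" if "x \<unlhd> w" for x
    using cox_sign_mult[OF w, of x] that below_carrier by blast
  have sq: "?sg x * (?sg x * c) = c" for x c
    by (simp flip: mult.assoc power_add)
  \<comment> \<open>The condition under the description in \<open>inv_KL\<close>, in coefficients.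
    Its unique solution m carries the signs relative to the plain expansion k.\<close>
  define ok where "ok m \<longleftrightarrow> (\<forall>x. \<not> x \<unlhd> w \<longrightarrow> m x = 0) \<and>
    (\<forall>u. (\<Sum>x | x \<unlhd> w. ?sg x * m x * KL1 u x) = of_bool (u = w))" for m :: "'a \<Rightarrow> int"
  have "(\<Sum>x | x \<unlhd> w. frag_cmul (cox_sign G S (w \<otimes> inv x) * m x) (KL_basis G S x)) =
      (\<Sum>x | x \<unlhd> w. frag_cmul (?sg x * m x) (KL_basis G S x))" for m
    by (intro sum.cong) (auto simp: sg)
  hence ok: "((\<forall>x. \<not> x \<unlhd> w \<longrightarrow> m x = 0) \<and> frag_of w = (\<Sum>x | x \<unlhd> w.
      frag_cmul (cox_sign G S (w \<otimes> inv x) * m x) (KL_basis G S x))) \<longleftrightarrow> ok m" for m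
    using KL_basis_expansion_iff[OF w, of "\<lambda>x. ?sg x * m x"] by (simp add: ok_def)
  obtain k where k: "\<And>u. (\<Sum>x | x \<unlhd> w. k x * KL1 u x) = of_bool (u = w)"
    using ex_KL_expansion[OF w] by blast
  define m where "m x = (if x \<unlhd> w then ?sg x * k x else 0)" for x
  have "(\<Sum>x | x \<unlhd> w. ?sg x * m x * KL1 u x) = (\<Sum>x | x \<unlhd> w. k x * KL1 u x)" for u
    by (intro sum.cong) (auto simp: m_def sq mult.assoc)
  hence m: "ok m" by (auto simp: ok_def m_def k)
  have "m' = m" if m': "ok m'" for m'
  proof
    fix x
    show "m' x = m x"
    proof (cases "x \<unlhd> w")
      case True
      have "?sg x * m' x = ?sg x * m x"
        using KL_expansion_unique[OF w _ True, of "\<lambda>x. ?sg x * m' x" "\<lambda>x. ?sg x * m x"] m m'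
        by (simp add: ok_def)
      thus ?thesis by simp
    next
      case False
      thus ?thesis using m m' by (simp add: ok_def)
    qed
  qed
  hence inv: "inv_KL G S v w = m v"
    unfolding inv_KL_def ok using m by (intro arg_cong[of _ m "\<lambda>m. m v"] the_equality)
  have "f w = (\<Sum>u | u \<unlhd> w. of_bool (u = w) * f u)"
  proof -
    have "(\<Sum>u | u \<unlhd> w. of_bool (u = w) * f u) = (\<Sum>u | u \<unlhd> w. if u = w then f w else 0)"
      by (intro sum.cong) auto
    thus ?thesis using w by simp
  qed
  also have "\<dots> = (\<Sum>u | u \<unlhd> w. \<Sum>x | x \<unlhd> w. k x * (KL1 u x * f u))"
    by (simp add: k[symmetric] sum_distrib_right mult.assoc)
  also have "\<dots> = (\<Sum>x | x \<unlhd> w. k x * (\<Sum>u | u \<unlhd> w. KL1 u x * f u))"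
    by (subst sum.swap) (simp add: sum_distrib_left)
  also have "\<dots> = (\<Sum>x | x \<unlhd> w. k x * of_bool (x = v))"
  proof (intro sum.cong HOL.refl arg_cong2[of _ _ _ _ "(*)"])
    fix x assume x: "x \<in> {x. x \<unlhd> w}"
    hence "x \<in> carrier G" using below_carrier by blast
    moreover have "{u. u \<unlhd> x} \<subseteq> {u. u \<unlhd> w}" using x below_trans by blast
    ultimately show "(\<Sum>u | u \<unlhd> w. KL1 u x * f u) = of_bool (x = v)"
      using KL_pairing_superset[of x "{u. u \<unlhd> w}" f] f[of x] by simp
  qed
  also have "\<dots> = (\<Sum>x | x \<unlhd> w. if x = v then k v else 0)"
    by (intro sum.cong) auto
  also have "\<dots> = (if v \<unlhd> w then k v else 0)" by simp
  finally show ?thesis unfolding inv m_def by (auto simp: add.commute)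
qed

text \<open>The form of \<open>KL_pairing_cell\<close> without signs. Neighbouring nodes differ by
  one letter, so their signs are opposite. This turns the sum over the neighbours minus
  \<open>m i w\<close> into the rule for the signed functions f.\<close>

theorem inv_KL_cell:
  fixes V :: "'i \<Rightarrow> 'a" and m :: "'i \<Rightarrow> 'a \<Rightarrow> int" and N :: "'i \<Rightarrow> 'i set"
  assumes V: "inj_on V I" "V ` I \<subseteq> carrier G"
    and N: "\<And>i. i \<in> I \<Longrightarrow> N i \<subseteq> I" "\<And>i. i \<in> I \<Longrightarrow> finite (N i)"
    and m_one: "\<And>i. i \<in> I \<Longrightarrow> m i \<one> = of_bool (V i = \<one>)"
    and m_step: "\<And>i s w. \<lbrakk>i \<in> I; s \<in> S; w \<in> carrier G\<rbrakk> \<Longrightarrow> m i (s \<otimes> w) =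
      (if len (s \<otimes> V i) < len (V i) then (\<Sum>j\<in>N i. m j w) - m i w else m i w)"
    and desc: "\<And>i s t. \<lbrakk>i \<in> I; s \<in> S; t \<in> S; len (s \<otimes> V i) < len (V i); len (t \<otimes> V i) < len (V i)\<rbrakk>
      \<Longrightarrow> s = t"
    and nbrs: "\<And>i s. \<lbrakk>i \<in> I; s \<in> S; len (s \<otimes> V i) < len (V i)\<rbrakk> \<Longrightarrow> V ` N i =
      insert (s \<otimes> V i) {t \<otimes> V i | t. t \<in> S \<and> t \<noteq> s \<and> \<not> len (s \<otimes> (t \<otimes> V i)) < len (t \<otimes> V i)}"
    and i: "i \<in> I" and w: "w \<in> carrier G"
  shows "inv_KL G S (V i) w = m i w"
proof -
  define f where "f i w = (-1) ^ (len (V i) + len w) * m i w" for i w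
  have f_one: "f i \<one> = of_bool (V i = \<one>)" if "i \<in> I" for i
    using m_one[OF that] by (auto simp: f_def)
  have f_step: "f i w + f i (s \<otimes> w) =
      (if len (s \<otimes> V i) < len (V i) then 2 * f i w + (\<Sum>j\<in>N i. f j w) else 0)"
    if i: "i \<in> I" and s: "s \<in> S" and w: "w \<in> carrier G" for i s w
  proof -
    have flip: "(-1) ^ (n + len (s \<otimes> u)) = - ((-1) ^ (n + len u) :: int)"
        "(-1) ^ (len (s \<otimes> u) + n) = - ((-1) ^ (len u + n) :: int)"
      if "s \<in> S" "u \<in> carrier G" for n s u
      using len_left[OF that] by (auto simp: power_add split: if_splits)
    have Vi: "V i \<in> carrier G" using V i by blast
    have "f j w = - ((-1) ^ (len (V i) + len w) * m j w)"
      if "len (s \<otimes> V i) < len (V i)" "j \<in> N i" for j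
    proof -
      have "V j \<in> insert (s \<otimes> V i) {t \<otimes> V i | t. t \<in> S \<and> t \<noteq> s \<and>
          \<not> len (s \<otimes> (t \<otimes> V i)) < len (t \<otimes> V i)}"
        using nbrs[OF i s that(1)] that(2) by blast
      then obtain t where "t \<in> S" "V j = t \<otimes> V i" using s by blast
      thus ?thesis using Vi by (simp add: f_def flip)
    qed
    hence "(\<Sum>j\<in>N i. f j w) = - ((-1) ^ (len (V i) + len w) * (\<Sum>j\<in>N i. m j w))"
      if "len (s \<otimes> V i) < len (V i)"
      using that by (simp add: sum_distrib_left sum_negf)
    thus ?thesis using m_step[OF i s w] s w by (simp add: f_def flip algebra_simps)
  qed
  have "KL_pairing (f i) y = of_bool (y = V i)" if "y \<in> carrier G" for y
    by (rule KL_pairing_cell[where V = V and I = I and N = N]) (fact V N f_one f_step desc nbrs that i)+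
  moreover have "V i \<in> carrier G" using V i by blast
  ultimately have "inv_KL G S (V i) w = (-1) ^ (len (V i) + len w) * f i w"
    by (intro inv_KL_eq w)
  thus ?thesis by (simp add: f_def flip: mult.assoc power_add)
qed

end

section \<open>Geometry of the affine Weyl group of type \<open>F\<^sub>4\<close>\<close>

definition pt :: "real \<Rightarrow> real \<Rightarrow> real \<Rightarrow> real \<Rightarrow> real ^ 4" where
  "pt a b c d = (\<chi> i. if i = 1 then a else if i = 2 then b else if i = 3 then c else d)"

lemma pt_nth [simp]: "pt a b c d $ 1 = a" "pt a b c d $ 2 = b" "pt a b c d $ 3 = c" "pt a b c d $ 4 = d"
  by (simp_all add: pt_def)

lemma vec4_eq_iff: "x = y \<longleftrightarrow> x $ 1 = y $ 1 \<and> x $ 2 = y $ 2 \<and> x $ 3 = y $ 3 \<and> x $ 4 = y $ 4"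
  for x y :: "real ^ 4"
  by (simp add: vec_eq_iff forall_4)

lemma pt_eq_iff [simp]: "pt a b c d = pt a' b' c' d' \<longleftrightarrow> a = a' \<and> b = b' \<and> c = c' \<and> d = d'"
  by (simp add: vec4_eq_iff)

lemma pt_add [simp]: "pt a b c d + pt a' b' c' d' = pt (a + a') (b + b') (c + c') (d + d')"
  by (simp add: vec4_eq_iff)

lemma pt_diff [simp]: "pt a b c d - pt a' b' c' d' = pt (a - a') (b - b') (c - c') (d - d')"
  by (simp add: vec4_eq_iff)

lemma pt_uminus [simp]: "- pt a b c d = pt (- a) (- b) (- c) (- d)"
  by (simp add: vec4_eq_iff)

lemma pt_scale [simp]: "r *\<^sub>R pt a b c d = pt (r * a) (r * b) (r * c) (r * d)"
  by (simp add: vec4_eq_iff)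

lemma pt_inner [simp]: "pt a b c d \<bullet> pt a' b' c' d' = a * a' + b * b' + c * c' + d * d'"
  by (simp add: inner_vec_def sum_4)

lemma pt_zero: "0 = pt 0 0 0 0"
  by (simp add: vec4_eq_iff)

lemma eps_pt: "eps 1 = pt 1 0 0 0" "eps 2 = pt 0 1 0 0" "eps 3 = pt 0 0 1 0" "eps 4 = pt 0 0 0 1"
  by (simp_all add: vec4_eq_iff axis_def)

lemma alpha_pt:
  "alpha1 = pt 0 1 (-1) 0" "alpha2 = pt 0 0 1 (-1)" "alpha3 = pt 0 0 0 2"
  "alpha4 = pt 1 (-1) (-1) (-1)" "theta = pt 1 1 0 0"
  by (simp_all add: alpha1_def alpha2_def alpha3_def alpha4_def theta_def eps_pt)

subsection \<open>Reflections\<close>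

lemma reflection_linear: "linear (reflection a)"
  by (rule linearI)
    (auto simp: reflection_def inner_add_left algebra_simps add_divide_distrib divide_inverse)

lemma reflection_inner: "reflection a x \<bullet> reflection a y = x \<bullet> y"
  by (cases "a = 0") (auto simp: reflection_def inner_diff_left inner_diff_right inner_commute field_simps)

lemma reflection_twice [simp]: "reflection a (reflection a x) = x"
  by (cases "a = 0") (auto simp: reflection_def inner_diff_left field_simps)

lemma reflection_comp_self: "reflection a \<circ> reflection a = id"
  by auto

lemma reflection_uminus: "reflection (- a) = reflection a"
  by (simp add: reflection_def fun_eq_iff)

lemma reflection_image:
  assumes "linear u" "\<And>x y. u x \<bullet> u y = x \<bullet> y"
  shows "reflection (u a) (u x) = u (reflection a x)"
  using assms by (simp add: reflection_def linear_diff linear_scale)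

lemma reflection_reflection:
  "reflection (reflection a b) = reflection a \<circ> reflection b \<circ> reflection a"
proof
  fix x
  show "reflection (reflection a b) x = (reflection a \<circ> reflection b \<circ> reflection a) x"
    using reflection_image[OF reflection_linear reflection_inner, of a b "reflection a x"] by simp
qed

lemma reflection_pt:
  "reflection alpha1 (pt a b c d) = pt a c b d"
  "reflection alpha2 (pt a b c d) = pt a b d c"
  "reflection alpha3 (pt a b c d) = pt a b c (- d)"
  "reflection alpha4 (pt a b c d) = pt ((a + b + c + d) / 2) ((a + b - c - d) / 2)
     ((a - b + c - d) / 2) ((a - b - c + d) / 2)"
  "reflection theta (pt a b c d) = pt (- b) (- a) c d"
  by (simp_all add: reflection_def alpha_pt field_simps)

subsection \<open>The coroot lattice\<close>

lemma coroot_comb_pt: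
  "coroot_comb a1 a2 a3 a4 = pt (of_int a4) (of_int (a1 - a4)) (of_int (a2 - a1 - a4))
     (of_int (2 * a3 - a2 - a4))"
  by (simp add: coroot_comb_def alpha_pt)

lemma coroot_lattice_iff:
  "x \<in> coroot_lattice \<longleftrightarrow> (\<exists>b1 b2 b3 b4 :: int.
     x = pt (of_int b1) (of_int b2) (of_int b3) (of_int b4) \<and> even (b1 + b2 + b3 + b4))"
proof
  assume "x \<in> coroot_lattice"
  then obtain a1 a2 a3 a4 where "x = coroot_comb a1 a2 a3 a4" by (auto simp: coroot_lattice_def)
  thus "\<exists>b1 b2 b3 b4 :: int. x = pt (of_int b1) (of_int b2) (of_int b3) (of_int b4) \<and>
      even (b1 + b2 + b3 + b4)"
    by (intro exI[of _ a4] exI[of _ "a1 - a4"] exI[of _ "a2 - a1 - a4"] exI[of _ "2 * a3 - a2 - a4"])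
      (simp add: coroot_comb_pt)
next
  assume "\<exists>b1 b2 b3 b4 :: int. x = pt (of_int b1) (of_int b2) (of_int b3) (of_int b4) \<and>
      even (b1 + b2 + b3 + b4)"
  then obtain b1 b2 b3 b4 k :: int where
    b: "x = pt (of_int b1) (of_int b2) (of_int b3) (of_int b4)" "b1 + b2 + b3 + b4 = 2 * k"
    unfolding dvd_def by blast
  \<comment> \<open>Solving \<open>coroot_comb_pt\<close> for the coefficients; the last coordinate
    gives 2 a3 = 3 b1 + b2 + b3 + b4 = 2 (b1 + k).\<close>
  have "x = coroot_comb (b1 + b2) (2 * b1 + b2 + b3) (b1 + k) b1"
    using b by (simp add: coroot_comb_pt)
  thus "x \<in> coroot_lattice" by (auto simp: coroot_lattice_def)
qed

lemma coroot_lattice_pt: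
  "even (b1 + b2 + b3 + b4) \<Longrightarrow> pt (of_int b1) (of_int b2) (of_int b3) (of_int b4) \<in> coroot_lattice"
  by (auto simp: coroot_lattice_iff)

lemma coroot_comb_combine:
  "of_int m *\<^sub>R coroot_comb a1 a2 a3 a4 + of_int n *\<^sub>R coroot_comb b1 b2 b3 b4 =
    coroot_comb (m * a1 + n * b1) (m * a2 + n * b2) (m * a3 + n * b3) (m * a4 + n * b4)"
  by (simp add: coroot_comb_def algebra_simps)

lemma coroot_lattice_combine:
  assumes "x \<in> coroot_lattice" "y \<in> coroot_lattice"
  shows "of_int m *\<^sub>R x + of_int n *\<^sub>R y \<in> coroot_lattice"
proof -
  obtain a1 a2 a3 a4 b1 b2 b3 b4 where
    "x = coroot_comb a1 a2 a3 a4" "y = coroot_comb b1 b2 b3 b4"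
    using assms by (auto simp: coroot_lattice_def)
  thus ?thesis unfolding coroot_lattice_def using coroot_comb_combine by blast
qed

lemma coroot_lattice_add: "x \<in> coroot_lattice \<Longrightarrow> y \<in> coroot_lattice \<Longrightarrow> x + y \<in> coroot_lattice"
  using coroot_lattice_combine[of x y 1 1] by simp

lemma coroot_lattice_scale: "x \<in> coroot_lattice \<Longrightarrow> of_int n *\<^sub>R x \<in> coroot_lattice"
  using coroot_lattice_combine[of x x n 0] by simp

lemma coroot_lattice_uminus: "x \<in> coroot_lattice \<Longrightarrow> - x \<in> coroot_lattice"
  using coroot_lattice_scale[of x "-1"] by simp

lemma coroot_lattice_zero: "0 \<in> coroot_lattice"
  using coroot_lattice_pt[of 0 0 0 0] by (simp add: pt_zero)

text \<open>
  The coroots of \<open>F\<^sub>4\<close> are the lattice vectors of square norm 2 (short) and 4 (long); this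
  description makes their invariance under the Weyl group evident.
\<close>

definition coroots :: "(real ^ 4) set" where
  "coroots = {x \<in> coroot_lattice. x \<bullet> x = 2 \<or> x \<bullet> x = 4}"

text \<open>The coordinates of -theta and of the four simple coroots, in the order of
  \<open>sroot\<close>.\<close>

definition simple_data :: "(int \<times> int \<times> int \<times> int) list" where
  "simple_data = [(-1, -1, 0, 0), (0, 1, -1, 0), (0, 0, 1, -1), (0, 0, 0, 2), (1, -1, -1, -1)]"

text \<open>
  Here \<open>height2 b1 b2 b3 b4 div n\<close> is the height of the root belonging to the
  coroot \<open>b\<close> of square norm \<open>n\<close>; the Coxeter number is 12.
\<close>

definition height2 :: "int \<Rightarrow> int \<Rightarrow> int \<Rightarrow> int \<Rightarrow> int" where
  "height2 b1 b2 b3 b4 = 2 * (8 * b1 + 3 * b2 + 2 * b3 + b4)"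

text \<open>The quotient c / n is the change of the root of b along the simple coroot a. The last
  two conditions treat the only ways in which a wall of b could separate two alcoves adjacent across
  the wall of a; the residue modulo 12 accounts for all parallel walls at once.\<close>

fun wall_check :: "int \<times> int \<times> int \<times> int \<Rightarrow> int \<Rightarrow> int \<Rightarrow> int \<times> int \<times> int \<times> int \<Rightarrow> bool" where
  "wall_check (b1, b2, b3, b4) n h (a1, a2, a3, a4) =
    (let c = 2 * (b1 * a1 + b2 * a2 + b3 * a3 + b4 * a4) in c mod n = 0 \<and> abs c \<le> 2 * n \<and>
     (c = 2 * n \<and> (h - 1) mod 12 = 0 \<longrightarrow> b1 = a1 \<and> b2 = a2 \<and> b3 = a3 \<and> b4 = a4) \<and>
     (c = - 2 * n \<and> (h + 1) mod 12 = 0 \<longrightarrow> b1 = - a1 \<and> b2 = - a2 \<and> b3 = - a3 \<and> b4 = - a4))"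

text \<open>The facts about coroots that rest on enumeration, in executable form: heights are
  integers, nonzero and at most 11 in absolute value, the coordinates of a long coroot have equal
  parity, and \<open>wall_check\<close> holds for every affine simple coroot.\<close>

definition coroot_check :: "int \<Rightarrow> int \<Rightarrow> int \<Rightarrow> int \<Rightarrow> bool" where
  "coroot_check b1 b2 b3 b4 =
    (let n = b1 * b1 + b2 * b2 + b3 * b3 + b4 * b4; H = height2 b1 b2 b3 b4 in
     (n = 2 \<or> n = 4) \<and> (b1 + b2 + b3 + b4) mod 2 = 0 \<longrightarrow>
     H mod n = 0 \<and> H \<noteq> 0 \<and> abs H \<le> 11 * n \<and>
     (n = 4 \<longrightarrow> (b1 - b2) mod 2 = 0 \<and> (b2 - b3) mod 2 = 0 \<and> (b3 - b4) mod 2 = 0) \<and>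
     list_all (wall_check (b1, b2, b3, b4) n (H div n)) simple_data)"

lemma coroot_checkD:
  assumes "coroot_check b1 b2 b3 b4" "n = b1 * b1 + b2 * b2 + b3 * b3 + b4 * b4"
    "n = 2 \<or> n = 4" "even (b1 + b2 + b3 + b4)"
  shows "height2 b1 b2 b3 b4 mod n = 0" "height2 b1 b2 b3 b4 \<noteq> 0" "\<bar>height2 b1 b2 b3 b4\<bar> \<le> 11 * n"
    "n = 4 \<Longrightarrow> (b1 - b2) mod 2 = 0 \<and> (b2 - b3) mod 2 = 0 \<and> (b3 - b4) mod 2 = 0"
    "list_all (wall_check (b1, b2, b3, b4) n (height2 b1 b2 b3 b4 div n)) simple_data"
proof -
  have "(b1 + b2 + b3 + b4) mod 2 = 0" using assms(4) by presburger
  note c = assms(1)[unfolded coroot_check_def Let_def, folded assms(2), rule_format, OF conjI, OF assms(3) this]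
  show "height2 b1 b2 b3 b4 mod n = 0" "height2 b1 b2 b3 b4 \<noteq> 0" "\<bar>height2 b1 b2 b3 b4\<bar> \<le> 11 * n"
    "n = 4 \<Longrightarrow> (b1 - b2) mod 2 = 0 \<and> (b2 - b3) mod 2 = 0 \<and> (b3 - b4) mod 2 = 0"
    "list_all (wall_check (b1, b2, b3, b4) n (height2 b1 b2 b3 b4 div n)) simple_data"
    using c by blast+
qed

definition small_ints :: "int list" where "small_ints = [-2, -1, 0, 1, 2]"

text \<open>A coroot has square norm at most 4, so the box of coordinates from -2 to 2 contains them
  all.\<close>

lemma coroot_check_small_ints:
  "list_all (\<lambda>b1. list_all (\<lambda>b2. list_all (\<lambda>b3. list_all (\<lambda>b4. coroot_check b1 b2 b3 b4)
     small_ints) small_ints) small_ints) small_ints"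
  by code_simp

lemma small_square:
  fixes b :: int
  assumes "b * b \<le> 4" shows "b \<in> set small_ints"
proof -
  have "\<bar>b\<bar> * \<bar>b\<bar> \<le> 4" using assms by simp
  moreover have "3 * 3 \<le> \<bar>b\<bar> * \<bar>b\<bar>" if "3 \<le> \<bar>b\<bar>" by (rule mult_mono) (use that in auto)
  ultimately have "\<bar>b\<bar> \<le> 2" by linarith
  thus ?thesis by (auto simp: small_ints_def)
qed

lemma coroot_obtain:
  assumes "\<beta> \<in> coroots"
  obtains b1 b2 b3 b4 n :: int where
    "\<beta> = pt (of_int b1) (of_int b2) (of_int b3) (of_int b4)" "even (b1 + b2 + b3 + b4)"
    "n = b1 * b1 + b2 * b2 + b3 * b3 + b4 * b4" "\<beta> \<bullet> \<beta> = of_int n" "n = 2 \<or> n = 4"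
    "coroot_check b1 b2 b3 b4"
proof -
  obtain b1 b2 b3 b4 :: int where b: "\<beta> = pt (of_int b1) (of_int b2) (of_int b3) (of_int b4)"
      "even (b1 + b2 + b3 + b4)"
    using assms by (auto simp: coroots_def coroot_lattice_iff)
  let ?n = "b1 * b1 + b2 * b2 + b3 * b3 + b4 * b4"
  have n: "\<beta> \<bullet> \<beta> = of_int ?n" by (simp add: b)
  have "\<beta> \<bullet> \<beta> = 2 \<or> \<beta> \<bullet> \<beta> = 4" using assms by (simp add: coroots_def)
  hence "real_of_int ?n = 2 \<or> real_of_int ?n = 4" unfolding n .
  hence "?n = 2 \<or> ?n = 4" by linarith
  moreover from this have "b1 * b1 \<le> 4" "b2 * b2 \<le> 4" "b3 * b3 \<le> 4" "b4 * b4 \<le> 4"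
    using zero_le_square[of b1] zero_le_square[of b2] zero_le_square[of b3] zero_le_square[of b4]
    by linarith+
  hence "coroot_check b1 b2 b3 b4"
    using coroot_check_small_ints small_square unfolding list_all_iff by blast
  ultimately show ?thesis using that b n by blast
qed

lemma coroot_norm_pos: "\<beta> \<in> coroots \<Longrightarrow> 0 < \<beta> \<bullet> \<beta>"
  by (auto simp: coroots_def)

text \<open>Only long coroots need an argument. Their coordinates are congruent modulo 2, so the
  inner product with y is congruent to b1 times the even coordinate sum of y.\<close>

lemma coroot_pairing:
  assumes "\<beta> \<in> coroots" "y \<in> coroot_lattice"
  shows "\<exists>k :: int. 2 * (y \<bullet> \<beta>) / (\<beta> \<bullet> \<beta>) = of_int k"
proof -
  obtain b1 b2 b3 b4 n :: int where b: "\<beta> = pt (of_int b1) (of_int b2) (of_int b3) (of_int b4)"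
      "even (b1 + b2 + b3 + b4)" "n = b1 * b1 + b2 * b2 + b3 * b3 + b4 * b4" "\<beta> \<bullet> \<beta> = of_int n"
      "n = 2 \<or> n = 4" "coroot_check b1 b2 b3 b4"
    using coroot_obtain[OF assms(1)] by metis
  obtain c1 c2 c3 c4 :: int where c: "y = pt (of_int c1) (of_int c2) (of_int c3) (of_int c4)"
      "even (c1 + c2 + c3 + c4)"
    using assms(2) by (auto simp: coroot_lattice_iff)
  have yb: "y \<bullet> \<beta> = of_int (c1 * b1 + c2 * b2 + c3 * b3 + c4 * b4)" by (simp add: b c)
  show ?thesis
  proof (cases "n = 2")
    case True
    thus ?thesis using yb b(4) by (intro exI[of _ "c1 * b1 + c2 * b2 + c3 * b3 + c4 * b4"]) simp
  next
    case False
    hence n: "n = 4" using b by simp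
    hence "(b1 - b2) mod 2 = 0" "(b2 - b3) mod 2 = 0" "(b3 - b4) mod 2 = 0"
      using coroot_checkD(4)[OF b(6,3,5,2)] by blast+
    hence "even (b2 - b1)" "even (b3 - b1)" "even (b4 - b1)" by presburger+
    hence "even (c2 * (b2 - b1) + c3 * (b3 - b1) + c4 * (b4 - b1) + b1 * (c1 + c2 + c3 + c4))"
      using c(2) by simp
    also have "c2 * (b2 - b1) + c3 * (b3 - b1) + c4 * (b4 - b1) + b1 * (c1 + c2 + c3 + c4) =
        c1 * b1 + c2 * b2 + c3 * b3 + c4 * b4" by (simp add: algebra_simps)
    finally obtain k where "c1 * b1 + c2 * b2 + c3 * b3 + c4 * b4 = 2 * k" by blast
    thus ?thesis using yb b(4) n by (intro exI[of _ k]) simp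
  qed
qed

lemma reflection_coroot_lattice:
  assumes "\<beta> \<in> coroots" "y \<in> coroot_lattice" shows "reflection \<beta> y \<in> coroot_lattice"
proof -
  obtain k :: int where "2 * (y \<bullet> \<beta>) / (\<beta> \<bullet> \<beta>) = of_int k" using coroot_pairing[OF assms] by blast
  hence "reflection \<beta> y = of_int 1 *\<^sub>R y + of_int (- k) *\<^sub>R \<beta>" by (simp add: reflection_def)
  thus ?thesis using assms coroot_lattice_combine[of y \<beta> 1 "- k"] by (simp add: coroots_def)
qed

text \<open>The interior point of the fundamental alcove at which all five affine simple walls have
  the value 1/12; roots take there their height divided by the Coxeter number.\<close>

definition rho :: "real ^ 4" where "rho = pt (2/3) (1/4) (1/6) (1/12)"

lemma coroot_height:
  assumes "\<beta> \<in> coroots"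
  shows "\<exists>h :: int. 2 * (rho \<bullet> \<beta>) / (\<beta> \<bullet> \<beta>) = of_int h / 12 \<and> h \<noteq> 0 \<and> \<bar>h\<bar> \<le> 11"
proof -
  obtain b1 b2 b3 b4 n :: int where b: "\<beta> = pt (of_int b1) (of_int b2) (of_int b3) (of_int b4)"
      "even (b1 + b2 + b3 + b4)" "n = b1 * b1 + b2 * b2 + b3 * b3 + b4 * b4" "\<beta> \<bullet> \<beta> = of_int n"
      "n = 2 \<or> n = 4" "coroot_check b1 b2 b3 b4"
    using coroot_obtain[OF assms(1)] by metis
  let ?H = "height2 b1 b2 b3 b4"
  note H = coroot_checkD(1-3)[OF b(6,3,5,2)]
  from H(1) obtain h where h: "?H = n * h" by (metis dvd_def mod_0_imp_dvd)
  have "24 * (rho \<bullet> \<beta>) = of_int ?H" by (simp add: rho_def b(1) height2_def)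
  hence "24 * (rho \<bullet> \<beta>) = of_int n * of_int h" unfolding h by simp
  hence "2 * (rho \<bullet> \<beta>) / (\<beta> \<bullet> \<beta>) = of_int h / 12" using b(4,5) by (auto simp: field_simps)
  moreover have "h \<noteq> 0" using H h by auto
  moreover have "\<bar>h\<bar> \<le> 11" using H(3) h b(5) by (auto simp: abs_mult)
  ultimately show ?thesis by blast
qed

section \<open>Affine walls and reflections\<close>

definition wall :: "real ^ 4 \<Rightarrow> int \<Rightarrow> real ^ 4 \<Rightarrow> real" where
  "wall \<beta> k y = 2 * (y \<bullet> \<beta>) / (\<beta> \<bullet> \<beta>) + of_int k"

definition aff_refl :: "real ^ 4 \<Rightarrow> int \<Rightarrow> real ^ 4 \<Rightarrow> real ^ 4" where
  "aff_refl \<beta> k y = y - wall \<beta> k y *\<^sub>R \<beta>"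

definition sroot :: "nat \<Rightarrow> real ^ 4" where
  "sroot j = [- theta, alpha1, alpha2, alpha3, alpha4] ! j"

definition soff :: "nat \<Rightarrow> int" where "soff j = of_bool (j = 0)"

lemma less_5_cases: "(j :: nat) < 5 \<longleftrightarrow> j = 0 \<or> j = 1 \<or> j = 2 \<or> j = 3 \<or> j = 4"
  by auto

lemma sroot_pt:
  "sroot 0 = pt (-1) (-1) 0 0" "sroot (Suc 0) = pt 0 1 (-1) 0" "sroot 2 = pt 0 0 1 (-1)"
  "sroot 3 = pt 0 0 0 2" "sroot 4 = pt 1 (-1) (-1) (-1)"
  by (simp_all add: sroot_def alpha_pt)

lemma soff_simps [simp]: "soff 0 = 1" "soff (Suc j) = 0" "soff (numeral m) = 0"
  by (simp_all add: soff_def)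

lemma sroot_data:
  assumes "j < 5"
  obtains a1 a2 a3 a4 where "(a1, a2, a3, a4) \<in> set simple_data"
    "sroot j = pt (of_int a1) (of_int a2) (of_int a3) (of_int a4)"
proof -
  obtain a1 a2 a3 a4 where a: "simple_data ! j = (a1, a2, a3, a4)" by (metis prod_cases4)
  have "simple_data ! j \<in> set simple_data" using assms by (intro nth_mem) (simp add: simple_data_def)
  moreover have "sroot j = pt (of_int a1) (of_int a2) (of_int a3) (of_int a4)"
    using assms a unfolding less_5_cases by (auto simp: sroot_pt simple_data_def)
  ultimately show ?thesis using that a by simp
qed

lemma sroot_coroot: "j < 5 \<Longrightarrow> sroot j \<in> coroots"
  unfolding less_5_cases coroots_def
  using coroot_lattice_pt[of "-1" "-1" 0 0] coroot_lattice_pt[of 0 1 "-1" 0]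
    coroot_lattice_pt[of 0 0 1 "-1"] coroot_lattice_pt[of 0 0 0 2] coroot_lattice_pt[of 1 "-1" "-1" "-1"]
  by (auto simp: sroot_pt)

lemma wall_sroot_rho: "j < 5 \<Longrightarrow> wall (sroot j) (soff j) rho = 1 / 12"
  unfolding less_5_cases by (auto simp: sroot_pt wall_def rho_def)

text \<open>At \<open>rho\<close> and at its mirror image the wall function has the values N/12 and
  (N - d)/12 with integers N = h + 12 k and |d| at most 2. Opposite signs leave only N = 1, d = 2
  and N = -1, d = -2, which \<open>wall_check\<close> settles.\<close>

lemma wall_separates_adjacent:
  assumes \<beta>: "\<beta> \<in> coroots" and j: "j < 5"
    and sep: "wall \<beta> k rho * wall \<beta> k (aff_refl (sroot j) (soff j) rho) < 0"
  shows "\<beta> = sroot j \<and> k = soff j \<or> \<beta> = - sroot j \<and> k = - soff j"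
proof -
  obtain b1 b2 b3 b4 n :: int where b: "\<beta> = pt (of_int b1) (of_int b2) (of_int b3) (of_int b4)"
      "even (b1 + b2 + b3 + b4)" "n = b1 * b1 + b2 * b2 + b3 * b3 + b4 * b4" "\<beta> \<bullet> \<beta> = of_int n"
      "n = 2 \<or> n = 4" "coroot_check b1 b2 b3 b4"
    using coroot_obtain[OF \<beta>] by metis
  obtain a1 a2 a3 a4 where a: "(a1, a2, a3, a4) \<in> set simple_data"
      "sroot j = pt (of_int a1) (of_int a2) (of_int a3) (of_int a4)"
    using sroot_data[OF j] by metis
  let ?H = "height2 b1 b2 b3 b4"
  let ?c = "2 * (b1 * a1 + b2 * a2 + b3 * a3 + b4 * a4)"
  note H = coroot_checkD(1)[OF b(6,3,5,2)]
  have "wall_check (b1, b2, b3, b4) n (?H div n) (a1, a2, a3, a4)"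
    using coroot_checkD(5)[OF b(6,3,5,2)] a(1) unfolding list_all_iff by blast
  note w = this[unfolded wall_check.simps Let_def]
  note c = w[THEN conjunct1] w[THEN conjunct2, THEN conjunct1]
    w[THEN conjunct2, THEN conjunct2, THEN conjunct1, rule_format, OF conjI]
    w[THEN conjunct2, THEN conjunct2, THEN conjunct2, rule_format, OF conjI]
  obtain h d where hd: "?H = n * h" "?c = n * d" using H c(1) by (metis dvd_def mod_0_imp_dvd)
  have n0: "0 < n" using b(5) by auto
  have "24 * (rho \<bullet> \<beta>) = of_int ?H" by (simp add: rho_def b(1) height2_def)
  hence rb: "24 * (rho \<bullet> \<beta>) = of_int n * of_int h" unfolding hd(1) by simp
  have "2 * (sroot j \<bullet> \<beta>) = of_int ?c" by (simp add: a(2) b(1) algebra_simps)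
  hence ab: "2 * (sroot j \<bullet> \<beta>) = of_int n * of_int d" unfolding hd(2) by simp
  have w1: "wall \<beta> k rho = of_int (h + 12 * k) / 12"
    using rb n0 b(4) by (simp add: wall_def field_simps)
  have "aff_refl (sroot j) (soff j) rho = rho - (1 / 12) *\<^sub>R sroot j"
    by (simp add: aff_refl_def wall_sroot_rho[OF j])
  hence "wall \<beta> k (aff_refl (sroot j) (soff j) rho) = wall \<beta> k rho - (2 * (sroot j \<bullet> \<beta>) / (\<beta> \<bullet> \<beta>)) / 12"
    by (simp add: wall_def inner_diff_left diff_divide_distrib)
  hence w2: "wall \<beta> k (aff_refl (sroot j) (soff j) rho) = of_int (h + 12 * k - d) / 12"
    using ab n0 b(4) by (simp add: w1 diff_divide_distrib)
  have "of_int ((h + 12 * k) * (h + 12 * k - d)) < (0 :: real)"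
    using sep unfolding w1 w2 of_int_mult by (simp add: mult_less_0_iff)
  hence neg: "(h + 12 * k) * (h + 12 * k - d) < 0" by linarith
  have "\<bar>d\<bar> \<le> 2" using c(2) n0 unfolding hd(2) by (simp add: abs_mult)
  with neg consider "h + 12 * k = 1" "d = 2" | "h + 12 * k = -1" "d = -2"
    by (auto simp: mult_less_0_iff)
  thus ?thesis
  proof cases
    case 1
    have "?H div n = h" using hd n0 by simp
    moreover have "(h - 1) mod 12 = 0" using 1 by presburger
    ultimately have "b1 = a1 \<and> b2 = a2 \<and> b3 = a3 \<and> b4 = a4" using c(3) hd(2) 1 by simp
    hence *: "\<beta> = sroot j" using a b by simp
    have "wall \<beta> k rho = wall (sroot j) (soff j) rho" using w1 1 wall_sroot_rho[OF j] by simp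
    thus ?thesis using * by (simp add: wall_def)
  next
    case 2
    have "?H div n = h" using hd n0 by simp
    moreover have "(h + 1) mod 12 = 0" using 2 by presburger
    ultimately have "b1 = - a1 \<and> b2 = - a2 \<and> b3 = - a3 \<and> b4 = - a4" using c(4) hd(2) 2 by simp
    hence *: "\<beta> = - sroot j" using a b by simp
    have "wall \<beta> k rho = - wall (sroot j) (soff j) rho" using w1 2 wall_sroot_rho[OF j] by simp
    hence "of_int k = - (of_int (soff j) :: real)" using * by (simp add: wall_def)
    thus ?thesis using * by linarith
  qed
qed

subsection \<open>The Weyl group and its affine extension\<close>

lemma weyl_comp: "u \<in> weyl_group \<Longrightarrow> v \<in> weyl_group \<Longrightarrow> u \<circ> v \<in> weyl_group"
  by (induction u rule: weyl_group.induct) (auto simp: comp_assoc intro: weyl_group.refl)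

lemma reflection_weyl: "a \<in> {alpha1, alpha2, alpha3, alpha4} \<Longrightarrow> reflection a \<in> weyl_group"
  using weyl_group.refl[OF weyl_group.id, of a] by simp

lemma weyl_inverse: "u \<in> weyl_group \<Longrightarrow> \<exists>v\<in>weyl_group. v \<circ> u = id \<and> u \<circ> v = id"
proof (induction u rule: weyl_group.induct)
  case id
  show ?case by (intro bexI[of _ id] weyl_group.id) simp_all
next
  case (refl u a)
  then obtain v where v: "v \<in> weyl_group" "v \<circ> u = id" "u \<circ> v = id" by blast
  have "v \<circ> reflection a \<circ> (reflection a \<circ> u) = id" "reflection a \<circ> u \<circ> (v \<circ> reflection a) = id"
    using v(2,3) by (auto simp: fun_eq_iff)
  thus ?case using v reflection_weyl[OF refl.hyps(2)] weyl_comp by blast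
qed

lemma simple_coroots: "a \<in> {alpha1, alpha2, alpha3, alpha4} \<Longrightarrow> a \<in> coroots"
  using sroot_coroot[of 1] sroot_coroot[of 2] sroot_coroot[of 3] sroot_coroot[of 4]
  by (auto simp: sroot_def)

lemma weyl_orthogonal:
  assumes "u \<in> weyl_group"
  shows "linear u \<and> (\<forall>x y. u x \<bullet> u y = x \<bullet> y) \<and> (\<forall>x\<in>coroot_lattice. u x \<in> coroot_lattice)"
  using assms
proof (induction u rule: weyl_group.induct)
  case id
  show ?case by (simp add: id_def linear_ident)
next
  case (refl u a)
  have "a \<in> coroots" using simple_coroots refl.hyps by blast
  moreover have "linear (reflection a \<circ> u)"
    using refl.IH by (intro linear_compose[OF _ reflection_linear]) blast
  ultimately show ?case using refl.IH
    by (simp add: o_def reflection_inner reflection_coroot_lattice)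
qed

lemma weyl_linear: "u \<in> weyl_group \<Longrightarrow> linear u"
  and weyl_inner: "u \<in> weyl_group \<Longrightarrow> u x \<bullet> u y = x \<bullet> y"
  and weyl_lattice: "u \<in> weyl_group \<Longrightarrow> z \<in> coroot_lattice \<Longrightarrow> u z \<in> coroot_lattice"
  using weyl_orthogonal by auto

lemma weyl_coroot: "u \<in> weyl_group \<Longrightarrow> \<beta> \<in> coroots \<Longrightarrow> u \<beta> \<in> coroots"
  by (simp add: coroots_def weyl_inner weyl_lattice)

lemma affine_weyl_simps [simp]:
  "carrier affine_weyl = coroot_lattice \<times> weyl_group"
  "(x, u) \<otimes>\<^bsub>affine_weyl\<^esub> (y, v) = (x + u y, u \<circ> v)"
  "\<one>\<^bsub>affine_weyl\<^esub> = (0, id)"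
  by (simp_all add: affine_weyl_def)

lemma group_affine_weyl: "group affine_weyl"
proof (rule groupI)
  fix g h assume "g \<in> carrier affine_weyl" "h \<in> carrier affine_weyl"
  thus "g \<otimes>\<^bsub>affine_weyl\<^esub> h \<in> carrier affine_weyl"
    by (cases g; cases h) (simp add: coroot_lattice_add weyl_lattice weyl_comp)
next
  show "\<one>\<^bsub>affine_weyl\<^esub> \<in> carrier affine_weyl"
    by (simp add: coroot_lattice_zero weyl_group.id)
next
  fix g h k assume "g \<in> carrier affine_weyl"
  thus "g \<otimes>\<^bsub>affine_weyl\<^esub> h \<otimes>\<^bsub>affine_weyl\<^esub> k = g \<otimes>\<^bsub>affine_weyl\<^esub> (h \<otimes>\<^bsub>affine_weyl\<^esub> k)"
    by (cases g; cases h; cases k) (simp add: linear_add[OF weyl_linear] add.assoc comp_assoc)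
next
  fix g assume g: "g \<in> carrier affine_weyl"
  thus "\<one>\<^bsub>affine_weyl\<^esub> \<otimes>\<^bsub>affine_weyl\<^esub> g = g" by (cases g) simp
  obtain x u where xu: "g = (x, u)" "x \<in> coroot_lattice" "u \<in> weyl_group" using g by (cases g) auto
  then obtain v where "v \<in> weyl_group" "v \<circ> u = id" using weyl_inverse by blast
  thus "\<exists>h\<in>carrier affine_weyl. h \<otimes>\<^bsub>affine_weyl\<^esub> g = \<one>\<^bsub>affine_weyl\<^esub>"
    using xu by (intro bexI[of _ "(- v x, v)"]) (simp_all add: weyl_lattice coroot_lattice_uminus)
qed

section \<open>The action on Euclidean space\<close>

definition act :: "aff_elt \<Rightarrow> real ^ 4 \<Rightarrow> real ^ 4" where
  "act g y = fst g + snd g y"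

lemma act_mult:
  "g \<in> carrier affine_weyl \<Longrightarrow> act (g \<otimes>\<^bsub>affine_weyl\<^esub> h) y = act g (act h y)"
  by (cases g; cases h) (auto simp: act_def linear_add[OF weyl_linear])

lemma act_one [simp]: "act \<one>\<^bsub>affine_weyl\<^esub> y = y"
  by (simp add: act_def)

lemma act_diff: "g \<in> carrier affine_weyl \<Longrightarrow> act g x - act g y = snd g (x - y)"
  by (cases g) (auto simp: act_def linear_diff[OF weyl_linear])

lemma fst_eq_act: "g \<in> carrier affine_weyl \<Longrightarrow> fst g = act g 0"
  by (cases g) (auto simp: act_def linear_0[OF weyl_linear])

lemma act_inject:
  assumes "g \<in> carrier affine_weyl" "h \<in> carrier affine_weyl" "\<And>y. act g y = act h y"
  shows "g = h"
proof (rule prod_eqI)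
  show *: "fst g = fst h" using assms fst_eq_act by simp
  show "snd g = snd h"
  proof
    fix y show "snd g y = snd h y" using assms(3)[of y] * by (simp add: act_def)
  qed
qed

lemma act_inner:
  "g \<in> carrier affine_weyl \<Longrightarrow> (act g x - act g y) \<bullet> (act g z - act g w) = (x - y) \<bullet> (z - w)"
  by (cases g) (auto simp: act_diff weyl_inner)

definition sr :: "nat \<Rightarrow> aff_elt" where
  "sr j = (- of_int (soff j) *\<^sub>R sroot j, reflection (sroot j))"

lemma simple_reflections_eq: "simple_reflections = sr ` {..<5}"
proof -
  have "{..<5} = {0, 1, 2, 3, 4 :: nat}" by auto
  thus ?thesis
    by (auto simp: simple_reflections_def sr_def sroot_def embed_weyl_def translation_def
        reflection_uminus)
qed

lemma act_sr: "act (sr j) y = aff_refl (sroot j) (soff j) y"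
  by (simp add: act_def sr_def aff_refl_def wall_def reflection_def algebra_simps)

lemma act_sr_pt:
  "act (sr 0) (pt a b c d) = pt (1 - b) (1 - a) c d"
  "act (sr (Suc 0)) (pt a b c d) = pt a c b d"
  "act (sr 2) (pt a b c d) = pt a b d c"
  "act (sr 3) (pt a b c d) = pt a b c (- d)"
  "act (sr 4) (pt a b c d) = pt ((a + b + c + d) / 2) ((a + b - c - d) / 2)
     ((a - b + c - d) / 2) ((a - b - c + d) / 2)"
  by (simp_all add: act_sr aff_refl_def wall_def sroot_pt field_simps)

abbreviation aff_mult (infixl \<open>\<odot>\<close> 70) where "g \<odot> h \<equiv> g \<otimes>\<^bsub>affine_weyl\<^esub> h"

interpretation affine_weyl: group affine_weyl
  by (rule group_affine_weyl)

text \<open>A walk through short coroots by simple reflections. It is stated for an arbitrary stable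
  set because it serves both for reflections and for translations.\<close>

lemma theta_chain:
  assumes step: "\<And>x a. x \<in> P \<Longrightarrow> a \<in> {alpha1, alpha2, alpha3, alpha4} \<Longrightarrow> reflection a x \<in> P"
    and P: "theta \<in> P"
  shows "pt 1 0 0 (-1) \<in> P" "pt 0 0 1 1 \<in> P" "alpha2 \<in> P" "- alpha2 \<in> P" "pt 0 (-1) (-1) 0 \<in> P"
    "alpha1 \<in> P"
proof -
  have 1: "pt 1 0 1 0 \<in> P" using step[OF P, of alpha1] by (simp add: alpha_pt(5) reflection_pt)
  have 2: "pt 1 0 0 1 \<in> P" using step[OF 1, of alpha2] by (simp add: reflection_pt)
  show 3: "pt 1 0 0 (-1) \<in> P" using step[OF 2, of alpha3] by (simp add: reflection_pt)
  have 4: "pt 0 1 1 0 \<in> P" using step[OF 3, of alpha4] by (simp add: reflection_pt)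
  have 5: "pt 0 1 0 1 \<in> P" using step[OF 4, of alpha2] by (simp add: reflection_pt)
  show 6: "pt 0 0 1 1 \<in> P" using step[OF 5, of alpha1] by (simp add: reflection_pt)
  have 7: "pt 0 0 1 (-1) \<in> P" using step[OF 6, of alpha3] by (simp add: reflection_pt)
  thus "alpha2 \<in> P" by (simp add: alpha_pt)
  have 8: "pt 0 0 (-1) 1 \<in> P" using step[OF 7, of alpha2] by (simp add: reflection_pt)
  thus "- alpha2 \<in> P" by (simp add: alpha_pt)
  have 9: "pt 0 0 (-1) (-1) \<in> P" using step[OF 8, of alpha3] by (simp add: reflection_pt)
  have 10: "pt 0 (-1) 0 (-1) \<in> P" using step[OF 9, of alpha1] by (simp add: reflection_pt)
  show "pt 0 (-1) (-1) 0 \<in> P" using step[OF 10, of alpha2] by (simp add: reflection_pt)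
  have 11: "pt 0 1 0 (-1) \<in> P" using step[OF 5, of alpha3] by (simp add: reflection_pt)
  have "pt 0 1 (-1) 0 \<in> P" using step[OF 11, of alpha2] by (simp add: reflection_pt)
  thus "alpha1 \<in> P" by (simp add: alpha_pt)
qed

lemma reflection_theta_weyl: "reflection theta \<in> weyl_group"
proof -
  \<comment> \<open>An implication runs the walk backwards: it is trivial at \<open>theta\<close>,
    is preserved by conjugation with simple reflections, and its premise holds at the simple coroot
    \<open>alpha2\<close>.\<close>
  let ?P = "{x. reflection x \<in> weyl_group \<longrightarrow> reflection theta \<in> weyl_group}"
  have "alpha2 \<in> ?P"
  proof (rule theta_chain)
    fix x a assume x: "x \<in> ?P" and a: "a \<in> {alpha1, alpha2, alpha3, alpha4}"
    have "reflection x \<in> weyl_group" if "reflection (reflection a x) \<in> weyl_group"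
    proof -
      have "reflection x = reflection a \<circ> reflection (reflection a x) \<circ> reflection a"
        by (auto simp: reflection_reflection)
      thus ?thesis using that reflection_weyl[OF a] weyl_comp by metis
    qed
    thus "reflection a x \<in> ?P" using x by blast
  qed simp
  thus ?thesis using reflection_weyl[of alpha2] by simp
qed

lemma reflection_sroot_weyl: "j < 5 \<Longrightarrow> reflection (sroot j) \<in> weyl_group"
  unfolding less_5_cases using reflection_theta_weyl reflection_weyl
  by (auto simp: sroot_def reflection_uminus)

lemma sr_carrier: "j < 5 \<Longrightarrow> sr j \<in> carrier affine_weyl"
  using coroot_lattice_scale[of "sroot j" "- soff j"] sroot_coroot[of j] reflection_sroot_weyl[of j]
  by (simp add: sr_def coroots_def)

lemma simple_carrier: "s \<in> simple_reflections \<Longrightarrow> s \<in> carrier affine_weyl"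
  using sr_carrier by (auto simp: simple_reflections_eq)

lemma aff_refl_twice: "\<beta> \<in> coroots \<Longrightarrow> aff_refl \<beta> k (aff_refl \<beta> k y) = y"
  using coroot_norm_pos[of \<beta>]
  by (auto simp: aff_refl_def wall_def inner_diff_left field_simps simp flip: scaleR_left_distrib)

lemma sr_square: "j < 5 \<Longrightarrow> sr j \<odot> sr j = \<one>\<^bsub>affine_weyl\<^esub>"
  using sr_carrier[of j] affine_weyl.m_closed[of "sr j" "sr j"] affine_weyl.one_closed
  by (intro act_inject) (simp_all only: act_mult act_one act_sr aff_refl_twice sroot_coroot)

subsection \<open>Generation by simple reflections\<close>

definition generated :: "aff_elt \<Rightarrow> bool" where
  "generated g \<longleftrightarrow> (\<exists>ss. set ss \<subseteq> simple_reflections \<and> foldr (\<odot>) ss \<one>\<^bsub>affine_weyl\<^esub> = g)"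

lemma generated_one: "generated \<one>\<^bsub>affine_weyl\<^esub>"
  unfolding generated_def by (intro exI[of _ "[]"]) simp

lemma generated_carrier: "generated g \<Longrightarrow> g \<in> carrier affine_weyl"
proof -
  have "set ss \<subseteq> simple_reflections \<Longrightarrow> foldr (\<odot>) ss \<one>\<^bsub>affine_weyl\<^esub> \<in> carrier affine_weyl" for ss
    by (induction ss) (simp_all add: simple_carrier affine_weyl.m_closed affine_weyl.one_closed
      del: affine_weyl_simps)
  thus "generated g \<Longrightarrow> g \<in> carrier affine_weyl" unfolding generated_def by blast
qed

lemma generated_simple_mult:
  assumes "s \<in> simple_reflections" "generated g" shows "generated (s \<odot> g)"
proof -
  obtain ss where "set ss \<subseteq> simple_reflections" "foldr (\<odot>) ss \<one>\<^bsub>affine_weyl\<^esub> = g"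
    using assms(2) unfolding generated_def by blast
  thus ?thesis using assms(1) unfolding generated_def by (intro exI[of _ "s # ss"]) simp
qed

lemma generated_mult:
  assumes "generated g" "generated h" shows "generated (g \<odot> h)"
proof -
  have h: "h \<in> carrier affine_weyl" using assms generated_carrier by blast
  have "generated (foldr (\<odot>) ss \<one>\<^bsub>affine_weyl\<^esub> \<odot> h)" if "set ss \<subseteq> simple_reflections" for ss
    using that
  proof (induction ss)
    case Nil
    thus ?case using assms(2) affine_weyl.l_one[OF h] by (simp del: affine_weyl_simps)
  next
    case (Cons s ss)
    have "foldr (\<odot>) ss \<one>\<^bsub>affine_weyl\<^esub> \<in> carrier affine_weyl"
      using Cons.prems by (intro generated_carrier) (auto simp: generated_def)
    thus ?case
      using Cons generated_simple_mult[of s] simple_carrier[of s] h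
      by (simp add: affine_weyl.m_assoc del: affine_weyl_simps)
  qed
  thus ?thesis using assms(1) unfolding generated_def by blast
qed

lemma generated_sr: "j < 5 \<Longrightarrow> generated (sr j)"
  using generated_simple_mult[of "sr j", OF _ generated_one] affine_weyl.r_one[OF sr_carrier[of j]]
  by (auto simp: simple_reflections_eq simp del: affine_weyl_simps)

lemma generated_embed: "u \<in> weyl_group \<Longrightarrow> generated (0, u)"
proof (induction u rule: weyl_group.induct)
  case id
  show ?case using generated_one by (simp only: affine_weyl_simps)
next
  case (refl u a)
  have "(0, reflection a) \<in> simple_reflections"
    using refl.hyps by (auto simp: simple_reflections_def embed_weyl_def)
  hence "generated ((0, reflection a) \<odot> (0, u))" by (intro generated_simple_mult refl.IH)
  moreover have "(0, reflection a) \<odot> (0, u) = (0, reflection a \<circ> u)"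
    by (simp add: linear_0[OF reflection_linear])
  ultimately show ?case by (simp only:)
qed

definition gen_trans :: "(real ^ 4) set" where "gen_trans = {x. generated (x, id)}"

lemma gen_trans_add: "x \<in> gen_trans \<Longrightarrow> y \<in> gen_trans \<Longrightarrow> x + y \<in> gen_trans"
  using generated_mult[of "(x, id)" "(y, id)"] by (simp add: gen_trans_def)

text \<open>Conjugating the translation by x with u gives the translation by u x.\<close>

lemma gen_trans_weyl:
  assumes "x \<in> gen_trans" "u \<in> weyl_group" shows "u x \<in> gen_trans"
proof -
  obtain v where v: "v \<in> weyl_group" "u \<circ> v = id" using weyl_inverse assms(2) by blast
  have "generated ((0, u) \<odot> (x, id) \<odot> (0, v))"
    using assms v by (intro generated_mult generated_embed) (simp_all add: gen_trans_def)
  thus ?thesis using v assms(2) by (simp add: gen_trans_def linear_0[OF weyl_linear])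
qed

lemma gen_trans_theta: "theta \<in> gen_trans"
proof -
  have "generated (sr 0 \<odot> (0, reflection theta))"
    by (intro generated_mult generated_sr generated_embed reflection_theta_weyl) simp
  thus ?thesis
    by (simp add: gen_trans_def sr_def sroot_def reflection_uminus reflection_comp_self
        linear_0[OF reflection_linear])
qed

lemma gen_trans_scale:
  assumes "x \<in> gen_trans" "- x \<in> gen_trans" shows "of_int n *\<^sub>R x \<in> gen_trans"
proof -
  have *: "of_nat k *\<^sub>R z \<in> gen_trans" if "z \<in> gen_trans" for k z
  proof (induction k)
    case 0
    thus ?case using generated_one by (simp add: gen_trans_def)
  next
    case (Suc k)
    thus ?case using gen_trans_add[OF that, of "of_nat k *\<^sub>R z"] by (simp add: algebra_simps)
  qed
  show ?thesis
    using *[OF assms(1), of "nat n"] *[OF assms(2), of "nat (- n)"] by (cases "0 \<le> n") auto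
qed

text \<open>The orbit of \<open>theta\<close> supplies the short coroots only. The long simple ones
  are sums of two of them: \<open>alpha3\<close> of (0,0,1,1) and (0,0,-1,1), \<open>alpha4\<close>
  of (1,0,0,-1) and (0,-1,-1,0).\<close>

lemma gen_trans_lattice: "x \<in> coroot_lattice \<Longrightarrow> x \<in> gen_trans"
proof -
  have step: "reflection a x \<in> gen_trans"
    if "x \<in> gen_trans" "a \<in> {alpha1, alpha2, alpha3, alpha4}" for x a
    using that gen_trans_weyl reflection_weyl by blast
  note chain = theta_chain[of gen_trans, OF step gen_trans_theta]
  have 3: "alpha3 \<in> gen_trans" using gen_trans_add[OF chain(2,4)] by (simp add: alpha_pt)
  have 4: "alpha4 \<in> gen_trans" using gen_trans_add[OF chain(1,5)] by (simp add: alpha_pt)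
  have neg: "reflection alpha1 alpha1 = - alpha1" "reflection alpha3 alpha3 = - alpha3"
      "reflection alpha4 alpha4 = - alpha4"
    unfolding alpha_pt using reflection_pt by (simp_all add: alpha_pt)
  have "- alpha1 \<in> gen_trans" "- alpha3 \<in> gen_trans" "- alpha4 \<in> gen_trans"
    using step[OF chain(6), of alpha1] step[OF 3, of alpha3] step[OF 4, of alpha4] neg by simp_all
  hence "coroot_comb a1 a2 a3 a4 \<in> gen_trans" for a1 a2 a3 a4
    unfolding coroot_comb_def using chain 3 4 by (intro gen_trans_add gen_trans_scale)
  thus "x \<in> coroot_lattice \<Longrightarrow> x \<in> gen_trans" by (auto simp: coroot_lattice_def)
qed

lemma generated_all:
  assumes "g \<in> carrier affine_weyl" shows "generated g"
proof -
  obtain x u where g: "g = (x, u)" "x \<in> coroot_lattice" "u \<in> weyl_group" using assms by (cases g) auto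
  have "generated ((x, id) \<odot> (0, u))"
    using g gen_trans_lattice generated_embed by (intro generated_mult) (auto simp: gen_trans_def)
  thus ?thesis by (simp add: g)
qed

subsection \<open>Separation of alcoves\<close>

lemma aff_refl_conj:
  assumes g: "g \<in> carrier affine_weyl" and \<beta>: "\<beta> \<in> coroots"
  obtains k' where "snd g \<beta> \<in> coroots"
    "\<And>y. act g (aff_refl \<beta> k y) = aff_refl (snd g \<beta>) k' (act g y)"
proof -
  obtain x u where xu: "g = (x, u)" "x \<in> coroot_lattice" "u \<in> weyl_group" using g by (cases g) auto
  have u\<beta>: "u \<beta> \<in> coroots" using weyl_coroot xu \<beta> by blast
  then obtain p :: int where p: "2 * (x \<bullet> u \<beta>) / (u \<beta> \<bullet> u \<beta>) = of_int p"
    using coroot_pairing xu by blast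
  have "wall (u \<beta>) (k - p) (x + u y) = wall \<beta> k y" for y
    using p by (simp add: wall_def inner_add_left weyl_inner[OF xu(3)] distrib_left add_divide_distrib)
  hence "act g (aff_refl \<beta> k y) = aff_refl (snd g \<beta>) (k - p) (act g y)" for y
    using weyl_linear[OF xu(3)] by (simp add: xu act_def aff_refl_def linear_diff linear_scale)
  thus ?thesis using that u\<beta> xu by simp
qed

text \<open>A nonzero height of absolute value at most 11 is not a multiple of 12.\<close>

lemma wall_rho_nonzero:
  assumes "\<beta> \<in> coroots" shows "wall \<beta> k rho \<noteq> 0"
proof -
  obtain h :: int where h: "2 * (rho \<bullet> \<beta>) / (\<beta> \<bullet> \<beta>) = of_int h / 12" "h \<noteq> 0" "\<bar>h\<bar> \<le> 11"
    using coroot_height[OF assms] by blast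
  have "h + 12 * k \<noteq> 0" using h by presburger
  hence "real_of_int (h + 12 * k) \<noteq> 0" by linarith
  thus ?thesis unfolding wall_def h(1) by (simp add: field_simps)
qed

lemma wall_act_rho_nonzero:
  assumes "g \<in> carrier affine_weyl" "\<beta> \<in> coroots" shows "wall \<beta> k (act g rho) \<noteq> 0"
proof -
  obtain x u where xu: "g = (x, u)" "x \<in> coroot_lattice" "u \<in> weyl_group" using assms by (cases g) auto
  obtain v where v: "v \<in> weyl_group" "u \<circ> v = id" using weyl_inverse xu by blast
  hence uv: "u (v \<beta>) = \<beta>" by (simp add: fun_eq_iff)
  obtain p :: int where p: "2 * (x \<bullet> \<beta>) / (\<beta> \<bullet> \<beta>) = of_int p"
    using coroot_pairing assms xu by blast
  have "u rho \<bullet> \<beta> = rho \<bullet> v \<beta>" using weyl_inner[OF xu(3), of rho "v \<beta>"] uv by simp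
  hence "wall \<beta> k (act g rho) = wall (v \<beta>) (k + p) rho"
    using p by (simp add: xu act_def wall_def inner_add_left weyl_inner[OF v(1)] distrib_left add_divide_distrib)
  thus ?thesis using wall_rho_nonzero weyl_coroot v assms by metis
qed

text \<open>The displacement of a point under t is normal to the wall of t, and its sign tells the
  side. The inner product of two displacements detects opposite sides without choosing a coroot for
  t.\<close>

definition alcove_sep :: "aff_elt \<Rightarrow> aff_elt \<Rightarrow> bool" where
  "alcove_sep t w \<longleftrightarrow> (rho - act t rho) \<bullet> (act w rho - act t (act w rho)) < 0"

lemma aff_refl_sep:
  assumes "\<beta> \<in> coroots"
  shows "(x - aff_refl \<beta> k x) \<bullet> (y - aff_refl \<beta> k y) < 0 \<longleftrightarrow> wall \<beta> k x * wall \<beta> k y < 0"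
proof -
  have "(x - aff_refl \<beta> k x) \<bullet> (y - aff_refl \<beta> k y) = (wall \<beta> k x * wall \<beta> k y) * (\<beta> \<bullet> \<beta>)"
    by (simp add: aff_refl_def)
  thus ?thesis
    using coroot_norm_pos[OF assms] mult_less_0_iff[of "wall \<beta> k x * wall \<beta> k y" "\<beta> \<bullet> \<beta>"] by linarith
qed

lemma wall_aff_refl:
  assumes "\<beta> \<in> coroots" shows "wall \<beta> k (aff_refl \<beta> k x) = - wall \<beta> k x"
proof -
  have "wall \<beta> k (x - c *\<^sub>R \<beta>) = wall \<beta> k x - 2 * c" for c
    using coroot_norm_pos[OF assms] by (simp add: wall_def inner_diff_left right_diff_distrib diff_divide_distrib)
  thus ?thesis by (simp add: aff_refl_def)
qed

lemma reflection_is_aff_refl: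
  assumes "t \<in> cox_reflections affine_weyl simple_reflections"
  obtains \<beta> k where "\<beta> \<in> coroots" "t \<in> carrier affine_weyl" "\<And>y. act t y = aff_refl \<beta> k y"
proof -
  obtain g j where gj: "g \<in> carrier affine_weyl" "j < 5"
      "t = g \<odot> sr j \<odot> inv\<^bsub>affine_weyl\<^esub> g"
    using assms unfolding cox_reflections_def simple_reflections_eq by blast
  obtain k' where k': "snd g (sroot j) \<in> coroots"
      "\<And>y. act g (aff_refl (sroot j) (soff j) y) = aff_refl (snd g (sroot j)) k' (act g y)"
    using aff_refl_conj[OF gj(1) sroot_coroot[OF gj(2)]] by metis
  let ?g = "inv\<^bsub>affine_weyl\<^esub> g"
  have c: "?g \<in> carrier affine_weyl" "g \<odot> sr j \<in> carrier affine_weyl"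
    using gj sr_carrier affine_weyl.inv_closed affine_weyl.m_closed by auto
  have "act g (act ?g y) = y" for y
    using act_mult[OF gj(1), of ?g y] affine_weyl.r_inv[OF gj(1)] act_one by metis
  hence "act t y = aff_refl (snd g (sroot j)) k' y" for y
    using act_mult[OF c(2)] act_mult[OF gj(1)] k'(2) unfolding gj(3) by (simp only: act_sr)
  moreover have "t \<in> carrier affine_weyl" unfolding gj(3) using c affine_weyl.m_closed by blast
  ultimately show ?thesis using that k' by blast
qed

text \<open>Applying the isometry \<open>sr j\<close> turns separation of \<open>rho\<close> and s w
  \<open>rho\<close> by t into separation of s \<open>rho\<close> and w \<open>rho\<close> by s t s.
  Replacing s \<open>rho\<close> by \<open>rho\<close> changes the answer only if the wall lies
  between these two, and then it is the wall of s.\<close>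

lemma alcove_sep_mult:
  assumes t: "t \<in> cox_reflections affine_weyl simple_reflections" and j: "j < 5"
    and w: "w \<in> carrier affine_weyl"
  shows "alcove_sep t (sr j \<odot> w) \<longleftrightarrow> (t = sr j) \<noteq> alcove_sep (sr j \<odot> t \<odot> sr j) w"
proof -
  let ?s = "sr j" and ?t = "sr j \<odot> t \<odot> sr j"
  obtain \<beta>0 k0 where t0: "\<beta>0 \<in> coroots" "t \<in> carrier affine_weyl" "\<And>y. act t y = aff_refl \<beta>0 k0 y"
    using reflection_is_aff_refl[OF t] by metis
  have s: "?s \<in> carrier affine_weyl" using sr_carrier[OF j] .
  have ss: "act ?s (act ?s y) = y" for y
    using act_mult[OF s, of ?s y] sr_square[OF j] by (simp del: affine_weyl_simps)
  have act_t: "act ?t y = act ?s (act t (act ?s y))" for y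
    using s t0(2) affine_weyl.m_closed[OF s t0(2)] by (simp only: act_mult)
  obtain k where k: "snd ?s \<beta>0 \<in> coroots"
      "\<And>y. act ?s (aff_refl \<beta>0 k0 y) = aff_refl (snd ?s \<beta>0) k (act ?s y)"
    using aff_refl_conj[OF s t0(1)] by metis
  define \<beta> where "\<beta> = snd ?s \<beta>0"
  have \<beta>: "\<beta> \<in> coroots" "\<And>y. act ?t y = aff_refl \<beta> k y"
    using k t0(3) act_t ss by (simp_all add: \<beta>_def)
  define y where "y = act w rho"
  define r where "r = aff_refl (sroot j) (soff j) rho"
  have r: "r = act ?s rho" by (simp add: r_def act_sr)
  have yw: "act (?s \<odot> w) rho = act ?s y" by (simp only: act_mult[OF s] y_def)
  have rho: "act t rho = act ?s (act ?t r)" "rho = act ?s r" by (simp_all only: act_t r ss)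
  have y': "act t (act ?s y) = act ?s (act ?t y)" by (simp only: act_t ss)
  have "(rho - act t rho) \<bullet> (act ?s y - act t (act ?s y)) = (r - act ?t r) \<bullet> (y - act ?t y)"
    unfolding y' using act_inner[OF s] rho by metis
  hence lhs: "alcove_sep t (?s \<odot> w) \<longleftrightarrow> wall \<beta> k r * wall \<beta> k y < 0"
    unfolding alcove_sep_def yw using \<beta> aff_refl_sep by simp
  have rhs: "alcove_sep ?t w \<longleftrightarrow> wall \<beta> k rho * wall \<beta> k y < 0"
    unfolding alcove_sep_def y_def[symmetric] using \<beta> aff_refl_sep by simp
  have nz: "wall \<beta> k rho \<noteq> 0" "wall \<beta> k y \<noteq> 0" "wall \<beta> k r \<noteq> 0"
    using wall_rho_nonzero[OF \<beta>(1)] wall_act_rho_nonzero[OF w \<beta>(1)] wall_act_rho_nonzero[OF s \<beta>(1)]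
    by (simp_all add: y_def r)
  have conj: "?t = ?s \<longleftrightarrow> t = ?s"
  proof
    assume e: "?t = ?s"
    show "t = ?s"
    proof (rule act_inject[OF t0(2) s])
      fix y
      have "act ?s (act t (act ?s (act ?s y))) = act ?s (act ?s y)"
        using act_t[of "act ?s y"] e by simp
      hence "act ?s (act t y) = y" by (simp only: ss)
      thus "act t y = act ?s y" using ss by metis
    qed
  next
    assume "t = ?s"
    thus "?t = ?s" using sr_square[OF j] s by (simp del: affine_weyl_simps)
  qed
  show ?thesis
  proof (cases "t = ?s")
    case True
    have "aff_refl \<beta> k rho = r" using \<beta>(2)[of rho] conj True r by simp
    hence "wall \<beta> k r = - wall \<beta> k rho" using wall_aff_refl[OF \<beta>(1)] by metis
    hence "alcove_sep t (?s \<odot> w) \<longleftrightarrow> 0 < wall \<beta> k rho * wall \<beta> k y"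
      unfolding lhs by simp
    moreover have "wall \<beta> k rho * wall \<beta> k y \<noteq> 0" using nz by simp
    ultimately show ?thesis unfolding rhs using True by linarith
  next
    case False
    have "\<not> wall \<beta> k rho * wall \<beta> k r < 0"
    proof
      assume "wall \<beta> k rho * wall \<beta> k r < 0"
      hence "\<beta> = sroot j \<and> k = soff j \<or> \<beta> = - sroot j \<and> k = - soff j"
        unfolding r_def by (rule wall_separates_adjacent[OF \<beta>(1) j])
      hence "aff_refl \<beta> k y = aff_refl (sroot j) (soff j) y" for y
        by (auto simp: aff_refl_def wall_def algebra_simps)
      hence "?t = ?s"
        using \<beta>(2) act_sr affine_weyl.m_closed s t0(2) by (intro act_inject) simp_all
      thus False using conj False by blast
    qed
    thus ?thesis using lhs rhs False nz by (auto simp: mult_less_0_iff)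
  qed
qed

interpretation F4: coxeter_walls affine_weyl simple_reflections alcove_sep
proof unfold_locales
  show "simple_reflections \<subseteq> carrier affine_weyl" using simple_carrier by blast
  show "finite simple_reflections" by (simp add: simple_reflections_eq)
  show "s \<odot> s = \<one>\<^bsub>affine_weyl\<^esub>" if "s \<in> simple_reflections" for s
    using that sr_square unfolding simple_reflections_eq by blast
  show "\<exists>ss. set ss \<subseteq> simple_reflections \<and> foldr (\<odot>) ss \<one>\<^bsub>affine_weyl\<^esub> = w"
    if "w \<in> carrier affine_weyl" for w
    using generated_all[OF that] unfolding generated_def .
  show "\<not> alcove_sep t \<one>\<^bsub>affine_weyl\<^esub>" for t
    unfolding alcove_sep_def act_one by (simp add: not_less)
  show "alcove_sep t (s \<odot> w) \<longleftrightarrow> (t = s) \<noteq> alcove_sep (s \<odot> t \<odot> s) w"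
    if "t \<in> cox_reflections affine_weyl simple_reflections" "s \<in> simple_reflections"
      "w \<in> carrier affine_weyl" for t s w
    using that alcove_sep_mult unfolding simple_reflections_eq by blast
qed

lemma sr_simple: "j < 5 \<Longrightarrow> sr j \<in> simple_reflections"
  by (simp add: simple_reflections_eq)

lemma left_descent_iff:
  assumes "j < 5" "w \<in> carrier affine_weyl"
  shows "F4.len (sr j \<odot> w) < F4.len w \<longleftrightarrow> wall (sroot j) (soff j) (act w rho) < 0"
proof -
  have "F4.len (sr j \<odot> w) < F4.len w \<longleftrightarrow> alcove_sep (sr j) w"
    using F4.sep_iff_len[of "sr j" w] F4.S_in_T[OF sr_simple] assms by blast
  also have "\<dots> \<longleftrightarrow> wall (sroot j) (soff j) (act w rho) < 0"
    unfolding alcove_sep_def act_sr aff_refl_sep[OF sroot_coroot[OF assms(1)]]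
      wall_sroot_rho[OF assms(1)] by simp
  finally show ?thesis .
qed

lemma wall_sroot_pt:
  "wall (sroot 0) 1 (pt a b c d) = 1 - a - b"
  "wall (sroot (Suc 0)) 0 (pt a b c d) = b - c"
  "wall (sroot 2) 0 (pt a b c d) = c - d"
  "wall (sroot 3) 0 (pt a b c d) = d"
  "wall (sroot 4) 0 (pt a b c d) = (a - b - c - d) / 2"
  by (simp_all add: wall_def sroot_pt field_simps)

section \<open>The cell of elements with a unique reduced expression\<close>

text \<open>From right to left these are walks from node 0 along the affine F4 diagram 0-1-2-3-4. At
  node 3 the walk continues to 4 or turns back to 2; the double bond between 2 and 3 keeps 2, 3, 2
  free of braid moves.\<close>

definition vword :: "nat \<Rightarrow> nat list" where
  "vword i = [[], [0], [1, 0], [2, 1, 0], [3, 2, 1, 0], [4, 3, 2, 1, 0], [2, 3, 2, 1, 0],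
     [1, 2, 3, 2, 1, 0], [0, 1, 2, 3, 2, 1, 0]] ! i"

definition V :: "nat \<Rightarrow> aff_elt" where
  "V i = foldr (\<lambda>j w. sr j \<odot> w) (vword i) \<one>\<^bsub>affine_weyl\<^esub>"

definition vnbrs :: "nat \<Rightarrow> nat set" where
  "vnbrs i = [{}, {0, 2}, {1, 3}, {2, 4}, {3, 5, 6}, {4}, {4, 7}, {6, 8}, {7}] ! i"

lemma V_rec:
  "V 0 = \<one>\<^bsub>affine_weyl\<^esub>" "V (Suc 0) = sr 0 \<odot> V 0" "V 2 = sr (Suc 0) \<odot> V (Suc 0)"
  "V 3 = sr 2 \<odot> V 2" "V 4 = sr 3 \<odot> V 3" "V 5 = sr 4 \<odot> V 4" "V 6 = sr 2 \<odot> V 4"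
  "V 7 = sr (Suc 0) \<odot> V 6" "V 8 = sr 0 \<odot> V 7"
  by (simp_all add: V_def vword_def del: affine_weyl_simps)

lemma less_9_cases: "(i :: nat) < 9 \<longleftrightarrow>
    i = 0 \<or> i = 1 \<or> i = 2 \<or> i = 3 \<or> i = 4 \<or> i = 5 \<or> i = 6 \<or> i = 7 \<or> i = 8"
  by auto

lemma sr_mult_carrier:
  "j < 5 \<Longrightarrow> w \<in> carrier affine_weyl \<Longrightarrow> sr j \<odot> w \<in> carrier affine_weyl"
  using sr_carrier affine_weyl.m_closed by blast

lemma V_carrier_aux:
  "V 0 \<in> carrier affine_weyl" "V (Suc 0) \<in> carrier affine_weyl" "V 2 \<in> carrier affine_weyl"
  "V 3 \<in> carrier affine_weyl" "V 4 \<in> carrier affine_weyl" "V 5 \<in> carrier affine_weyl"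
  "V 6 \<in> carrier affine_weyl" "V 7 \<in> carrier affine_weyl" "V 8 \<in> carrier affine_weyl"
  by (simp_all add: V_rec sr_mult_carrier affine_weyl.one_closed del: affine_weyl_simps)

lemma V_carrier: "i < 9 \<Longrightarrow> V i \<in> carrier affine_weyl"
  unfolding less_9_cases using V_carrier_aux by (auto simp del: affine_weyl_simps)

lemma act_sr_mult: "j < 5 \<Longrightarrow> act (sr j \<odot> w) y = act (sr j) (act w y)"
  using act_mult sr_carrier by blast

lemma act_V_rho:
  "act (V 0) rho = pt (8/12) (3/12) (2/12) (1/12)"
  "act (V (Suc 0)) rho = pt (9/12) (4/12) (2/12) (1/12)"
  "act (V 2) rho = pt (9/12) (2/12) (4/12) (1/12)"
  "act (V 3) rho = pt (9/12) (2/12) (1/12) (4/12)"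
  "act (V 4) rho = pt (9/12) (2/12) (1/12) (-4/12)"
  "act (V 5) rho = pt (4/12) (7/12) (6/12) (1/12)"
  "act (V 6) rho = pt (9/12) (2/12) (-4/12) (1/12)"
  "act (V 7) rho = pt (9/12) (-4/12) (2/12) (1/12)"
  "act (V 8) rho = pt (16/12) (3/12) (2/12) (1/12)"
  by (simp_all add: V_rec act_sr_mult act_sr_pt rho_def del: affine_weyl_simps)

definition vpoint :: "nat \<Rightarrow> real ^ 4" where
  "vpoint i = [0, eps 1 + eps 2, eps 1 + eps 3, eps 1 + eps 4, eps 1 - eps 4, eps 2 + eps 3,
     eps 1 - eps 3, eps 1 - eps 2, 2 *\<^sub>R eps 1] ! i"

lemma vpoint_pt:
  "vpoint 0 = pt 0 0 0 0" "vpoint (Suc 0) = pt 1 1 0 0" "vpoint 2 = pt 1 0 1 0"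
  "vpoint 3 = pt 1 0 0 1" "vpoint 4 = pt 1 0 0 (-1)" "vpoint 5 = pt 0 1 1 0"
  "vpoint 6 = pt 1 0 (-1) 0" "vpoint 7 = pt 1 (-1) 0 0" "vpoint 8 = pt 2 0 0 0"
  by (simp_all add: vpoint_def eps_pt pt_zero)

lemma fst_sr_mult: "j < 5 \<Longrightarrow> fst (sr j \<odot> w) = act (sr j) (fst w)"
  by (cases "sr j"; cases w) (simp add: act_def)

lemma fst_V: "i < 9 \<Longrightarrow> fst (V i) = vpoint i"
proof -
  have 0: "fst (V 0) = pt 0 0 0 0" by (simp add: V_rec pt_zero)
  show "i < 9 \<Longrightarrow> fst (V i) = vpoint i"
    unfolding less_9_cases
    by (auto simp: V_rec(2-) fst_sr_mult 0 act_sr_pt vpoint_pt simp del: affine_weyl_simps)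
qed

lemma V_inj: "inj_on V {..<9}"
proof -
  have "inj_on vpoint {..<9}"
    by (rule inj_onI) (auto simp: less_9_cases vpoint_pt)
  thus ?thesis using fst_V by (metis inj_onD inj_onI lessThan_iff)
qed

lemma V_descent:
  assumes "i < 9" "j < 5"
  shows "F4.len (sr j \<odot> V i) < F4.len (V i) \<longleftrightarrow> i \<noteq> 0 \<and> j = hd (vword i)"
  unfolding left_descent_iff[OF assms(2) V_carrier[OF assms(1)]]
  using assms unfolding less_9_cases less_5_cases
  by (elim disjE; simp add: act_V_rho wall_sroot_pt vword_def)

lemma sr_inj: "inj_on sr {..<5}"
proof -
  have "inj_on (\<lambda>j. act (sr j) rho) {..<5}"
    by (rule inj_onI) (auto simp: less_5_cases rho_def act_sr_pt)
  thus ?thesis unfolding inj_on_def by simp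
qed

text \<open>The letters on the edges leading away from the identity in the tree. Together with the
  edge of the first letter they give all neighbours of a node other than the identity.\<close>

definition vup :: "nat \<Rightarrow> nat set" where
  "vup i = [{0}, {1}, {2}, {3}, {2, 4}, {}, {1}, {0}, {}] ! i"

lemma V_second_descent:
  assumes "0 < i" "i < 9" "k < 5" "k \<noteq> hd (vword i)"
  shows "\<not> F4.len (sr (hd (vword i)) \<odot> (sr k \<odot> V i)) < F4.len (sr k \<odot> V i) \<longleftrightarrow> k \<in> vup i"
proof -
  have "hd (vword i) < 5" using assms(1,2) by (auto simp: less_9_cases vword_def)
  note left_descent_iff[OF this sr_mult_carrier[OF assms(3) V_carrier[OF assms(2)]]]
  moreover have "wall (sroot (hd (vword i))) (soff (hd (vword i))) (act (sr k \<odot> V i) rho) < 0 \<longleftrightarrow> k \<notin> vup i"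
    unfolding act_sr_mult[OF assms(3)]
    using assms unfolding less_9_cases less_5_cases
    by (elim disjE; simp add: act_V_rho wall_sroot_pt act_sr_pt vword_def vup_def)
  ultimately show ?thesis by blast
qed

lemma V_neighbours:
  assumes "0 < i" "i < 9"
  shows "V ` vnbrs i = insert (sr (hd (vword i)) \<odot> V i) ((\<lambda>k. sr k \<odot> V i) ` vup i)"
proof -
  have cancel: "sr j \<odot> (sr j \<odot> w) = w" if "j < 5" "w \<in> carrier affine_weyl" for j w
    using F4.S_cancel(1)[OF sr_simple] that by blast
  note V_carrier_aux[simp] and affine_weyl_simps[simp del]
  show ?thesis
    using assms unfolding less_9_cases
    by (elim disjE; simp add: vword_def vup_def vnbrs_def)
      (simp_all add: V_rec(2) V_rec(3) V_rec(4) V_rec(5) V_rec(6) V_rec(7) V_rec(8) V_rec(9)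
        cancel sr_mult_carrier insert_commute)
qed

subsection \<open>The multiplicities\<close>

text \<open>The closed formulas in integer arithmetic, preceded by the constant 1 for the identity.
  The residues p, q, r are the three indicators, and \<open>(- a1) div 2\<close> is minus the
  ceiling of a1/2.\<close>

definition mult_coord :: "nat \<Rightarrow> int \<Rightarrow> int \<Rightarrow> int \<Rightarrow> int \<Rightarrow> int" where
  "mult_coord i a1 a2 a3 a4 =
    (let n = a1^2 + a2^2 + 2 * a3^2 + 2 * a4^2 - a1 * a2 - 2 * a2 * a3 - 2 * a3 * a4;
         p = a1 mod 2; q = (a1 - a2) mod 2; r = a2 mod 2 in
     [1, (2 * n + p + q + r) div 4, n - a1 div 2, (6 * n - 2 * a2 + p + q - r) div 4, 2 * n - a3,
      n - a4, (6 * n - 2 * a2 - p - q + r) div 4, n + (- a1) div 2, (2 * n - p - q - r) div 4] ! i)"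

text \<open>The arguments invert \<open>coroot_comb_pt\<close>. On the lattice they are integers, so
  that the floor is a mere conversion of type.\<close>

definition mult_at :: "nat \<Rightarrow> real ^ 4 \<Rightarrow> int" where
  "mult_at i x = mult_coord i \<lfloor>x $ 1 + x $ 2\<rfloor> \<lfloor>2 * x $ 1 + x $ 2 + x $ 3\<rfloor>
     \<lfloor>(3 * x $ 1 + x $ 2 + x $ 3 + x $ 4) / 2\<rfloor> \<lfloor>x $ 1\<rfloor>"

lemma mult_at_coroot_comb: "mult_at i (coroot_comb a1 a2 a3 a4) = mult_coord i a1 a2 a3 a4"
proof -
  have "(3 * of_int a4 + of_int (a1 - a4) + of_int (a2 - a1 - a4) + of_int (2 * a3 - a2 - a4)) / 2 = (of_int a3 :: real)"
    by simp
  moreover have "of_int a4 + of_int (a1 - a4) = (of_int a1 :: real)"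
    "2 * of_int a4 + of_int (a1 - a4) + of_int (a2 - a1 - a4) = (of_int a2 :: real)" by simp_all
  ultimately show ?thesis unfolding mult_at_def coroot_comb_pt pt_nth by (simp only: floor_of_int)
qed

lemma act_sr_coroot_comb:
  "act (sr 0) (coroot_comb a1 a2 a3 a4) = coroot_comb (2 - a1) (a2 + 3 * (1 - a1)) (a3 + 2 * (1 - a1)) (a4 + 1 - a1)"
  "act (sr (Suc 0)) (coroot_comb a1 a2 a3 a4) = coroot_comb (a2 - a1) a2 a3 a4"
  "act (sr 2) (coroot_comb a1 a2 a3 a4) = coroot_comb a1 (a1 + 2 * a3 - a2) a3 a4"
  "act (sr 3) (coroot_comb a1 a2 a3 a4) = coroot_comb a1 a2 (a2 + a4 - a3) a4"
  "act (sr 4) (coroot_comb a1 a2 a3 a4) = coroot_comb a1 a2 a3 (a3 - a4)"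
  by (simp_all add: coroot_comb_pt act_sr_pt)

text \<open>Four times \<open>mult_coord\<close>, with a1 and a2 split into halves b and parities e.
  For parities 0 and 1 this removes all divisions, and the step rule becomes a polynomial identity
  in each of four parity cases.\<close>

definition mult_poly :: "nat \<Rightarrow> int \<Rightarrow> int \<Rightarrow> int \<Rightarrow> int \<Rightarrow> int \<Rightarrow> int \<Rightarrow> int" where
  "mult_poly i b1 e1 b2 e2 a3 a4 =
    (let n = (2 * b1 + e1)^2 + (2 * b2 + e2)^2 + 2 * a3^2 + 2 * a4^2 -
         (2 * b1 + e1) * (2 * b2 + e2) - 2 * (2 * b2 + e2) * a3 - 2 * a3 * a4; q = \<bar>e1 - e2\<bar> in
     [4, 2 * n + e1 + q + e2, 4 * (n - b1), 6 * n - 2 * (2 * b2 + e2) + e1 + q - e2,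
      4 * (2 * n - a3), 4 * (n - a4), 6 * n - 2 * (2 * b2 + e2) - e1 - q + e2, 4 * (n - b1 - e1),
      2 * n - e1 - q - e2] ! i)"

lemma mult_coord_poly:
  fixes b1 b2 e1 e2 a3 a4 :: int
  assumes e12: "e1 \<in> {0, 1}" "e2 \<in> {0, 1}" and i: "i < 9"
  shows "4 * mult_coord i (2 * b1 + e1) (2 * b2 + e2) a3 a4 = mult_poly i b1 e1 b2 e2 a3 a4"
proof -
  define n where "n = (2 * b1 + e1)^2 + (2 * b2 + e2)^2 + 2 * a3^2 + 2 * a4^2 -
    (2 * b1 + e1) * (2 * b2 + e2) - 2 * (2 * b2 + e2) * a3 - 2 * a3 * a4"
  have e: "(2 * b1 + e1) mod 2 = e1" "(2 * b2 + e2) mod 2 = e2" "(2 * b1 + e1) div 2 = b1"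
      "(- (2 * b1 + e1)) div 2 = - b1 - e1" "(2 * b1 + e1 - (2 * b2 + e2)) mod 2 = \<bar>e1 - e2\<bar>"
    using e12 by (auto; presburger)+
  \<comment> \<open>This makes the first division by 4 exact. The other three dividends follow
    modulo 4 because the sum of e1, e2 and |e1 - e2| is even.\<close>
  have "2 * n + e1 + \<bar>e1 - e2\<bar> + e2 = 4 * (2 * b1^2 + 2 * b2^2 + 2 * b1 * e1 + 2 * b2 * e2
      - 2 * b1 * b2 - b1 * e2 - b2 * e1 + a3^2 + a4^2 - 2 * b2 * a3 - e2 * a3 - a3 * a4 + max e1 e2)"
    using e12 by (auto simp: n_def power2_eq_square algebra_simps)
  then obtain k where k: "2 * n + e1 + \<bar>e1 - e2\<bar> + e2 = 4 * k" by blast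
  have d: "4 dvd x \<Longrightarrow> 4 * (x div 4) = x" for x :: int by simp
  have q: "\<bar>e1 - e2\<bar> = e1 + e2 - 2 * (e1 * e2)" "e1 * e2 = 0 \<or> e1 * e2 = 1" using e12 by auto
  have dv: "4 dvd 2 * n + e1 + \<bar>e1 - e2\<bar> + e2"
    "4 dvd 6 * n - 2 * (2 * b2 + e2) + e1 + \<bar>e1 - e2\<bar> - e2"
    "4 dvd 6 * n - 2 * (2 * b2 + e2) - e1 - \<bar>e1 - e2\<bar> + e2"
    "4 dvd 2 * n - e1 - \<bar>e1 - e2\<bar> - e2"
    using k q by presburger+
  note m = mult_coord_def[of _ "2 * b1 + e1" "2 * b2 + e2" a3 a4, unfolded Let_def e, folded n_def]
  note r = mult_poly_def[of _ b1 e1 b2 e2 a3 a4, unfolded Let_def, folded n_def]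
  show ?thesis
    using i unfolding less_9_cases m r
    by (elim disjE) (use d[OF dv(1)] d[OF dv(2)] d[OF dv(3)] d[OF dv(4)] in \<open>simp_all\<close>)
qed

text \<open>The arguments on the left are the halves and parities of the coordinates in
  \<open>act_sr_coroot_comb\<close>. Corrections such as e1 (1 - e2) are borrows, as in e2 - e1 =
  |e1 - e2| - 2 e1 (1 - e2).\<close>

lemma mult_poly_step:
  fixes b1 b2 e1 e2 a3 a4 :: int
  assumes "e1 \<in> {0, 1}" "e2 \<in> {0, 1}" "i < 9"
  shows "mult_poly i (1 - b1 - e1) e1 (b2 - 3 * b1 + (1 - e1) * (1 + e2)) (1 - \<bar>e1 - e2\<bar>)
      (a3 + 2 * (1 - (2 * b1 + e1))) (a4 + 1 - (2 * b1 + e1)) = (if i \<noteq> 0 \<and> 0 = hd (vword i)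
      then (\<Sum>k\<in>vnbrs i. mult_poly k b1 e1 b2 e2 a3 a4) - mult_poly i b1 e1 b2 e2 a3 a4
      else mult_poly i b1 e1 b2 e2 a3 a4)" (is ?A)
    and "mult_poly i (b2 - b1 - e1 * (1 - e2)) \<bar>e1 - e2\<bar> b2 e2 a3 a4 = (if i \<noteq> 0 \<and> Suc 0 = hd (vword i)
      then (\<Sum>k\<in>vnbrs i. mult_poly k b1 e1 b2 e2 a3 a4) - mult_poly i b1 e1 b2 e2 a3 a4
      else mult_poly i b1 e1 b2 e2 a3 a4)" (is ?B)
    and "mult_poly i b1 e1 (b1 + a3 - b2 - e2 * (1 - e1)) \<bar>e1 - e2\<bar> a3 a4 = (if i \<noteq> 0 \<and> 2 = hd (vword i)
      then (\<Sum>k\<in>vnbrs i. mult_poly k b1 e1 b2 e2 a3 a4) - mult_poly i b1 e1 b2 e2 a3 a4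
      else mult_poly i b1 e1 b2 e2 a3 a4)" (is ?C)
    and "mult_poly i b1 e1 b2 e2 (2 * b2 + e2 + a4 - a3) a4 = (if i \<noteq> 0 \<and> 3 = hd (vword i)
      then (\<Sum>k\<in>vnbrs i. mult_poly k b1 e1 b2 e2 a3 a4) - mult_poly i b1 e1 b2 e2 a3 a4
      else mult_poly i b1 e1 b2 e2 a3 a4)" (is ?D)
    and "mult_poly i b1 e1 b2 e2 a3 (a3 - a4) = (if i \<noteq> 0 \<and> 4 = hd (vword i)
      then (\<Sum>k\<in>vnbrs i. mult_poly k b1 e1 b2 e2 a3 a4) - mult_poly i b1 e1 b2 e2 a3 a4
      else mult_poly i b1 e1 b2 e2 a3 a4)" (is ?E)
proof -
  have e: "e1 = 0 \<and> e2 = 0 \<or> e1 = 0 \<and> e2 = 1 \<or> e1 = 1 \<and> e2 = 0 \<or> e1 = 1 \<and> e2 = 1"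
    using assms by auto
  note defs = mult_poly_def Let_def vnbrs_def vword_def
  show ?A using e assms(3) unfolding less_9_cases
    by (elim disjE conjE) (simp_all add: defs power2_eq_square algebra_simps)
  show ?B using e assms(3) unfolding less_9_cases
    by (elim disjE conjE) (simp_all add: defs power2_eq_square algebra_simps)
  show ?C using e assms(3) unfolding less_9_cases
    by (elim disjE conjE) (simp_all add: defs power2_eq_square algebra_simps)
  show ?D using e assms(3) unfolding less_9_cases
    by (elim disjE conjE) (simp_all add: defs power2_eq_square algebra_simps)
  show ?E using e assms(3) unfolding less_9_cases
    by (elim disjE conjE) (simp_all add: defs power2_eq_square algebra_simps)
qed

lemma parity_split:
  fixes a :: int
  obtains b e where "a = 2 * b + e" "e \<in> {0, 1}"
proof -
  have "a = 2 * (a div 2) + a mod 2" "a mod 2 \<in> {0, 1}" by auto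
  thus ?thesis by (rule that)
qed

lemma vnbrs_less: "i < 9 \<Longrightarrow> vnbrs i \<subseteq> {..<9}" "i < 9 \<Longrightarrow> finite (vnbrs i)"
  unfolding less_9_cases by (auto simp: vnbrs_def)

lemma mult_at_step:
  assumes x: "x \<in> coroot_lattice" and i: "i < 9" and j: "j < 5"
  shows "mult_at i (act (sr j) x) = (if i \<noteq> 0 \<and> j = hd (vword i)
    then (\<Sum>k\<in>vnbrs i. mult_at k x) - mult_at i x else mult_at i x)"
proof -
  obtain a1 a2 a3 a4 where x: "x = coroot_comb a1 a2 a3 a4" using x by (auto simp: coroot_lattice_def)
  obtain b1 e1 b2 e2 where e: "a1 = 2 * b1 + e1" "e1 \<in> {0, 1}" "a2 = 2 * b2 + e2" "e2 \<in> {0, 1}"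
    using parity_split[of a1] parity_split[of a2] by metis
  have q: "\<bar>e1 - e2\<bar> \<in> {0, 1}" "1 - \<bar>e1 - e2\<bar> \<in> {0, 1}" using e by auto
  have M: "4 * mult_at k x = mult_poly k b1 e1 b2 e2 a3 a4" if "k < 9" for k
    unfolding x mult_at_coroot_comb e(1,3) by (rule mult_coord_poly[OF e(2,4) that])
  have "4 * mult_at i (act (sr j) x) = (if i \<noteq> 0 \<and> j = hd (vword i)
      then (\<Sum>k\<in>vnbrs i. mult_poly k b1 e1 b2 e2 a3 a4) - mult_poly i b1 e1 b2 e2 a3 a4
      else mult_poly i b1 e1 b2 e2 a3 a4)"
  proof -
    note step = mult_poly_step[OF e(2,4) i]
    note P = mult_coord_poly[OF _ _ i]
    consider "j = 0" | "j = Suc 0" | "j = 2" | "j = 3" | "j = 4" using j by force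
    thus ?thesis
    proof cases
      case 1
      have a: "2 - a1 = 2 * (1 - b1 - e1) + e1"
        "a2 + 3 * (1 - a1) = 2 * (b2 - 3 * b1 + (1 - e1) * (1 + e2)) + (1 - \<bar>e1 - e2\<bar>)"
        using e by auto
      show ?thesis
        unfolding 1 x act_sr_coroot_comb mult_at_coroot_comb a P[OF e(2) q(2)]
        unfolding e(1) by (rule step(1))
    next
      case 2
      have a: "a2 - a1 = 2 * (b2 - b1 - e1 * (1 - e2)) + \<bar>e1 - e2\<bar>" using e by auto
      show ?thesis
        unfolding 2 x act_sr_coroot_comb mult_at_coroot_comb a
        unfolding e(3) P[OF q(1) e(4)] by (rule step(2))
    next
      case 3
      have a: "a1 + 2 * a3 - a2 = 2 * (b1 + a3 - b2 - e2 * (1 - e1)) + \<bar>e1 - e2\<bar>" using e by auto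
      show ?thesis
        unfolding 3 x act_sr_coroot_comb mult_at_coroot_comb a
        unfolding e(1) P[OF e(2) q(1)] by (rule step(3))
    next
      case 4
      show ?thesis
        unfolding 4 x act_sr_coroot_comb mult_at_coroot_comb
        unfolding e(1,3) P[OF e(2,4)] by (rule step(4))
    next
      case 5
      show ?thesis
        unfolding 5 x act_sr_coroot_comb mult_at_coroot_comb
        unfolding e(1,3) P[OF e(2,4)] by (rule step(5))
    qed
  qed
  moreover have "(\<Sum>k\<in>vnbrs i. mult_poly k b1 e1 b2 e2 a3 a4) = 4 * (\<Sum>k\<in>vnbrs i. mult_at k x)"
    unfolding sum_distrib_left using vnbrs_less[OF i] M by (intro sum.cong) auto
  ultimately show ?thesis using M[OF i] by (auto split: if_splits)
qed

text \<open>Left multiplication acts on the translation part by the affine action, so the recursion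
  for functions of w becomes \<open>mult_at_step\<close> for functions on the lattice.\<close>

theorem inv_KL_V:
  assumes "i < 9" "w \<in> carrier affine_weyl"
  shows "inv_KL affine_weyl simple_reflections (V i) w = mult_at i (fst w)"
proof (rule F4.inv_KL_cell[where I = "{..<9}" and V = V and N = vnbrs and m = "\<lambda>i w. mult_at i (fst w)"])
  show "inj_on V {..<9}" by (rule V_inj)
  show "V ` {..<9} \<subseteq> carrier affine_weyl" using V_carrier by blast
  show "vnbrs i \<subseteq> {..<9}" "finite (vnbrs i)" if "i \<in> {..<9}" for i using that vnbrs_less by auto
  show "mult_at i (fst \<one>\<^bsub>affine_weyl\<^esub>) = of_bool (V i = \<one>\<^bsub>affine_weyl\<^esub>)" if "i \<in> {..<9}" for i
  proof -
    have "V i = \<one>\<^bsub>affine_weyl\<^esub> \<longleftrightarrow> i = 0"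
      using inj_onD[OF V_inj, of i 0] that V_rec(1) by (auto simp del: affine_weyl_simps)
    moreover have "fst \<one>\<^bsub>affine_weyl\<^esub> = coroot_comb 0 0 0 0" by (simp add: coroot_comb_def)
    moreover have "mult_coord i 0 0 0 0 = of_bool (i = 0)"
      using that unfolding lessThan_iff less_9_cases by (auto simp: mult_coord_def)
    ultimately show ?thesis by (simp only: mult_at_coroot_comb)
  qed
  have hd: "hd (vword i) < 5" if "i < 9" "i \<noteq> 0" for i
    using that by (auto simp: less_9_cases vword_def)
  have desc: "F4.len (s \<odot> V i) < F4.len (V i) \<longleftrightarrow> i \<noteq> 0 \<and> s = sr (hd (vword i))"
    if "i < 9" "s \<in> simple_reflections" for i s
    using that V_descent[of i] hd[of i] inj_onD[OF sr_inj] unfolding simple_reflections_eq by fastforce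
  show "mult_at i (fst (s \<odot> w)) = (if F4.len (s \<odot> V i) < F4.len (V i)
      then (\<Sum>j\<in>vnbrs i. mult_at j (fst w)) - mult_at i (fst w) else mult_at i (fst w))"
    if i: "i \<in> {..<9}" and s: "s \<in> simple_reflections" and w: "w \<in> carrier affine_weyl" for i s w
  proof -
    obtain j where j: "s = sr j" "j < 5" using s unfolding simple_reflections_eq by blast
    have "fst w \<in> coroot_lattice" using w by auto
    thus ?thesis
      using mult_at_step[of "fst w" i j] V_descent[of i j] i j fst_sr_mult[of j w] by simp
  qed
  show "s = t" if "i \<in> {..<9}" "s \<in> simple_reflections" "t \<in> simple_reflections"
      "F4.len (s \<odot> V i) < F4.len (V i)" "F4.len (t \<odot> V i) < F4.len (V i)" for i s t
    using that desc by simp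
  show "V ` vnbrs i = insert (s \<odot> V i) {t \<odot> V i | t. t \<in> simple_reflections \<and> t \<noteq> s \<and>
      \<not> F4.len (s \<odot> (t \<odot> V i)) < F4.len (t \<odot> V i)}"
    if i: "i \<in> {..<9}" and s: "s \<in> simple_reflections" "F4.len (s \<odot> V i) < F4.len (V i)" for i s
  proof -
    have i9: "i < 9" "0 < i" and s': "s = sr (hd (vword i))" using i desc[OF _ s(1), of i] s(2) by auto
    have h5: "hd (vword i) < 5" using hd i9 by simp
    have up: "vup i \<subseteq> {..<5} - {hd (vword i)}" using i9 by (auto simp: less_9_cases vup_def vword_def)
    have "(\<lambda>k. sr k \<odot> V i) ` vup i = {t \<odot> V i | t. t \<in> simple_reflections \<and> t \<noteq> s \<and>
        \<not> F4.len (s \<odot> (t \<odot> V i)) < F4.len (t \<odot> V i)}" (is "?L = ?R")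
    proof (intro equalityI subsetI)
      fix g assume "g \<in> ?L"
      then obtain k where k: "k \<in> vup i" "g = sr k \<odot> V i" by blast
      have "k < 5" "k \<noteq> hd (vword i)" using up k by auto
      moreover from this have "sr k \<noteq> s" using inj_onD[OF sr_inj, of k "hd (vword i)"] h5 s' by auto
      ultimately show "g \<in> ?R"
        using V_second_descent[OF i9(2,1)] k sr_simple[of k] s' by blast
    next
      fix g assume "g \<in> ?R"
      then obtain k where k: "k < 5" "g = sr k \<odot> V i" "sr k \<noteq> s"
          "\<not> F4.len (s \<odot> (sr k \<odot> V i)) < F4.len (sr k \<odot> V i)"
        unfolding simple_reflections_eq by blast
      hence "k \<noteq> hd (vword i)" using s' by blast
      thus "g \<in> ?L" using V_second_descent[OF i9(2,1) k(1)] k s' by blast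
    qed
    thus ?thesis unfolding V_neighbours[OF i9(2,1)] s' by simp
  qed
qed (use assms in auto)

subsection \<open>Minimal coset representatives\<close>

lemma w_min_coset: "w \<in> translation x <#\<^bsub>affine_weyl\<^esub> (embed_weyl ` weyl_group) \<longleftrightarrow>
    fst w = x \<and> snd w \<in> weyl_group"
  unfolding l_coset_def by (cases w) (auto simp: translation_def embed_weyl_def)

lemma w_min_props:
  assumes "x \<in> coroot_lattice"
  shows "w_min x \<in> carrier affine_weyl" "fst (w_min x) = x"
    "\<And>w. w \<in> carrier affine_weyl \<Longrightarrow> fst w = x \<Longrightarrow> F4.len (w_min x) \<le> F4.len w"
proof -
  let ?P = "\<lambda>w. fst w = x \<and> snd w \<in> weyl_group"
  have eq: "w_min x = arg_min F4.len ?P" unfolding w_min_def w_min_coset ..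
  have "?P (x, id)" by (simp add: weyl_group.id)
  note min = arg_min_nat_lemma[of ?P, OF this, of F4.len]
  show "fst (w_min x) = x" using min eq by simp
  show "w_min x \<in> carrier affine_weyl" using min eq assms by (simp add: mem_Times_iff)
  fix w assume "w \<in> carrier affine_weyl" "fst w = x"
  thus "F4.len (w_min x) \<le> F4.len w" using min eq by (cases w) auto
qed

text \<open>Weyl images of \<open>rho\<close> pair with roots to at most 11/12. Hence a wall value
  at \<open>act w rho\<close> exceeds the one at the vertex \<open>fst w\<close> by less than
  1.\<close>

lemma coroot_height_less_one:
  assumes "u \<in> weyl_group" "\<beta> \<in> coroots" shows "2 * (u rho \<bullet> \<beta>) / (\<beta> \<bullet> \<beta>) < 1"
proof -
  obtain v where v: "v \<in> weyl_group" "u \<circ> v = id" using weyl_inverse assms by blast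
  have "u (v \<beta>) = \<beta>" using v(2) by (simp add: fun_eq_iff)
  hence e: "u rho \<bullet> \<beta> = rho \<bullet> v \<beta>" "\<beta> \<bullet> \<beta> = v \<beta> \<bullet> v \<beta>"
    using weyl_inner[OF assms(1), of rho "v \<beta>"] weyl_inner[OF v(1), of \<beta> \<beta>] by simp_all
  obtain h :: int where "2 * (rho \<bullet> v \<beta>) / (v \<beta> \<bullet> v \<beta>) = of_int h / 12" "\<bar>h\<bar> \<le> 11"
    using coroot_height[OF weyl_coroot[OF v(1) assms(2)]] by blast
  thus ?thesis unfolding e by simp
qed

definition vpred :: "nat \<Rightarrow> nat" where
  "vpred i = [0, 0, 1, 2, 3, 4, 4, 6, 7] ! i"

lemma V_pred:
  assumes "i < 9" "i \<noteq> 0"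
  shows "vpred i < 9" "hd (vword i) < 5" "length (vword i) = Suc (length (vword (vpred i)))"
    "V i = sr (hd (vword i)) \<odot> V (vpred i)" "act (sr (hd (vword i))) (vpoint i) = vpoint (vpred i)"
    "wall (sroot (hd (vword i))) (soff (hd (vword i))) (vpoint i) = -1"
proof -
  note i = assms[unfolded less_9_cases]
  show "vpred i < 9" "hd (vword i) < 5" "length (vword i) = Suc (length (vword (vpred i)))"
    "act (sr (hd (vword i))) (vpoint i) = vpoint (vpred i)"
    "wall (sroot (hd (vword i))) (soff (hd (vword i))) (vpoint i) = -1"
    using i by (elim disjE; simp add: vword_def vpred_def vpoint_pt act_sr_pt wall_sroot_pt)+
  show "V i = sr (hd (vword i)) \<odot> V (vpred i)"
    using i by (elim disjE; simp add: vword_def vpred_def V_rec(2-) del: affine_weyl_simps)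
qed

text \<open>The wall of the first letter has the value -1 at \<open>vpoint i\<close>, so by
  \<open>coroot_height_less_one\<close> it is negative at every alcove based there. The letter is
  thus a descent of each w in the coset; it is stripped off, and induction applies at the preceding
  vertex.\<close>

lemma V_unique:
  assumes "i < 9" "w \<in> carrier affine_weyl" "fst w = vpoint i" "F4.len w \<le> length (vword i)"
  shows "w = V i"
  using assms
proof (induction "length (vword i)" arbitrary: i w)
  case 0
  hence "i = 0" using V_pred(3)[of i] by auto
  moreover have "w = \<one>\<^bsub>affine_weyl\<^esub>" using F4.len_eq_0[of w] 0 by (simp del: affine_weyl_simps)
  ultimately show ?case by (simp only: V_rec(1))
next
  case (Suc n)
  have i0: "i \<noteq> 0" using Suc.hyps(2) by (intro notI) (simp add: vword_def)
  note p = V_pred[OF Suc.prems(1) i0]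
  let ?j = "hd (vword i)"
  obtain u where u: "w = (vpoint i, u)" "u \<in> weyl_group" using Suc.prems by (cases w) auto
  have "wall (sroot ?j) (soff ?j) (act w rho) =
      wall (sroot ?j) (soff ?j) (vpoint i) + 2 * (u rho \<bullet> sroot ?j) / (sroot ?j \<bullet> sroot ?j)"
    by (simp add: u act_def wall_def inner_add_left distrib_left add_divide_distrib)
  hence "wall (sroot ?j) (soff ?j) (act w rho) < 0"
    using coroot_height_less_one[OF u(2) sroot_coroot[OF p(2)]] p(6) by linarith
  hence "F4.len (sr ?j \<odot> w) < F4.len w"
    using left_descent_iff[OF p(2) Suc.prems(2)] by blast
  hence "F4.len (sr ?j \<odot> w) \<le> length (vword (vpred i))" using Suc.prems(4) p(3) by simp
  moreover have "fst (sr ?j \<odot> w) = vpoint (vpred i)"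
    using fst_sr_mult[OF p(2)] Suc.prems(3) p(5) by simp
  ultimately have "sr ?j \<odot> w = V (vpred i)"
    using Suc.hyps p sr_mult_carrier[OF p(2) Suc.prems(2)] by simp
  thus ?case
    using p(4) F4.S_cancel(1)[OF sr_simple[OF p(2)] Suc.prems(2)] by simp
qed

lemma len_V: "i < 9 \<Longrightarrow> F4.len (V i) \<le> length (vword i)"
proof -
  assume i: "i < 9"
  have "V i = foldr (\<odot>) (map sr (vword i)) \<one>\<^bsub>affine_weyl\<^esub>"
    by (simp add: V_def foldr_map comp_def del: affine_weyl_simps)
  moreover have "set (vword i) \<subseteq> {..<5}" using i by (auto simp: less_9_cases vword_def)
  hence "set (map sr (vword i)) \<subseteq> simple_reflections" by (auto simp: simple_reflections_eq)
  ultimately show ?thesis using F4.len_le[of "map sr (vword i)"] by (simp del: affine_weyl_simps)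
qed

text \<open>An upper bound for the length of \<open>V i\<close> suffices: the minimal element
  inherits it, and \<open>V_unique\<close> identifies the two.\<close>

lemma w_min_vpoint:
  assumes "i < 9" shows "w_min (vpoint i) = V i"
proof -
  have "vpoint i \<in> coroot_lattice" using V_carrier[OF assms] fst_V[OF assms] by auto
  note m = w_min_props[OF this]
  have "F4.len (w_min (vpoint i)) \<le> length (vword i)"
    using m(3)[OF V_carrier[OF assms] fst_V[OF assms]] len_V[OF assms] by simp
  thus ?thesis using V_unique[OF assms m(1,2)] by simp
qed

lemma m_aff_w_min:
  assumes "i < 9"
  shows "m_aff (w_min (vpoint i)) (w_min (coroot_comb a1 a2 a3 a4)) = of_int (mult_coord i a1 a2 a3 a4)"
proof -
  have "coroot_comb a1 a2 a3 a4 \<in> coroot_lattice" by (auto simp: coroot_lattice_def)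
  note m = w_min_props[OF this]
  show ?thesis
    unfolding w_min_vpoint[OF assms] inv_KL_V[OF assms m(1)] m(2) mult_at_coroot_comb ..
qed

theorem theorem7p13:
  fixes a1 a2 a3 a4 :: int and \<gamma> :: "real ^ 4"
  assumes "\<gamma> = coroot_comb a1 a2 a3 a4"
  shows
    "m_aff (w_min (eps 1 + eps 2)) (w_min \<gamma>) =
       1/2 * sq_length \<gamma> + 1/4 * (of_bool (\<not> [a1 = 0] (mod 2)) + of_bool (\<not> [a1 = a2] (mod 2))
                                 + of_bool (\<not> [a2 = 0] (mod 2))) \<and>
     m_aff (w_min (eps 1 + eps 3)) (w_min \<gamma>) =
       sq_length \<gamma> - of_int \<lfloor>real_of_int a1 / 2\<rfloor> \<and>
     m_aff (w_min (eps 1 + eps 4)) (w_min \<gamma>) =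
       3/2 * sq_length \<gamma> - 1/2 * of_int a2
         + 1/4 * (of_bool (\<not> [a1 = 0] (mod 2)) + of_bool (\<not> [a1 = a2] (mod 2))
                  - of_bool (\<not> [a2 = 0] (mod 2))) \<and>
     m_aff (w_min (eps 1 - eps 4)) (w_min \<gamma>) =
       2 * sq_length \<gamma> - of_int a3 \<and>
     m_aff (w_min (eps 2 + eps 3)) (w_min \<gamma>) =
       sq_length \<gamma> - of_int a4 \<and>
     m_aff (w_min (eps 1 - eps 3)) (w_min \<gamma>) =
       3/2 * sq_length \<gamma> - 1/2 * of_int a2
         - 1/4 * (of_bool (\<not> [a1 = 0] (mod 2)) + of_bool (\<not> [a1 = a2] (mod 2))
                  - of_bool (\<not> [a2 = 0] (mod 2))) \<and>
     m_aff (w_min (eps 1 - eps 2)) (w_min \<gamma>) =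
       sq_length \<gamma> - of_int \<lceil>real_of_int a1 / 2\<rceil> \<and>
     m_aff (w_min (2 *\<^sub>R eps 1)) (w_min \<gamma>) =
       1/2 * sq_length \<gamma> - 1/4 * (of_bool (\<not> [a1 = 0] (mod 2)) + of_bool (\<not> [a1 = a2] (mod 2))
                                 + of_bool (\<not> [a2 = 0] (mod 2)))"
proof -
  obtain b1 e1 b2 e2 where e: "a1 = 2 * b1 + e1" "e1 \<in> {0, 1}" "a2 = 2 * b2 + e2" "e2 \<in> {0, 1}"
    using parity_split[of a1] parity_split[of a2] by metis
  \<comment> \<open>Over the common denominator 4, everything is expressed in the halves b and
    parities e: the indicators become e1, |e1 - e2| and e2, the floor b1 and the ceiling b1 +
    e1.\<close>
  have M: "m_aff (w_min (vpoint i)) (w_min \<gamma>) = of_int (mult_poly i b1 e1 b2 e2 a3 a4) / 4" if "i < 9" for i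
    using mult_coord_poly[OF e(2,4) that, of b1 b2 a3 a4, symmetric]
    unfolding assms m_aff_w_min[OF that] e(1,3) by simp
  have p: "of_bool (\<not> [a1 = 0] (mod 2)) = real_of_int e1" "of_bool (\<not> [a2 = 0] (mod 2)) = real_of_int e2"
      "of_bool (\<not> [a1 = a2] (mod 2)) = real_of_int \<bar>e1 - e2\<bar>"
    unfolding cong_def using e by (auto; presburger)+
  have "\<lfloor>real_of_int a1 / 2\<rfloor> = a1 div 2" using floor_divide_of_int_eq[of a1 2] by simp
  hence f: "\<lfloor>real_of_int a1 / 2\<rfloor> = b1" using e(1,2) by auto
  have "\<lceil>real_of_int a1 / 2\<rceil> = - ((- a1) div 2)"
    using ceiling_divide_eq_div[of a1 2] by simp
  hence c: "\<lceil>real_of_int a1 / 2\<rceil> = b1 + e1" using e(1,2) by auto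
  have v: "vpoint 1 = eps 1 + eps 2" "vpoint 2 = eps 1 + eps 3" "vpoint 3 = eps 1 + eps 4"
    "vpoint 4 = eps 1 - eps 4" "vpoint 5 = eps 2 + eps 3" "vpoint 6 = eps 1 - eps 3"
    "vpoint 7 = eps 1 - eps 2" "vpoint 8 = 2 *\<^sub>R eps 1"
    by (simp_all add: vpoint_def)
  have m: "m_aff (w_min (eps 1 + eps 2)) (w_min \<gamma>) = of_int (mult_poly 1 b1 e1 b2 e2 a3 a4) / 4"
    "m_aff (w_min (eps 1 + eps 3)) (w_min \<gamma>) = of_int (mult_poly 2 b1 e1 b2 e2 a3 a4) / 4"
    "m_aff (w_min (eps 1 + eps 4)) (w_min \<gamma>) = of_int (mult_poly 3 b1 e1 b2 e2 a3 a4) / 4"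
    "m_aff (w_min (eps 1 - eps 4)) (w_min \<gamma>) = of_int (mult_poly 4 b1 e1 b2 e2 a3 a4) / 4"
    "m_aff (w_min (eps 2 + eps 3)) (w_min \<gamma>) = of_int (mult_poly 5 b1 e1 b2 e2 a3 a4) / 4"
    "m_aff (w_min (eps 1 - eps 3)) (w_min \<gamma>) = of_int (mult_poly 6 b1 e1 b2 e2 a3 a4) / 4"
    "m_aff (w_min (eps 1 - eps 2)) (w_min \<gamma>) = of_int (mult_poly 7 b1 e1 b2 e2 a3 a4) / 4"
    "m_aff (w_min (2 *\<^sub>R eps 1)) (w_min \<gamma>) = of_int (mult_poly 8 b1 e1 b2 e2 a3 a4) / 4"
    unfolding v[symmetric] by (rule M; simp)+
  define n where "n = a1^2 + a2^2 + 2 * a3^2 + 2 * a4^2 - a1 * a2 - 2 * a2 * a3 - 2 * a3 * a4"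
  have sq: "sq_length \<gamma> = of_int n" unfolding assms n_def by (rule sq_length_coroot_comb)
  have r: "mult_poly 1 b1 e1 b2 e2 a3 a4 = 2 * n + e1 + \<bar>e1 - e2\<bar> + e2"
    "mult_poly 2 b1 e1 b2 e2 a3 a4 = 4 * (n - b1)"
    "mult_poly 3 b1 e1 b2 e2 a3 a4 = 6 * n - 2 * (2 * b2 + e2) + e1 + \<bar>e1 - e2\<bar> - e2"
    "mult_poly 4 b1 e1 b2 e2 a3 a4 = 4 * (2 * n - a3)"
    "mult_poly 5 b1 e1 b2 e2 a3 a4 = 4 * (n - a4)"
    "mult_poly 6 b1 e1 b2 e2 a3 a4 = 6 * n - 2 * (2 * b2 + e2) - e1 - \<bar>e1 - e2\<bar> + e2"
    "mult_poly 7 b1 e1 b2 e2 a3 a4 = 4 * (n - b1 - e1)"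
    "mult_poly 8 b1 e1 b2 e2 a3 a4 = 2 * n - e1 - \<bar>e1 - e2\<bar> - e2"
    by (simp_all add: mult_poly_def Let_def n_def e(1,3))
  show ?thesis
    unfolding m r sq p f c by (simp add: e(3) field_simps)
qed

end
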